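(* Let $n\ge1$, $r\ge n+1$ be integers and let $K$ be a field of characteristic $p>2(n+1)$. Let $V=K^n$ with a symmetric bilinear form admitting an orthonormal basis, $B_r(n)$ the $r$-string Brauer algebra over $K$ with parameter $n$, and $\nu:B_r(n)\to\mathrm{End}_{\mathrm{O}(V)}(V^{\otimes r})\subseteq\mathrm{End}(V^{\otimes r})$ the Brauer homomorphism. Then $\ker(\nu)=\langle E\rangle$, the two-sided ideal of $B_r(n)$ generated by $E=E_{\lfloor (n+1)/2\rfloor}$.
   Context: Brauer algebra: for a commutative ring $R$ and $\delta\in R$, $B_r^R(\delta)$ is the $R$-algebra, free over $R$ with basis the Brauer diagrams, i.e. the perfect matchings of $2r$ vertices, arranged as top row $1,\dots,r$ and bottom row $r+1,\dots,2r$ (vertex $r+i$ below vertex $i$). The product $D_1D_2$ is $\delta^{l}D_1\circ D_2$, where $D_1\circ D_2$ is obtained by placing $D_1$ above $D_2$, erasing the intermediate vertices and the closed loops, and $l$ is the number of loops erased. $B_r(n)=B_r^K(n)$. A permutation $\sigma\in\mathrm{Sym}_r$ is identified with the diagram with edges $(\sigma(i),r+i)$, $1\le i\le r$. For $1\le i<j\le r$, $e_{i,j}$ is the diagram with edges $(i,j)$, $(r+i,r+j)$ and $(k,r+k)$ for $k\neq i,j$; $e_i:=e_{i,i+1}$. The map $\nu$: $V$ has a basis $b_1,\dots,b_n$ with $(b_i,b_j)=\delta_{ij}$; $\mathrm{O}(V)$ is the isometry group of the form. $\nu$ is the algebra homomorphism with $\nu(\sigma)(v_1\otimes\dots\otimes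 v_r)=v_{\sigma^{-1}(1)}\otimes\dots\otimes v_{\sigma^{-1}(r)}$ for $\sigma\in\mathrm{Sym}_r$, and $\nu(e_i)$ acting on factors $i,i+1$ by $v\otimes w\mapsto (v,w)\sum_{k=1}^n b_k\otimes b_k$ and as the identity on the other factors. The elements $E_i$: for $1\le k<l\le r$ let $a(k,l)=\sum_{\sigma\in\mathrm{Sym}\{k,\dots,l\}}\varepsilon(\sigma)\sigma$ ($\varepsilon$ the sign character); $a(k,l)=1$ if $k\ge l$. For $0\le i\le\lfloor\frac{n+1}2\rfloor$ let $F_i=a(1,i)a(i+1,n+1)$; for $0\le j\le i$ let $e_i(j)=e_{i,i+1}e_{i-1,i+2}\cdots e_{i-j+1,i+j}$ ($e_i(0)=1$); and $$E_i=\sum_{j=0}^i(-1)^jc_i(j)F_ie_i(j)F_i,\qquad c_i(j)=\big((i-j)!\,(n+1-i-j)!\,(j!)^2\big)^{-1}.$$ Computed over $\mathbb{Q}$, $E_i$ is a linear combination of diagrams with coefficients $\pm1$, so it lies in $B_r^{\mathbb Z}(n)$ and is regarded as an element of $B_r^K(n)$ for any $K$. *)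

theory Defs
  imports
    "HOL-Analysis.Cartesian_Space"
    "HOL-Algebra.Module"
    "HOL-Algebra.Ideal"
    "HOL-Combinatorics.Permutations"
    "HOL-Library.Disjoint_Sets"
begin

section \<open>Brauer diagrams\<close>

text \<open>A diagram is the set of its edges, an edge being a two-element set of vertices.\<close>

type_synonym diagram = "nat set set"

definition brauer_diagrams :: "nat \<Rightarrow> diagram set" where
  "brauer_diagrams r = {D. partition_on {1..2 * r} D \<and> (\<forall>e\<in>D. card e = 2)}"

text \<open>
  To stack \<open>D\<^sub>1\<close> above \<open>D\<^sub>2\<close>, the vertices of \<open>D\<^sub>2\<close> are shifted by \<open>r\<close>. This gives a graph on
  \<open>{1..3 * r}\<close> with intermediate vertices \<open>{r + 1..2 * r}\<close>. Outer vertices have degree one and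
  intermediate vertices degree two (counting parallel edges), so a connected component is either
  a path joining two outer vertices or a closed loop, consisting of intermediate vertices only.
\<close>

definition stacked_edges :: "nat \<Rightarrow> diagram \<Rightarrow> diagram \<Rightarrow> nat set set" where
  "stacked_edges r D\<^sub>1 D\<^sub>2 = D\<^sub>1 \<union> (\<lambda>e. (\<lambda>v. v + r) ` e) ` D\<^sub>2"

definition stacked_components :: "nat \<Rightarrow> diagram \<Rightarrow> diagram \<Rightarrow> nat set set" where
  "stacked_components r D\<^sub>1 D\<^sub>2 =
     {1..3 * r} // {(u, v). \<exists>e\<in>stacked_edges r D\<^sub>1 D\<^sub>2. u \<in> e \<and> v \<in> e}\<^sup>*"

definition outer_vertices :: "nat \<Rightarrow> nat set" where
  "outer_vertices r = {1..r} \<union> {2 * r + 1..3 * r}"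

definition diagram_comp :: "nat \<Rightarrow> diagram \<Rightarrow> diagram \<Rightarrow> diagram" where
  "diagram_comp r D\<^sub>1 D\<^sub>2 =
     (\<lambda>C. (\<lambda>v. if v \<le> r then v else v - r) ` (C \<inter> outer_vertices r)) `
       {C \<in> stacked_components r D\<^sub>1 D\<^sub>2. C \<inter> outer_vertices r \<noteq> {}}"

definition loop_count :: "nat \<Rightarrow> diagram \<Rightarrow> diagram \<Rightarrow> nat" where
  "loop_count r D\<^sub>1 D\<^sub>2 = card {C \<in> stacked_components r D\<^sub>1 D\<^sub>2. C \<inter> outer_vertices r = {}}"

definition perm_diagram :: "nat \<Rightarrow> (nat \<Rightarrow> nat) \<Rightarrow> diagram" where
  "perm_diagram r \<sigma> = {{\<sigma> i, r + i} | i. i \<in> {1..r}}"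

definition e_diagram :: "nat \<Rightarrow> nat \<Rightarrow> nat \<Rightarrow> diagram" where
  "e_diagram r i j = {{i, j}, {r + i, r + j}} \<union> {{k, r + k} | k. k \<in> {1..r} - {i, j}}"

section \<open>The Brauer algebra\<close>

text \<open>
  An element is given by its coefficients with respect to the basis of diagrams.
\<close>

definition brauer_algebra :: "nat \<Rightarrow> 'a::comm_ring_1 \<Rightarrow> ('a, diagram \<Rightarrow> 'a) module" where
  "brauer_algebra r \<delta> =
     \<lparr> carrier = {x. \<forall>D. D \<notin> brauer_diagrams r \<longrightarrow> x D = 0},
       monoid.mult = (\<lambda>x y D.
         \<Sum>(D\<^sub>1, D\<^sub>2) \<in> {(D\<^sub>1, D\<^sub>2). D\<^sub>1 \<in> brauer_diagrams r \<and> D\<^sub>2 \<in> brauer_diagrams r \<and>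
                              diagram_comp r D\<^sub>1 D\<^sub>2 = D}.
           x D\<^sub>1 * y D\<^sub>2 * \<delta> ^ loop_count r D\<^sub>1 D\<^sub>2),
       one = (\<lambda>D. if D = perm_diagram r id then 1 else 0),
       zero = (\<lambda>D. 0),
       add = (\<lambda>x y D. x D + y D),
       smult = (\<lambda>c x D. c * x D) \<rparr>"

definition basis_diagram :: "diagram \<Rightarrow> diagram \<Rightarrow> 'a::comm_ring_1" where
  "basis_diagram D = (\<lambda>D'. if D' = D then 1 else 0)"

section \<open>The elements \<open>E\<^sub>i\<close>\<close>

text \<open>For \<open>k \<ge> l\<close> only the identity permutes \<open>{k..l}\<close>, so that \<open>a(k, l) = 1\<close> as required.\<close>

definition antisymmetrizer :: "nat \<Rightarrow> nat \<Rightarrow> nat \<Rightarrow> diagram \<Rightarrow> 'a::comm_ring_1" where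
  "antisymmetrizer r k l =
     (\<lambda>D. \<Sum>\<sigma> | \<sigma> permutes {k..l}. of_int (sign \<sigma>) * basis_diagram (perm_diagram r \<sigma>) D)"

definition F_elem :: "nat \<Rightarrow> nat \<Rightarrow> nat \<Rightarrow> diagram \<Rightarrow> 'a::comm_ring_1" where
  "F_elem n r i =
     antisymmetrizer r 1 i \<otimes>\<^bsub>brauer_algebra r (of_nat n)\<^esub> antisymmetrizer r (i + 1) (n + 1)"

primrec e_prod :: "nat \<Rightarrow> nat \<Rightarrow> nat \<Rightarrow> nat \<Rightarrow> diagram \<Rightarrow> 'a::comm_ring_1" where
  "e_prod n r i 0 = \<one>\<^bsub>brauer_algebra r (of_nat n)\<^esub>"
| "e_prod n r i (Suc j) =
     e_prod n r i j \<otimes>\<^bsub>brauer_algebra r (of_nat n)\<^esub> basis_diagram (e_diagram r (i - j) (i + j + 1))"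

definition c_coeff :: "nat \<Rightarrow> nat \<Rightarrow> nat \<Rightarrow> rat" where
  "c_coeff n i j = inverse (fact (i - j) * fact (n + 1 - i - j) * (fact j)\<^sup>2)"

definition E_elem_rat :: "nat \<Rightarrow> nat \<Rightarrow> nat \<Rightarrow> diagram \<Rightarrow> rat" where
  "E_elem_rat n r i = (\<lambda>D. \<Sum>j = 0..i. (- 1) ^ j * c_coeff n i j *
     (F_elem n r i \<otimes>\<^bsub>brauer_algebra r (of_nat n)\<^esub> e_prod n r i j
        \<otimes>\<^bsub>brauer_algebra r (of_nat n)\<^esub> F_elem n r i) D)"

text \<open>
  The coefficients of \<^const>\<open>E_elem_rat\<close> are integers for \<open>i \<le> (n + 1) div 2\<close> and \<open>r \<ge> n + 1\<close>, so
  \<^const>\<open>floor\<close> merely reads them as elements of \<^typ>\<open>int\<close>.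
\<close>

definition E_elem :: "nat \<Rightarrow> nat \<Rightarrow> nat \<Rightarrow> diagram \<Rightarrow> 'a::comm_ring_1" where
  "E_elem n r i = (\<lambda>D. of_int \<lfloor>E_elem_rat n r i D\<rfloor>)"

section \<open>Bilinear forms and tensor space\<close>

definition symmetric_bilinear_form :: "('k::field ^ 'n \<Rightarrow> 'k ^ 'n \<Rightarrow> 'k) \<Rightarrow> bool" where
  "symmetric_bilinear_form B \<longleftrightarrow>
     (\<forall>v. Vector_Spaces.linear (*s) (*) (B v)) \<and> (\<forall>v w. B v w = B w v)"

definition orthonormal_basis ::
    "('k::field ^ 'n \<Rightarrow> 'k ^ 'n \<Rightarrow> 'k) \<Rightarrow> ('n::finite \<Rightarrow> 'k ^ 'n) \<Rightarrow> bool" where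
  "orthonormal_basis B b \<longleftrightarrow>
     inj b \<and> vec.independent (range b) \<and> vec.span (range b) = UNIV \<and>
     (\<forall>i j. B (b i) (b j) = (if i = j then 1 else 0))"

definition isometry_group ::
    "('k::field ^ 'n \<Rightarrow> 'k ^ 'n \<Rightarrow> 'k) \<Rightarrow> ('k ^ 'n \<Rightarrow> 'k ^ 'n) set" where
  "isometry_group B =
     {g. Vector_Spaces.linear (*s) (*s) g \<and> bij g \<and> (\<forall>v w. B (g v) (g w) = B v w)}"

text \<open>
  The \<open>r\<close>-th tensor power of \<^typ>\<open>'k ^ 'n\<close> is modelled by coordinate arrays: \<open>t f\<close> is the
  coefficient of \<open>t\<close> at the tensor product of the standard basis vectors with indices
  \<open>f 1, \<dots>, f r\<close>. The \<open>i\<close>-th factor of \<open>pure_tensor r v\<close> is \<open>v i\<close>, for \<open>i\<close> from 1 to \<open>r\<close>.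
\<close>

type_synonym ('k, 'n) tensor = "(nat \<Rightarrow> 'n) \<Rightarrow> 'k"

definition multi_indices :: "nat \<Rightarrow> (nat \<Rightarrow> 'n) set" where
  "multi_indices r = {1..r} \<rightarrow>\<^sub>E UNIV"

definition tensor_space :: "nat \<Rightarrow> ('k::field, 'n) tensor set" where
  "tensor_space r = {t. \<forall>f. f \<notin> multi_indices r \<longrightarrow> t f = 0}"

definition pure_tensor :: "nat \<Rightarrow> (nat \<Rightarrow> 'k::field ^ 'n) \<Rightarrow> ('k, 'n) tensor" where
  "pure_tensor r v = (\<lambda>f. if f \<in> multi_indices r then \<Prod>i = 1..r. v i $ f i else 0)"

definition tensor_linear :: "nat \<Rightarrow> (('k::field, 'n) tensor \<Rightarrow> ('k, 'n) tensor) \<Rightarrow> bool" where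
  "tensor_linear r T \<longleftrightarrow>
     (\<forall>s\<in>tensor_space r. \<forall>t\<in>tensor_space r. T (\<lambda>f. s f + t f) = (\<lambda>f. T s f + T t f)) \<and>
     (\<forall>c. \<forall>t\<in>tensor_space r. T (\<lambda>f. c * t f) = (\<lambda>f. c * T t f))"

definition tensor_End ::
    "nat \<Rightarrow> ('k::field, ('k, 'n) tensor \<Rightarrow> ('k, 'n) tensor) module" where
  "tensor_End r =
     \<lparr> carrier = {T \<in> tensor_space r \<rightarrow>\<^sub>E tensor_space r. tensor_linear r T},
       monoid.mult = (\<lambda>S T. compose (tensor_space r) S T),
       one = (\<lambda>t\<in>tensor_space r. t),
       zero = (\<lambda>t\<in>tensor_space r. (\<lambda>f. 0)),
       add = (\<lambda>S T. \<lambda>t\<in>tensor_space r. (\<lambda>f. S t f + T t f)),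
       smult = (\<lambda>c T. \<lambda>t\<in>tensor_space r. (\<lambda>f. c * T t f)) \<rparr>"

text \<open>
  The linear extension of \<open>v\<^sub>1 \<otimes> \<dots> \<otimes> v\<^sub>r \<mapsto> g v\<^sub>1 \<otimes> \<dots> \<otimes> g v\<^sub>r\<close> from tensor products of
  standard basis vectors.
\<close>

definition tensor_action ::
    "nat \<Rightarrow> ('k::field ^ 'n \<Rightarrow> 'k ^ 'n) \<Rightarrow> ('k, 'n::finite) tensor \<Rightarrow> ('k, 'n) tensor" where
  "tensor_action r g t =
     (\<lambda>f. \<Sum>h\<in>multi_indices r. t h * pure_tensor r (\<lambda>i. g (axis (h i) 1)) f)"

definition equivariant_End ::
    "nat \<Rightarrow> ('k::field ^ 'n::finite \<Rightarrow> 'k ^ 'n \<Rightarrow> 'k) \<Rightarrow>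
     ('k, ('k, 'n) tensor \<Rightarrow> ('k, 'n) tensor) module" where
  "equivariant_End r B =
     (tensor_End r) \<lparr> carrier := {T \<in> carrier (tensor_End r).
        \<forall>g\<in>isometry_group B. \<forall>t\<in>tensor_space r.
          T (tensor_action r g t) = tensor_action r g (T t)} \<rparr>"

section \<open>The Brauer homomorphism\<close>

text \<open>
  Permutations and the \<open>e\<^sub>i\<close> generate the Brauer algebra, so the conditions determine \<open>\<nu>\<close> on
  the carrier.
\<close>

definition brauer_homomorphism ::
    "nat \<Rightarrow> ('k::field ^ 'n::finite \<Rightarrow> 'k ^ 'n \<Rightarrow> 'k) \<Rightarrow> ('n \<Rightarrow> 'k ^ 'n) \<Rightarrow>
     ((diagram \<Rightarrow> 'k) \<Rightarrow> ('k, 'n) tensor \<Rightarrow> ('k, 'n) tensor) \<Rightarrow> bool" where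
  "brauer_homomorphism r B b \<nu> \<longleftrightarrow>
     \<nu> \<in> ring_hom (brauer_algebra r (of_nat CARD('n))) (equivariant_End r B) \<and>
     (\<forall>c. \<forall>x\<in>carrier (brauer_algebra r (of_nat CARD('n))).
        \<nu> (c \<odot>\<^bsub>brauer_algebra r (of_nat CARD('n))\<^esub> x) = c \<odot>\<^bsub>equivariant_End r B\<^esub> \<nu> x) \<and>
     (\<forall>\<sigma> v. \<sigma> permutes {1..r} \<longrightarrow>
        \<nu> (basis_diagram (perm_diagram r \<sigma>)) (pure_tensor r v) =
          pure_tensor r (\<lambda>i. v (inv_into UNIV \<sigma> i))) \<and>
     (\<forall>i v. 1 \<le> i \<and> i < r \<longrightarrow>
        \<nu> (basis_diagram (e_diagram r i (i + 1))) (pure_tensor r v) =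
          (\<lambda>f. B (v i) (v (i + 1)) *
            (\<Sum>k\<in>UNIV. pure_tensor r (v(i := b k, i + 1 := b k)) f)))"

end

theory Submission
  imports Defs
begin

text \<open>
  In an orthonormal basis, a diagram acts on tensor space by the matrix whose entry at two colourings
  of the top and bottom row by \<open>n\<close> colours is 1 if every edge is monochromatic and 0 otherwise. Hence
  \<open>ker \<nu>\<close> consists of the linear relations between the functionals ``all edges of \<open>D\<close> are
  monochromatic'' on colourings of the \<open>2r\<close> vertices. Antisymmetrising a diagram over any \<open>n + 1\<close>
  vertices gives such a relation, because two of these vertices have the same colour.

  These relations span. Order diagrams by the sum of the products of the end points of their edges.
  If \<open>n + 1\<close> edges are pairwise not nested, then \<open>D\<close> is the largest summand of its antisymmetrisation
  over their upper end points, by the rearrangement inequality. Otherwise colour each edge by the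
  length of the longest chain of non-nested edges that ends in it: equally coloured edges are nested,
  so that \<open>D\<close> is the smallest diagram compatible with this colouring, and diagrams of the second kind
  are linearly independent.

  The generator \<open>E\<close> is the identity diagram antisymmetrised over \<open>l = (n + 1) div 2\<close> vertices of the
  top row and \<open>n + 1 - l\<close> of the bottom row, because the coefficients \<open>c\<^sub>i(j)\<close> are inverse to the
  numbers of factorisations in double cosets of a Young subgroup. Multiplying by contractions and
  permutations reduces every antisymmetrised diagram to an identity diagram antisymmetrised over \<open>k\<close>
  vertices of the top row and \<open>n + 1 - k\<close> of the bottom row. Exchanging the two sets of end points
  replaces \<open>k\<close> by \<open>n + 1 - k\<close>, and Garnir relations lead from \<open>k + 1\<close> to \<open>k\<close> when \<open>2k + 1 \<le> n + 1\<close>;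
  this last step inverts \<open>(k + 1)!\<close>.
\<close>

section \<open>Colourings of stacked diagrams\<close>

text \<open>The obstacle that shapes the second half is that permutations in the algebra move
  vertices only within the top row (from the left) or within the bottom row (from the right),
  whereas the relations antisymmetrise over arbitrary vertex sets \<open>J\<close>. The number
  \<open>k\<close> of vertices of \<open>J\<close> in the top row is invariant under these moves,
  and passing from one \<open>k\<close> to another needs linear algebra. Let
  \<open>m = n + 1\<close>. Of the \<open>2m\<close> end points of the edges that meet
  \<open>J\<close>, exactly \<open>m\<close> lie in each row. Fixing the bottom part of
  \<open>J\<close> leaves a function on the \<open>k\<close>-subsets of the \<open>m\<close> top end
  points, and the Garnir relations put its sums over all \<open>k\<close>-subsets of a
  \<open>(k + 1)\<close>-subset into the ideal. Such a function lies in the ideal itself if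
  \<open>2k + 1 \<le> m\<close>; this is why the descent starts from a generator with the middle
  value of \<open>k\<close>. The dichotomy between chains and nested colourings is Mirsky's theorem
  for the order that compares edges by both end points: antichains are sets of nested edges.
  Products are identified by counting compatible colourings of the middle row, so that no path
  through two stacked diagrams has to be traced.\<close>

definition compat :: "('v \<Rightarrow> 'c) \<Rightarrow> 'v set set \<Rightarrow> bool" where
  "compat h D \<longleftrightarrow> (\<forall>e\<in>D. \<forall>u\<in>e. \<forall>v\<in>e. h u = h v)"

definition join :: "nat \<Rightarrow> (nat \<Rightarrow> 'c) \<Rightarrow> (nat \<Rightarrow> 'c) \<Rightarrow> nat \<Rightarrow> 'c" where
  "join r f g v = (if v \<le> r then f v else g (v - r))"

abbreviation adjacency :: "'v set set \<Rightarrow> ('v \<times> 'v) set" where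
  "adjacency F \<equiv> {(u, v). \<exists>e\<in>F. u \<in> e \<and> v \<in> e}"

lemma sym_adjacency_rtrancl: "sym ((adjacency F)\<^sup>*)"
  by (rule sym_rtrancl) (auto simp: sym_def)

lemma compat_iff_rtrancl: "compat h F \<longleftrightarrow> (\<forall>u v. (u, v) \<in> (adjacency F)\<^sup>* \<longrightarrow> h u = h v)"
proof
  assume c: "compat h F"
  show "\<forall>u v. (u, v) \<in> (adjacency F)\<^sup>* \<longrightarrow> h u = h v"
  proof (intro allI impI)
    fix u v assume "(u, v) \<in> (adjacency F)\<^sup>*"
    then show "h u = h v"
      by (induction rule: rtrancl_induct) (use c in \<open>auto simp: compat_def\<close>)
  qed
next
  assume "\<forall>u v. (u, v) \<in> (adjacency F)\<^sup>* \<longrightarrow> h u = h v"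
  then show "compat h F" unfolding compat_def by blast
qed

text \<open>A component that leaves \<open>M\<close> has its colour dictated by \<open>h\<close>,
  provided that \<open>h\<close> is constant on its vertices outside \<open>M\<close>; a component
  inside \<open>M\<close> takes any colour, independently of the others. Hence the count is a power
  of the number of colours, or zero.\<close>

lemma component_count:
  fixes h :: "'v \<Rightarrow> 'c::finite" and F :: "'v set set"
  assumes fin: "finite V" and sub: "\<Union>F \<subseteq> V" and MV: "M \<subseteq> V"
  defines "R \<equiv> (adjacency F)\<^sup>*"
  shows "card {k \<in> M \<rightarrow>\<^sub>E UNIV. compat (\<lambda>v. if v \<in> M then k v else h v) F} =
    (if \<forall>C\<in>V // R. \<forall>u\<in>C - M. \<forall>v\<in>C - M. h u = h v
     then CARD('c) ^ card {C \<in> V // R. C \<subseteq> M} else 0)"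
proof -
  define L where "L = {C \<in> V // R. C \<subseteq> M}"
  define S where "S = {k \<in> M \<rightarrow>\<^sub>E (UNIV::'c set). compat (\<lambda>v. if v \<in> M then k v else h v) F}"
  have symR: "(v, u) \<in> R" if "(u, v) \<in> R" for u v
    using sym_adjacency_rtrancl[of F] that unfolding R_def sym_def by blast
  have reflR: "(u, u) \<in> R" for u by (simp add: R_def)
  have transR: "(u, w) \<in> R" if "(u, v) \<in> R" "(v, w) \<in> R" for u v w
    using that unfolding R_def by (rule rtrancl_trans)
  have class_eq: "R `` {u} = R `` {v}" if "(u, v) \<in> R" for u v
    using symR transR that by blast
  have inV: "v \<in> V" if "(u, v) \<in> R" "u \<in> V" for u v
    using that unfolding R_def
    by (induction rule: rtrancl_induct) (use sub in auto)
  have S_iff: "k \<in> S \<longleftrightarrow> k \<in> M \<rightarrow>\<^sub>E UNIV \<and>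
     (\<forall>u v. (u, v) \<in> R \<longrightarrow> (if u \<in> M then k u else h u) = (if v \<in> M then k v else h v))" for k
    by (simp only: S_def compat_iff_rtrancl R_def mem_Collect_eq)
  have "L \<subseteq> (\<lambda>x. R `` {x}) ` V" unfolding L_def quotient_def by blast
  then have finL: "finite L" using fin by (rule finite_surj[rotated])
  show ?thesis
  proof (cases "\<forall>C\<in>V // R. \<forall>u\<in>C - M. \<forall>v\<in>C - M. h u = h v")
    case False
    then obtain C u v where C: "C \<in> V // R" "u \<in> C" "u \<notin> M" "v \<in> C" "v \<notin> M" "h u \<noteq> h v" by blast
    then obtain x where "C = R `` {x}" by (auto simp: quotient_def)
    then have uv: "(u, v) \<in> R" using C symR transR by blast
    have "S = {}"
    proof (rule ccontr)
      assume "S \<noteq> {}" then obtain k where "k \<in> S" by blast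
      then have "(if u \<in> M then k u else h u) = (if v \<in> M then k v else h v)" using S_iff uv by blast
      then show False using C by simp
    qed
    then have "card S = 0" by simp
    then show ?thesis unfolding if_not_P[OF False] S_def .
  next
    case True
    have h_eq: "h u = h v" if "(u, v) \<in> R" "u \<notin> M" "v \<notin> M" "u \<in> V" for u v
    proof -
      have "R `` {u} \<in> V // R" using that by (auto simp: quotient_def)
      then show ?thesis using True that reflR by blast
    qed
    \<comment> \<open>\<open>\<phi>\<close> spreads a choice of colours for the components inside
      \<open>M\<close> over their vertices and copies the forced colours from some vertex outside
      \<open>M\<close>; \<open>\<psi>\<close> goes back by inspecting one representative per
      component.\<close>
    define \<phi> :: "('v set \<Rightarrow> 'c) \<Rightarrow> 'v \<Rightarrow> 'c" where
      "\<phi> c = (\<lambda>v\<in>M. if R `` {v} \<subseteq> M then c (R `` {v}) else h (SOME w. w \<in> R `` {v} - M))" for c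
    define \<psi> :: "('v \<Rightarrow> 'c) \<Rightarrow> 'v set \<Rightarrow> 'c" where
      "\<psi> k = (\<lambda>C\<in>L. k (SOME v. v \<in> C))" for k
    have some: "(SOME w. w \<in> R `` {v} - M) \<in> R `` {v} - M" if "\<not> R `` {v} \<subseteq> M" for v
      by (rule someI_ex) (use that in blast)
    have "bij_betw \<phi> (L \<rightarrow>\<^sub>E UNIV) S"
    proof (rule bij_betw_byWitness[where f' = \<psi>])
      show "\<forall>c\<in>L \<rightarrow>\<^sub>E UNIV. \<psi> (\<phi> c) = c"
      proof
        fix c :: "'v set \<Rightarrow> 'c" assume c: "c \<in> L \<rightarrow>\<^sub>E UNIV"
        show "\<psi> (\<phi> c) = c"
        proof
          fix C show "\<psi> (\<phi> c) C = c C"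
          proof (cases "C \<in> L")
            case True
            then obtain x where x: "C = R `` {x}" "C \<subseteq> M" by (auto simp: L_def quotient_def)
            have "(SOME v. v \<in> C) \<in> C" by (rule someI_ex) (use x reflR in blast)
            moreover from this have "R `` {SOME v. v \<in> C} = C" using x class_eq by blast
            ultimately show ?thesis using True x by (auto simp: \<psi>_def \<phi>_def)
          next
            case False
            then show ?thesis using c by (auto simp: \<psi>_def PiE_def extensional_def)
          qed
        qed
      qed
      show "\<forall>k\<in>S. \<phi> (\<psi> k) = k"
      proof
        fix k assume k: "k \<in> S"
        show "\<phi> (\<psi> k) = k"
        proof
          fix v show "\<phi> (\<psi> k) v = k v"
          proof (cases "v \<in> M")
            case True
            show ?thesis
            proof (cases "R `` {v} \<subseteq> M")
              case sub: True
              then have L: "R `` {v} \<in> L" using True MV by (auto simp: L_def quotient_def)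
              have "(SOME w. w \<in> R `` {v}) \<in> R `` {v}" by (rule someI_ex) (use reflR in blast)
              then have "(v, SOME w. w \<in> R `` {v}) \<in> R" "(SOME w. w \<in> R `` {v}) \<in> M" using sub by auto
              then have "k v = k (SOME w. w \<in> R `` {v})" using k True S_iff by metis
              then show ?thesis using True sub L by (auto simp: \<phi>_def \<psi>_def)
            next
              case nsub: False
              from some[OF nsub] have "(v, SOME w. w \<in> R `` {v} - M) \<in> R"
                "(SOME w. w \<in> R `` {v} - M) \<notin> M" by auto
              then have "k v = h (SOME w. w \<in> R `` {v} - M)" using k True S_iff by metis
              then show ?thesis using True nsub by (auto simp: \<phi>_def)
            qed
          next
            case False
            then show ?thesis using k by (auto simp: \<phi>_def S_def PiE_def extensional_def)
          qed
        qed
      qed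
      show "\<phi> ` (L \<rightarrow>\<^sub>E UNIV) \<subseteq> S"
      proof safe
        fix c :: "'v set \<Rightarrow> 'c" assume c: "c \<in> L \<rightarrow>\<^sub>E UNIV"
        have key: "\<phi> c u = (if v \<in> M then \<phi> c v else h v)" if uv: "(u, v) \<in> R" "u \<in> M" for u v
        proof (cases "R `` {u} \<subseteq> M")
          case True
          then have "v \<in> M" using uv by auto
          then show ?thesis using uv class_eq[OF uv(1)] by (simp add: \<phi>_def)
        next
          case False
          let ?w = "SOME w. w \<in> R `` {u} - M"
          have w: "(u, ?w) \<in> R" "?w \<notin> M" using some[OF False] by auto
          have u: "\<phi> c u = h ?w" using False uv by (simp add: \<phi>_def)
          show ?thesis
          proof (cases "v \<in> M")
            case True
            then show ?thesis using uv class_eq[OF uv(1)] by (simp add: \<phi>_def)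
          next
            case False
            have "(?w, v) \<in> R" using w uv symR transR by blast
            moreover have "?w \<in> V" using w inV uv MV by blast
            ultimately show ?thesis using u False w h_eq by auto
          qed
        qed
        show "\<phi> c \<in> S"
          unfolding S_iff
        proof (intro conjI allI impI)
          show "\<phi> c \<in> M \<rightarrow>\<^sub>E UNIV" by (auto simp: \<phi>_def)
          fix u v assume uv: "(u, v) \<in> R"
          show "(if u \<in> M then \<phi> c u else h u) = (if v \<in> M then \<phi> c v else h v)"
          proof (cases "u = v")
            case False
            then have V: "u \<in> V"
              using uv sub unfolding R_def by (auto elim: converse_rtranclE)
            show ?thesis
              using key[OF uv] key[OF symR[OF uv]] h_eq[OF uv] V by auto
          qed simp
        qed
      qed
      show "\<psi> ` S \<subseteq> L \<rightarrow>\<^sub>E UNIV" by (auto simp: \<psi>_def)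
    qed
    then have "card S = card (L \<rightarrow>\<^sub>E (UNIV :: 'c set))" by (metis bij_betw_same_card)
    also have "\<dots> = CARD('c) ^ card L" using finL by (simp add: card_PiE)
    finally show ?thesis unfolding if_P[OF True] S_def L_def .
  qed
qed

lemma brauer_diagramsD:
  assumes "D \<in> brauer_diagrams r"
  shows "\<Union>D = {1..2 * r}" "\<And>e. e \<in> D \<Longrightarrow> card e = 2" "disjoint D" "{} \<notin> D" "finite D"
    "\<And>e. e \<in> D \<Longrightarrow> finite e"
proof -
  show *: "\<Union>D = {1..2 * r}" "disjoint D" "{} \<notin> D" and c: "\<And>e. e \<in> D \<Longrightarrow> card e = 2"
    using assms by (auto simp: brauer_diagrams_def partition_on_def)
  show "finite D" by (rule finite_UnionD) (simp add: *)
  show "finite e" if "e \<in> D" for e by (rule card_ge_0_finite) (simp add: c[OF that])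
qed

lemma brauer_diagrams_edge_unique:
  assumes "D \<in> brauer_diagrams r" "e \<in> D" "e' \<in> D" "v \<in> e" "v \<in> e'"
  shows "e = e'"
  using brauer_diagramsD(3)[OF assms(1)] assms by (auto simp: disjoint_def)

lemma brauer_diagrams_sub:
  assumes "D \<in> brauer_diagrams r" "e \<in> D"
  shows "e \<subseteq> {1..2 * r}"
  using brauer_diagramsD(1)[OF assms(1)] assms(2) by blast

lemma finite_brauer_diagrams [simp]: "finite (brauer_diagrams r)"
proof (rule finite_subset)
  show "brauer_diagrams r \<subseteq> Pow (Pow {1..2 * r})"
    using brauer_diagrams_sub by blast
qed simp

lemma stacked_sub:
  assumes "D\<^sub>1 \<in> brauer_diagrams r" "D\<^sub>2 \<in> brauer_diagrams r"
  shows "\<Union>(stacked_edges r D\<^sub>1 D\<^sub>2) \<subseteq> {1..3 * r}"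
proof -
  have "v \<in> {1..3 * r}" if "e \<in> D\<^sub>1" "v \<in> e" for e v
    using brauer_diagrams_sub[OF assms(1) that(1)] that(2) by auto
  moreover have "v + r \<in> {1..3 * r}" if "e \<in> D\<^sub>2" "v \<in> e" for e v
    using brauer_diagrams_sub[OF assms(2) that(1)] that(2) by auto
  ultimately show ?thesis unfolding stacked_edges_def by blast
qed

lemma rtrancl_adjacency_in:
  assumes "(u, v) \<in> (adjacency F)\<^sup>*" "u \<in> V" "\<Union>F \<subseteq> V"
  shows "v \<in> V"
  using assms by (induction rule: rtrancl_induct) auto

lemma stacked_components_sub:
  assumes "D\<^sub>1 \<in> brauer_diagrams r" "D\<^sub>2 \<in> brauer_diagrams r" "C \<in> stacked_components r D\<^sub>1 D\<^sub>2"
  shows "C \<subseteq> {1..3 * r}"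
proof -
  obtain x where x: "C = (adjacency (stacked_edges r D\<^sub>1 D\<^sub>2))\<^sup>* `` {x}" "x \<in> {1..3 * r}"
    using assms(3) by (auto simp: stacked_components_def quotient_def)
  show ?thesis
  proof
    fix v assume "v \<in> C"
    then show "v \<in> {1..3 * r}" using rtrancl_adjacency_in[OF _ x(2) stacked_sub[OF assms(1,2)]] x by blast
  qed
qed

lemma compat_cong:
  assumes "D \<in> brauer_diagrams r" "\<And>v. v \<in> {1..2 * r} \<Longrightarrow> h v = h' v"
  shows "compat h D \<longleftrightarrow> compat h' D"
proof -
  have "h v = h' v" if "e \<in> D" "v \<in> e" for e v
    using assms(2) brauer_diagrams_sub[OF assms(1) that(1)] that(2) by blast
  then show ?thesis unfolding compat_def by (intro ball_cong refl) (simp cong: ball_cong)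
qed

text \<open>Instance of \<open>component_count\<close> with \<open>M\<close> the middle row:
  components inside \<open>M\<close> are the closed loops, the others become the edges of the
  composite. With \<open>n\<close> colours the formula is matrix multiplication for the action on
  tensors; with two colours it serves to identify composites.\<close>

lemma count_middle_colourings:
  fixes f g :: "nat \<Rightarrow> 'c::finite"
  assumes D: "D\<^sub>1 \<in> brauer_diagrams r" "D\<^sub>2 \<in> brauer_diagrams r"
  shows "card {k \<in> multi_indices r. compat (join r f k) D\<^sub>1 \<and> compat (join r k g) D\<^sub>2} =
    (if compat (join r f g) (diagram_comp r D\<^sub>1 D\<^sub>2) then CARD('c) ^ loop_count r D\<^sub>1 D\<^sub>2 else 0)"
proof -
  define M where "M = {r + 1..2 * r}"
  \<comment> \<open>\<open>H\<close> colours the outer vertices in the numbering of the stacked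
    graph, whose bottom row is \<open>{2 * r + 1..3 * r}\<close>; its values on \<open>M\<close> are
    immaterial.\<close>
  define H where "H = (\<lambda>v. if v \<le> r then f v else g (v - 2 * r))"
  let ?F = "stacked_edges r D\<^sub>1 D\<^sub>2"
  let ?S = "{k \<in> M \<rightarrow>\<^sub>E (UNIV :: 'c set). compat (\<lambda>v. if v \<in> M then k v else H v) ?F}"
  have Mout: "C \<inter> outer_vertices r = C - M" if "C \<subseteq> {1..3 * r}" for C
    using that unfolding outer_vertices_def M_def by (auto; fastforce)
  have shift: "v + r \<in> M \<longleftrightarrow> v \<in> {1..r}" for v unfolding M_def by auto
  have iff: "compat (\<lambda>v. if v \<in> M then (\<lambda>v\<in>M. k (v - r)) v else H v) ?F \<longleftrightarrow>
      compat (join r f k) D\<^sub>1 \<and> compat (join r k g) D\<^sub>2" for k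
  proof -
    let ?m = "\<lambda>v. if v \<in> M then (\<lambda>v\<in>M. k (v - r)) v else H v"
    have "compat ?m ?F \<longleftrightarrow> compat ?m D\<^sub>1 \<and> compat (\<lambda>v. ?m (v + r)) D\<^sub>2"
      unfolding compat_def stacked_edges_def ball_Un by simp
    also have "compat ?m D\<^sub>1 \<longleftrightarrow> compat (join r f k) D\<^sub>1"
      by (rule compat_cong[OF D(1)]) (auto simp: join_def M_def H_def)
    also have "compat (\<lambda>v. ?m (v + r)) D\<^sub>2 \<longleftrightarrow> compat (join r k g) D\<^sub>2"
      by (rule compat_cong[OF D(2)]) (auto simp: join_def M_def H_def)
    finally show ?thesis .
  qed
  have bij: "bij_betw (\<lambda>k. \<lambda>v\<in>M. k (v - r))
     {k \<in> multi_indices r. compat (join r f k) D\<^sub>1 \<and> compat (join r k g) D\<^sub>2} ?S"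
  proof (rule bij_betw_byWitness[where f' = "\<lambda>k. \<lambda>v\<in>{1..r}. k (v + r)"])
    show "\<forall>k\<in>{k \<in> multi_indices r. compat (join r f k) D\<^sub>1 \<and> compat (join r k g) D\<^sub>2}.
       (\<lambda>v\<in>{1..r}. (\<lambda>v\<in>M. k (v - r)) (v + r)) = k"
      by (auto simp: fun_eq_iff multi_indices_def shift PiE_def extensional_def restrict_def)
    show inv: "\<forall>k\<in>?S. (\<lambda>v\<in>M. (\<lambda>v\<in>{1..r}. k (v + r)) (v - r)) = k"
      by (auto simp: fun_eq_iff M_def PiE_def extensional_def restrict_def)
    show "(\<lambda>k. \<lambda>v\<in>M. k (v - r)) ` {k \<in> multi_indices r. compat (join r f k) D\<^sub>1 \<and> compat (join r k g) D\<^sub>2} \<subseteq> ?S"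
      using iff by auto
    show "(\<lambda>k. \<lambda>v\<in>{1..r}. k (v + r)) ` ?S \<subseteq>
       {k \<in> multi_indices r. compat (join r f k) D\<^sub>1 \<and> compat (join r k g) D\<^sub>2}"
    proof safe
      fix k :: "nat \<Rightarrow> 'c"
      assume k: "k \<in> M \<rightarrow>\<^sub>E UNIV" "compat (\<lambda>v. if v \<in> M then k v else H v) ?F"
      let ?k = "\<lambda>v\<in>{1..r}. k (v + r)"
      have "(\<lambda>v\<in>M. ?k (v - r)) = k" using inv k by blast
      then have "compat (join r f ?k) D\<^sub>1 \<and> compat (join r ?k g) D\<^sub>2" using iff[of ?k] k(2) by metis
      then show "compat (join r f ?k) D\<^sub>1" "compat (join r ?k g) D\<^sub>2" by auto
      show "?k \<in> multi_indices r" by (auto simp: multi_indices_def)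
    qed
  qed
  have comps: "{1..3 * r} // (adjacency ?F)\<^sup>* = stacked_components r D\<^sub>1 D\<^sub>2"
    by (simp add: stacked_components_def)
  have MV: "M \<subseteq> {1..3 * r}" unfolding M_def by auto
  have "card ?S = (if \<forall>C\<in>stacked_components r D\<^sub>1 D\<^sub>2. \<forall>u\<in>C - M. \<forall>v\<in>C - M. H u = H v
     then CARD('c) ^ card {C \<in> stacked_components r D\<^sub>1 D\<^sub>2. C \<subseteq> M} else 0)"
    using component_count[OF _ stacked_sub[OF D] MV, of H] unfolding comps by simp
  also have "{C \<in> stacked_components r D\<^sub>1 D\<^sub>2. C \<subseteq> M} =
     {C \<in> stacked_components r D\<^sub>1 D\<^sub>2. C \<inter> outer_vertices r = {}}"
  proof -
    have "C \<subseteq> M \<longleftrightarrow> C \<inter> outer_vertices r = {}" if "C \<in> stacked_components r D\<^sub>1 D\<^sub>2" for C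
      unfolding Mout[OF stacked_components_sub[OF D that]] by blast
    then show ?thesis by blast
  qed
  also have "(\<forall>C\<in>stacked_components r D\<^sub>1 D\<^sub>2. \<forall>u\<in>C - M. \<forall>v\<in>C - M. H u = H v) \<longleftrightarrow>
     compat (join r f g) (diagram_comp r D\<^sub>1 D\<^sub>2)"
  proof -
    define i where "i = (\<lambda>v. if v \<le> r then v else v - r)"
    have J: "join r f g (i v) = H v" if "v \<in> outer_vertices r" for v
      using that by (auto simp: join_def H_def outer_vertices_def mult_2 i_def)
    have "compat (join r f g) (diagram_comp r D\<^sub>1 D\<^sub>2) \<longleftrightarrow>
      (\<forall>C\<in>stacked_components r D\<^sub>1 D\<^sub>2. \<forall>u\<in>C \<inter> outer_vertices r. \<forall>v\<in>C \<inter> outer_vertices r. H u = H v)"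
      unfolding compat_def diagram_comp_def i_def[symmetric] by (auto simp: J)
    also have "\<dots> \<longleftrightarrow> (\<forall>C\<in>stacked_components r D\<^sub>1 D\<^sub>2. \<forall>u\<in>C - M. \<forall>v\<in>C - M. H u = H v)"
    proof (rule ball_cong[OF refl])
      fix C assume "C \<in> stacked_components r D\<^sub>1 D\<^sub>2"
      then have "C \<inter> outer_vertices r = C - M" by (intro Mout stacked_components_sub[OF D])
      then show "(\<forall>u\<in>C \<inter> outer_vertices r. \<forall>v\<in>C \<inter> outer_vertices r. H u = H v) =
        (\<forall>u\<in>C - M. \<forall>v\<in>C - M. H u = H v)" by simp
    qed
    finally show ?thesis by simp
  qed
  finally show ?thesis
    using bij_betw_same_card[OF bij] by (simp add: loop_count_def)
qed

text \<open>A connected graph with \<open>c\<close> vertices has at least \<open>c - 1\<close>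
  edges. A maximal vertex set \<open>A\<close> containing \<open>v\<close> that satisfies the bound
  is all of \<open>C\<close>, since an edge leaving \<open>A\<close> would add one vertex and at
  least one edge.\<close>

lemma connected_card_le:
  assumes fin: "finite V" and sub: "\<Union>F \<subseteq> V" and v: "v \<in> V" and two: "\<And>e. e \<in> F \<Longrightarrow> card e = 2"
  defines "C \<equiv> (adjacency F)\<^sup>* `` {v}"
  shows "card C \<le> card {e \<in> F. e \<subseteq> C} + 1"
proof -
  have CV: "C \<subseteq> V" using rtrancl_adjacency_in[OF _ v sub] unfolding C_def by blast
  then have finC: "finite C" using fin finite_subset by blast
  have finF: "finite F" by (rule finite_UnionD) (use fin sub finite_subset in blast)
  define P where "P A \<longleftrightarrow> A \<subseteq> C \<and> v \<in> A \<and> card A \<le> card {e \<in> F. e \<subseteq> A} + 1" for A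
  have "v \<in> C" unfolding C_def by simp
  then have "P {v}" unfolding P_def by simp
  moreover have "finite {A. P A}" by (rule finite_subset[of _ "Pow C"]) (auto simp: P_def finC)
  ultimately obtain A where A: "P A" "\<And>B. P B \<Longrightarrow> A \<subseteq> B \<Longrightarrow> B = A"
    using finite_has_maximal[of "{A. P A}"] by (metis empty_iff mem_Collect_eq)
  have "A = C"
  proof (rule ccontr)
    assume "A \<noteq> C"
    have "\<not> adjacency F `` A \<subseteq> A"
    proof
      assume "adjacency F `` A \<subseteq> A"
      then have "(adjacency F)\<^sup>* `` A \<subseteq> A" by (simp add: Image_closed_trancl)
      then have "C \<subseteq> A" using A(1) unfolding C_def P_def by blast
      then show False using \<open>A \<noteq> C\<close> A(1) P_def by blast
    qed
    then obtain a c e where e: "a \<in> A" "c \<notin> A" "e \<in> F" "a \<in> e" "c \<in> e" by blast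
    have "a \<noteq> c" using e by auto
    then have ee: "e = {a, c}" using two[OF e(3)] e(4,5) by (metis card_2_iff doubleton_eq_iff insert_iff singletonD)
    have "(v, a) \<in> (adjacency F)\<^sup>*" using e(1) A(1) unfolding P_def C_def by blast
    moreover have "(a, c) \<in> adjacency F" using e by blast
    ultimately have cC: "c \<in> C" unfolding C_def by (auto intro: rtrancl_into_rtrancl)
    have finA: "finite A" using A(1) finC finite_subset P_def by blast
    have "card (insert e {e \<in> F. e \<subseteq> A}) \<le> card {e \<in> F. e \<subseteq> insert c A}"
      by (rule card_mono) (use finF e ee in auto)
    moreover have "e \<notin> {e \<in> F. e \<subseteq> A}" using e by auto
    ultimately have "card {e \<in> F. e \<subseteq> A} + 1 \<le> card {e \<in> F. e \<subseteq> insert c A}" using finF by simp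
    then have "P (insert c A)" using A(1) cC e(2) finA unfolding P_def by auto
    then show False using A(2)[of "insert c A"] e(2) by blast
  qed
  then show ?thesis using A(1) P_def by blast
qed

lemma card_edges_in_closed:
  assumes p: "partition_on X D" and two: "\<forall>e\<in>D. card e = 2" and fin: "finite X"
    and cl: "\<And>e u v. e \<in> D \<Longrightarrow> u \<in> e \<Longrightarrow> v \<in> e \<Longrightarrow> u \<in> C \<Longrightarrow> v \<in> C"
  shows "2 * card {e \<in> D. e \<subseteq> C} = card (C \<inter> X)"
proof -
  have eq: "\<Union>{e \<in> D. e \<subseteq> C} = C \<inter> X"
    using p cl unfolding partition_on_def by blast
  have fe: "finite e" if "e \<in> D" for e by (rule card_ge_0_finite) (use two that in simp)
  have "card (\<Union>{e \<in> D. e \<subseteq> C}) = sum card {e \<in> D. e \<subseteq> C}"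
  proof (rule card_Union_disjoint)
    show "pairwise disjnt {e \<in> D. e \<subseteq> C}"
      using p by (auto simp: partition_on_def disjoint_def pairwise_def disjnt_def)
  qed (use fe in auto)
  also have "\<dots> = 2 * card {e \<in> D. e \<subseteq> C}" using two by simp
  finally show ?thesis using eq by simp
qed

text \<open>Counting replaces the tracing of paths. Let a component have \<open>p\<close> top,
  \<open>m\<close> middle and \<open>q\<close> bottom vertices. It contains
  \<open>(p + m) / 2\<close> edges of \<open>D\<^sub>1\<close> and \<open>(m + q) / 2\<close> edges
  of \<open>D\<^sub>2\<close>, so connectedness gives
  \<open>p + m + q \<le> (p + q) / 2 + m + 1\<close>, that is, \<open>p + q \<le> 2\<close>. Since
  \<open>p + q\<close> is even, a component that meets the outer rows does so in exactly two
  vertices.\<close>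

lemma diagram_comp_closed:
  assumes D: "D\<^sub>1 \<in> brauer_diagrams r" "D\<^sub>2 \<in> brauer_diagrams r"
  shows "diagram_comp r D\<^sub>1 D\<^sub>2 \<in> brauer_diagrams r"
proof -
  let ?F = "stacked_edges r D\<^sub>1 D\<^sub>2"
  let ?R = "(adjacency ?F)\<^sup>*"
  let ?s = "\<lambda>v. v + r"
  let ?i = "\<lambda>v. if v \<le> r then v else v - r"
  let ?D = "(\<lambda>e. ?s ` e) ` D\<^sub>2"
  have symR: "(v, u) \<in> ?R" if "(u, v) \<in> ?R" for u v
    using sym_adjacency_rtrancl[of ?F] that unfolding sym_def by blast
  have two2: "\<forall>e\<in>?D. card e = 2"
    using brauer_diagramsD(2)[OF D(2)] by (auto simp: card_image)
  have p1: "partition_on {1..2 * r} D\<^sub>1" and p2: "partition_on {1..2 * r} D\<^sub>2"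
    and two1: "\<forall>e\<in>D\<^sub>1. card e = 2"
    using D by (auto simp: brauer_diagrams_def)
  have img: "?s ` {1..2 * r} = {r + 1..3 * r}"
    using image_add_atLeastAtMost'[of r 1 "2 * r"] by simp
  have p2': "partition_on {r + 1..3 * r} ?D"
  proof -
    have "partition_on (?s ` {1..2 * r}) ((`) ?s ` D\<^sub>2 - {{}})"
      by (rule partition_on_inj_image[OF p2]) simp
    moreover have "(`) ?s ` D\<^sub>2 - {{}} = ?D" using brauer_diagramsD(4)[OF D(2)] by auto
    ultimately show ?thesis using img by simp
  qed
  have two: "card e = 2" if "e \<in> ?F" for e using that two1 two2 unfolding stacked_edges_def by blast
  have finF: "finite ?F" using brauer_diagramsD(5) D by (auto simp: stacked_edges_def)
  have card2: "card (C \<inter> outer_vertices r) = 2"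
    if C: "C \<in> stacked_components r D\<^sub>1 D\<^sub>2" "C \<inter> outer_vertices r \<noteq> {}" for C
  proof -
    obtain x where x: "C = ?R `` {x}" "x \<in> {1..3 * r}"
      using C(1) by (auto simp: stacked_components_def quotient_def)
    have cl: "v \<in> C" if "e \<in> ?F" "u \<in> e" "v \<in> e" "u \<in> C" for e u v
      using that x by (auto intro: rtrancl_into_rtrancl)
    have CV: "C \<subseteq> {1..3 * r}" by (rule stacked_components_sub[OF D C(1)])
    then have finC: "finite C" using finite_subset by blast
    have "card C \<le> card {e \<in> ?F. e \<subseteq> C} + 1"
      unfolding x(1) by (rule connected_card_le[OF _ stacked_sub[OF D] x(2)]) (use two in auto)
    also have "{e \<in> ?F. e \<subseteq> C} = {e \<in> D\<^sub>1. e \<subseteq> C} \<union> {e \<in> ?D. e \<subseteq> C}"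
      unfolding stacked_edges_def by blast
    also have "card \<dots> \<le> card {e \<in> D\<^sub>1. e \<subseteq> C} + card {e \<in> ?D. e \<subseteq> C}" by (rule card_Un_le)
    finally have le: "card C \<le> card {e \<in> D\<^sub>1. e \<subseteq> C} + card {e \<in> ?D. e \<subseteq> C} + 1" by simp
    have e1: "2 * card {e \<in> D\<^sub>1. e \<subseteq> C} = card (C \<inter> {1..2 * r})"
      by (rule card_edges_in_closed[OF p1 two1]) (use cl in \<open>auto simp: stacked_edges_def\<close>)
    have e2: "2 * card {e \<in> ?D. e \<subseteq> C} = card (C \<inter> {r + 1..3 * r})"
    proof (rule card_edges_in_closed[OF p2' two2])
      fix e u v assume "e \<in> ?D" "u \<in> e" "v \<in> e" "u \<in> C"
      then show "v \<in> C" using cl[of e u v] unfolding stacked_edges_def by blast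
    qed simp
    define p q m where "p = card (C \<inter> {1..r})" and "q = card (C \<inter> {2 * r + 1..3 * r})"
      and "m = card (C \<inter> {r + 1..2 * r})"
    have "C \<inter> {1..2 * r} = (C \<inter> {1..r}) \<union> (C \<inter> {r + 1..2 * r})" by auto
    then have c1: "card (C \<inter> {1..2 * r}) = p + m"
      unfolding p_def m_def by (subst card_Un_disjoint[symmetric]) (use finC in auto)
    have "C \<inter> {r + 1..3 * r} = (C \<inter> {r + 1..2 * r}) \<union> (C \<inter> {2 * r + 1..3 * r})" by auto
    then have c2: "card (C \<inter> {r + 1..3 * r}) = m + q"
      unfolding q_def m_def by (subst card_Un_disjoint[symmetric]) (use finC in auto)
    have "C = (C \<inter> {1..r}) \<union> (C \<inter> {r + 1..3 * r})" using CV by auto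
    then have "card C = card ((C \<inter> {1..r}) \<union> (C \<inter> {r + 1..3 * r}))" by simp
    also have "\<dots> = p + card (C \<inter> {r + 1..3 * r})"
      unfolding p_def by (subst card_Un_disjoint) (use finC in auto)
    finally have c3: "card C = p + m + q" using c2 by simp
    have "C \<inter> outer_vertices r = (C \<inter> {1..r}) \<union> (C \<inter> {2 * r + 1..3 * r})"
      unfolding outer_vertices_def by auto
    then have c4: "card (C \<inter> outer_vertices r) = p + q"
      unfolding p_def q_def by (subst card_Un_disjoint[symmetric]) (use finC in auto)
    have "p + q \<noteq> 0" using c4 C(2) finC by (metis card_0_eq finite_Int)
    then show ?thesis using le e1 e2 c1 c2 c3 c4 by presburger
  qed
  have inj: "inj_on ?i (outer_vertices r)"
    unfolding outer_vertices_def by (auto simp: inj_on_def)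
  have img2: "?i ` outer_vertices r = {1..2 * r}"
  proof
    show "?i ` outer_vertices r \<subseteq> {1..2 * r}" unfolding outer_vertices_def by auto
    show "{1..2 * r} \<subseteq> ?i ` outer_vertices r"
    proof
      fix v assume v: "v \<in> {1..2 * r}"
      show "v \<in> ?i ` outer_vertices r"
      proof (cases "v \<le> r")
        case True
        then show ?thesis using v by (auto simp: outer_vertices_def intro!: image_eqI[of _ _ v])
      next
        case False
        then show ?thesis using v by (auto simp: outer_vertices_def intro!: image_eqI[of _ _ "v + r"])
      qed
    qed
  qed
  let ?Cs = "{C \<in> stacked_components r D\<^sub>1 D\<^sub>2. C \<inter> outer_vertices r \<noteq> {}}"
  have pV: "partition_on {1..3 * r} (stacked_components r D\<^sub>1 D\<^sub>2)"
  proof -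
    have disj: "C \<inter> C' = {}" if C: "C \<in> stacked_components r D\<^sub>1 D\<^sub>2" "C' \<in> stacked_components r D\<^sub>1 D\<^sub>2"
      "C \<noteq> C'" for C C'
    proof -
      obtain x y where xy: "C = ?R `` {x}" "C' = ?R `` {y}" 
        using C by (auto simp: stacked_components_def quotient_def)
      show ?thesis
      proof (rule ccontr)
        assume "C \<inter> C' \<noteq> {}"
        then have "(x, y) \<in> ?R" using xy symR by (blast intro: rtrancl_trans)
        then have "C = C'" unfolding xy using symR by (blast intro: rtrancl_trans)
        then show False using C(3) by blast
      qed
    qed
    have "\<Union>(stacked_components r D\<^sub>1 D\<^sub>2) = {1..3 * r}"
    proof
      show "\<Union>(stacked_components r D\<^sub>1 D\<^sub>2) \<subseteq> {1..3 * r}" using stacked_components_sub[OF D] by blast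
      show "{1..3 * r} \<subseteq> \<Union>(stacked_components r D\<^sub>1 D\<^sub>2)"
        by (auto simp: stacked_components_def quotient_def)
    qed
    moreover have "{} \<notin> stacked_components r D\<^sub>1 D\<^sub>2"
      by (auto simp: stacked_components_def quotient_def)
    ultimately show ?thesis using disj unfolding partition_on_def disjoint_def by blast
  qed
  have "partition_on (?i ` outer_vertices r) ((`) ?i ` ((\<inter>) (outer_vertices r) ` stacked_components r D\<^sub>1 D\<^sub>2 - {{}}) - {{}})"
  proof (rule partition_on_inj_image[OF _ inj])
    have "outer_vertices r \<inter> {1..3 * r} = outer_vertices r" unfolding outer_vertices_def by auto
    then show "partition_on (outer_vertices r) ((\<inter>) (outer_vertices r) ` stacked_components r D\<^sub>1 D\<^sub>2 - {{}})"
      using partition_on_restrict[OF pV, of "outer_vertices r"] by simp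
  qed
  moreover have "(`) ?i ` ((\<inter>) (outer_vertices r) ` stacked_components r D\<^sub>1 D\<^sub>2 - {{}}) - {{}} = diagram_comp r D\<^sub>1 D\<^sub>2"
    unfolding diagram_comp_def by (auto simp: Int_commute image_iff simp del: if_image_distrib)
  ultimately have "partition_on {1..2 * r} (diagram_comp r D\<^sub>1 D\<^sub>2)" using img2 by simp
  moreover have "\<forall>e\<in>diagram_comp r D\<^sub>1 D\<^sub>2. card e = 2"
  proof
    fix e assume "e \<in> diagram_comp r D\<^sub>1 D\<^sub>2"
    then obtain C where C: "C \<in> stacked_components r D\<^sub>1 D\<^sub>2" "C \<inter> outer_vertices r \<noteq> {}"
      "e = ?i ` (C \<inter> outer_vertices r)"
      unfolding diagram_comp_def by blast
    have "inj_on ?i (C \<inter> outer_vertices r)" by (rule inj_on_subset[OF inj]) simp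
    then show "card e = 2" unfolding C(3) by (subst card_image) (use card2[OF C(1,2)] in auto)
  qed
  ultimately show ?thesis by (simp add: brauer_diagrams_def)
qed

unbundle no m_inv_syntax

section \<open>Vertex permutations acting on diagrams\<close>

abbreviation vswap :: "nat \<Rightarrow> nat \<Rightarrow> nat \<Rightarrow> nat" where
  "vswap \<equiv> Transposition.transpose"

text \<open>Permutations of all \<open>2 * r\<close> vertices are allowed, also those that mix the
  rows; multiplication by permutations in the algebra realises only those that act separately on the
  two rows.\<close>

definition dact :: "(nat \<Rightarrow> nat) \<Rightarrow> diagram \<Rightarrow> diagram" where
  "dact \<pi> D = (`) \<pi> ` D"

definition bottom :: "nat \<Rightarrow> (nat \<Rightarrow> nat) \<Rightarrow> nat \<Rightarrow> nat" where
  "bottom r \<sigma> v = (if r < v then r + \<sigma> (v - r) else v)"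

lemma compat_dact: "compat h (dact \<pi> D) \<longleftrightarrow> compat (h \<circ> \<pi>) D"
  by (auto simp: compat_def dact_def)

lemma dact_comp: "dact (\<pi> \<circ> \<sigma>) D = dact \<pi> (dact \<sigma> D)"
  by (auto simp: dact_def image_comp)

lemma dact_id [simp]: "dact id D = D" "dact (\<lambda>x. x) D = D"
  by (auto simp: dact_def)

lemma dact_closed:
  assumes "D \<in> brauer_diagrams r" "\<pi> permutes {1..2 * r}"
  shows "dact \<pi> D \<in> brauer_diagrams r"
proof -
  have "inj \<pi>" using assms(2) by (rule permutes_inj)
  have "partition_on {1..2 * r} D" using assms(1) by (simp add: brauer_diagrams_def)
  then have "partition_on (\<pi> ` {1..2 * r}) ((`) \<pi> ` D - {{}})"
    by (rule partition_on_inj_image) (use \<open>inj \<pi>\<close> inj_on_subset in blast)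
  moreover have "\<pi> ` {1..2 * r} = {1..2 * r}" using assms(2) by (rule permutes_image)
  moreover have "(`) \<pi> ` D - {{}} = dact \<pi> D"
    using brauer_diagramsD(4)[OF assms(1)] by (auto simp: dact_def)
  moreover have "card (\<pi> ` e) = 2" if "e \<in> D" for e
    using brauer_diagramsD(2)[OF assms(1) that] \<open>inj \<pi>\<close> by (subst card_image) (auto intro: inj_on_subset)
  ultimately show ?thesis by (auto simp: brauer_diagrams_def dact_def)
qed

lemma dact_inverse:
  assumes "bij \<pi>"
  shows "dact (inv \<pi>) (dact \<pi> D) = D" "dact \<pi> (dact (inv \<pi>) D) = D"
  using assms by (simp_all add: dact_comp[symmetric] bij_is_inj bij_is_surj surj_iff[THEN iffD1])

lemma join_split: "join r h (\<lambda>v. h (v + r)) = h"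
  by (auto simp: join_def fun_eq_iff)

lemma finite_multi_indices [simp]: "finite (multi_indices r :: (nat \<Rightarrow> 'c::finite) set)"
  by (simp add: multi_indices_def finite_PiE)

text \<open>Two colours suffice because the indicator function of an edge of one diagram is a
  compatible colouring; in the other diagram it confines the edge through any vertex of this edge to
  the same two vertices.\<close>

lemma diagram_eqI_compat:
  assumes "D \<in> brauer_diagrams r" "D' \<in> brauer_diagrams r"
    and "\<And>h :: nat \<Rightarrow> bool. compat h D \<longleftrightarrow> compat h D'"
  shows "D = D'"
proof -
  have sub: "E \<subseteq> E'" if E: "E \<in> brauer_diagrams r" "E' \<in> brauer_diagrams r"
    and eq: "\<And>h :: nat \<Rightarrow> bool. compat h E \<longleftrightarrow> compat h E'" for E E'
  proof
    fix e assume e: "e \<in> E"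
    have "compat (\<lambda>v. v \<in> e) E"
      using brauer_diagrams_edge_unique[OF E(1) e] by (auto simp: compat_def)
    then have c: "compat (\<lambda>v. v \<in> e) E'" using eq by blast
    have "card e = 2" using brauer_diagramsD(2) E(1) e by blast
    then obtain u where u: "u \<in> e" by fastforce
    then have "u \<in> \<Union>E'" using brauer_diagrams_sub[OF E(1) e] brauer_diagramsD(1)[OF E(2)] by blast
    then obtain e' where e': "e' \<in> E'" "u \<in> e'" by blast
    have "(u \<in> e) = (v \<in> e)" if "v \<in> e'" for v using c e' that unfolding compat_def by blast
    then have "e' \<subseteq> e" using u by blast
    moreover have "card e' = 2" using brauer_diagramsD(2) E(2) e' by blast
    moreover have "finite e" using brauer_diagramsD(6) E(1) e by blast
    ultimately have "e' = e" using \<open>card e = 2\<close> by (intro card_subset_eq) auto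
    then show "e \<in> E'" using e' by simp
  qed
  show ?thesis using sub[OF assms(1,2)] sub[OF assms(2,1)] assms(3) by blast
qed

text \<open>
  Products, closed loops and associativity are all read off from colourings: compatible colourings
  of the middle row of two stacked diagrams are counted by the product and its number of loops, and
  two colours suffice to separate diagrams.
\<close>

lemma diagram_eqI:
  assumes D: "D \<in> brauer_diagrams r" "D' \<in> brauer_diagrams r"
    and eq: "\<And>f g :: nat \<Rightarrow> bool. (if compat (join r f g) D then 2 ^ a else 0 :: nat) =
      (if compat (join r f g) D' then 2 ^ b else 0)"
  shows "D = D'" "a = b"
proof -
  have eq': "(if compat h D then 2 ^ a else 0 :: nat) = (if compat h D' then 2 ^ b else 0)"
    for h :: "nat \<Rightarrow> bool"
    using eq[of h "\<lambda>v. h (v + r)"] by (simp add: join_split)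
  \<comment> \<open>The constant colouring is compatible with both diagrams and therefore compares
    the exponents.\<close>
  have "compat (\<lambda>_. True) E" for E :: diagram by (simp add: compat_def)
  then have "(2 :: nat) ^ a = 2 ^ b" using eq'[of "\<lambda>_. True"] by simp
  then show "a = b" by simp
  have "compat h D \<longleftrightarrow> compat h D'" for h :: "nat \<Rightarrow> bool"
    using eq'[of h] by (auto split: if_splits)
  then show "D = D'" by (rule diagram_eqI_compat[OF D])
qed

lemma diagram_comp_eqI:
  assumes D: "D\<^sub>1 \<in> brauer_diagrams r" "D\<^sub>2 \<in> brauer_diagrams r" "D \<in> brauer_diagrams r"
    and eq: "\<And>f g :: nat \<Rightarrow> bool. card {k \<in> multi_indices r. compat (join r f k) D\<^sub>1 \<and> compat (join r k g) D\<^sub>2} =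
       (if compat (join r f g) D then 1 else 0)"
  shows "diagram_comp r D\<^sub>1 D\<^sub>2 = D" "loop_count r D\<^sub>1 D\<^sub>2 = 0"
proof -
  have "(if compat (join r f g) (diagram_comp r D\<^sub>1 D\<^sub>2) then 2 ^ loop_count r D\<^sub>1 D\<^sub>2 else 0 :: nat) =
      (if compat (join r f g) D then 2 ^ 0 else 0)" for f g :: "nat \<Rightarrow> bool"
    using trans[OF count_middle_colourings[OF D(1,2), symmetric] eq, of f g]
    unfolding card_UNIV_bool power_0 .
  from diagram_eqI[OF diagram_comp_closed[OF D(1,2)] D(3) this]
  show "diagram_comp r D\<^sub>1 D\<^sub>2 = D" "loop_count r D\<^sub>1 D\<^sub>2 = 0" .
qed

lemma sum_middle_colourings:
  fixes f g :: "nat \<Rightarrow> 'c::finite"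
  assumes D: "D\<^sub>1 \<in> brauer_diagrams r" "D\<^sub>2 \<in> brauer_diagrams r"
  shows "(\<Sum>k\<in>multi_indices r. of_bool (compat (join r f k) D\<^sub>1) * of_bool (compat (join r k g) D\<^sub>2)) =
    of_nat CARD('c) ^ loop_count r D\<^sub>1 D\<^sub>2 *
    (of_bool (compat (join r f g) (diagram_comp r D\<^sub>1 D\<^sub>2)) :: 'a::comm_semiring_1)"
proof -
  have "(\<Sum>k\<in>multi_indices r. of_bool (compat (join r f k) D\<^sub>1) * of_bool (compat (join r k g) D\<^sub>2)) =
    (\<Sum>k\<in>multi_indices r. if compat (join r f k) D\<^sub>1 \<and> compat (join r k g) D\<^sub>2 then 1 else 0 :: 'a)"
    by (intro sum.cong) auto
  also have "\<dots> = of_nat (card {k \<in> multi_indices r. compat (join r f k) D\<^sub>1 \<and> compat (join r k g) D\<^sub>2})"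
    by (simp add: sum.If_cases Int_def)
  finally show ?thesis unfolding count_middle_colourings[OF D] by simp
qed

text \<open>Both sides count the colourings of the two middle rows of three stacked diagrams, summed
  in the two possible orders. With two colours, \<open>diagram_eqI\<close> reads off the composite
  and the total number of loops together.\<close>

lemma diagram_comp_assoc:
  assumes D: "D\<^sub>1 \<in> brauer_diagrams r" "D\<^sub>2 \<in> brauer_diagrams r" "D\<^sub>3 \<in> brauer_diagrams r"
  shows "diagram_comp r (diagram_comp r D\<^sub>1 D\<^sub>2) D\<^sub>3 = diagram_comp r D\<^sub>1 (diagram_comp r D\<^sub>2 D\<^sub>3)"
    and "loop_count r D\<^sub>1 D\<^sub>2 + loop_count r (diagram_comp r D\<^sub>1 D\<^sub>2) D\<^sub>3 =
      loop_count r D\<^sub>2 D\<^sub>3 + loop_count r D\<^sub>1 (diagram_comp r D\<^sub>2 D\<^sub>3)"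
proof -
  let ?c = "\<lambda>f g D. of_bool (compat (join r f g) D) :: nat"
  let ?M = "multi_indices r :: (nat \<Rightarrow> bool) set"
  note closed = diagram_comp_closed[OF D(1,2)] diagram_comp_closed[OF D(2,3)]
  have s: "(\<Sum>k\<in>?M. ?c f k A * ?c k g B) = 2 ^ loop_count r A B * ?c f g (diagram_comp r A B)"
    if "A \<in> brauer_diagrams r" "B \<in> brauer_diagrams r" for f g A B
    using sum_middle_colourings[OF that, of f g, where 'a = nat] by simp
  have "2 ^ (loop_count r D\<^sub>1 D\<^sub>2 + loop_count r (diagram_comp r D\<^sub>1 D\<^sub>2) D\<^sub>3) *
      ?c f g (diagram_comp r (diagram_comp r D\<^sub>1 D\<^sub>2) D\<^sub>3) =
      2 ^ (loop_count r D\<^sub>2 D\<^sub>3 + loop_count r D\<^sub>1 (diagram_comp r D\<^sub>2 D\<^sub>3)) *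
      ?c f g (diagram_comp r D\<^sub>1 (diagram_comp r D\<^sub>2 D\<^sub>3))" for f g :: "nat \<Rightarrow> bool"
  proof -
    have "2 ^ (loop_count r D\<^sub>1 D\<^sub>2 + loop_count r (diagram_comp r D\<^sub>1 D\<^sub>2) D\<^sub>3) *
      ?c f g (diagram_comp r (diagram_comp r D\<^sub>1 D\<^sub>2) D\<^sub>3) =
      2 ^ loop_count r D\<^sub>1 D\<^sub>2 * (\<Sum>l\<in>?M. ?c f l (diagram_comp r D\<^sub>1 D\<^sub>2) * ?c l g D\<^sub>3)"
      unfolding s[OF closed(1) D(3)] by (simp only: power_add mult.assoc)
    also have "\<dots> = (\<Sum>l\<in>?M. (\<Sum>k\<in>?M. ?c f k D\<^sub>1 * ?c k l D\<^sub>2) * ?c l g D\<^sub>3)"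
      unfolding s[OF D(1,2)] by (simp only: sum_distrib_left mult.assoc)
    also have "\<dots> = (\<Sum>k\<in>?M. ?c f k D\<^sub>1 * (\<Sum>l\<in>?M. ?c k l D\<^sub>2 * ?c l g D\<^sub>3))"
      unfolding sum_distrib_left sum_distrib_right by (subst sum.swap) (simp only: mult.assoc)
    also have "\<dots> = 2 ^ loop_count r D\<^sub>2 D\<^sub>3 * (\<Sum>k\<in>?M. ?c f k D\<^sub>1 * ?c k g (diagram_comp r D\<^sub>2 D\<^sub>3))"
      unfolding s[OF D(2,3)] by (simp only: sum_distrib_left mult.left_commute)
    finally show ?thesis unfolding s[OF D(1) closed(2)] by (simp only: power_add mult.assoc)
  qed
  then have "(if compat (join r f g) (diagram_comp r (diagram_comp r D\<^sub>1 D\<^sub>2) D\<^sub>3)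
     then 2 ^ (loop_count r D\<^sub>1 D\<^sub>2 + loop_count r (diagram_comp r D\<^sub>1 D\<^sub>2) D\<^sub>3) else 0 :: nat) =
     (if compat (join r f g) (diagram_comp r D\<^sub>1 (diagram_comp r D\<^sub>2 D\<^sub>3))
     then 2 ^ (loop_count r D\<^sub>2 D\<^sub>3 + loop_count r D\<^sub>1 (diagram_comp r D\<^sub>2 D\<^sub>3)) else 0)" for f g :: "nat \<Rightarrow> bool"
    by (simp only: of_bool_def mult_1_right mult_0_right if_distrib[of "(*) _"])
  from diagram_eqI[OF diagram_comp_closed[OF closed(1) D(3)] diagram_comp_closed[OF D(1) closed(2)] this]
  show "diagram_comp r (diagram_comp r D\<^sub>1 D\<^sub>2) D\<^sub>3 = diagram_comp r D\<^sub>1 (diagram_comp r D\<^sub>2 D\<^sub>3)"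
    "loop_count r D\<^sub>1 D\<^sub>2 + loop_count r (diagram_comp r D\<^sub>1 D\<^sub>2) D\<^sub>3 =
      loop_count r D\<^sub>2 D\<^sub>3 + loop_count r D\<^sub>1 (diagram_comp r D\<^sub>2 D\<^sub>3)" .
qed

section \<open>Products with permutations and contractions\<close>

lemma id_diagram_closed: "perm_diagram r id \<in> brauer_diagrams r"
proof -
  have "{1..2 * r} = \<Union>(perm_diagram r id)"
  proof
    show "{1..2 * r} \<subseteq> \<Union>(perm_diagram r id)"
    proof
      fix v assume v: "v \<in> {1..2 * r}"
      show "v \<in> \<Union>(perm_diagram r id)"
      proof (cases "v \<le> r")
        case True
        then have "{v, r + v} \<in> perm_diagram r id" using v by (auto simp: perm_diagram_def)
        then show ?thesis by blast
      next
        case False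
        then have "{v - r, r + (v - r)} \<in> perm_diagram r id" using v unfolding perm_diagram_def by force
        then show ?thesis using False by auto
      qed
    qed
  qed (auto simp: perm_diagram_def)
  moreover have "disjoint (perm_diagram r id)"
    by (auto simp: perm_diagram_def disjoint_def)
  moreover have "{} \<notin> perm_diagram r id" "\<forall>e\<in>perm_diagram r id. card e = 2"
    by (auto simp: perm_diagram_def)
  ultimately show ?thesis by (simp add: brauer_diagrams_def partition_on_def)
qed

lemma permutes_le:
  assumes "\<sigma> permutes {1..r :: nat}" 
  shows "\<sigma> permutes {1..2 * r}"
  using assms by (rule permutes_subset) auto

lemma perm_diagram_dact:
  assumes "\<sigma> permutes {1..r}"
  shows "perm_diagram r \<sigma> = dact \<sigma> (perm_diagram r id)"
proof -
  have "\<sigma> (r + i) = r + i" if "i \<in> {1..r}" for i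
    using permutes_not_in[OF assms] that by simp
  then have "(\<lambda>i. \<sigma> ` {i, r + i}) ` {1..r} = (\<lambda>i. {\<sigma> i, r + i}) ` {1..r}"
    by (intro image_cong) auto
  then show ?thesis
    by (simp only: perm_diagram_def dact_def Setcompr_eq_image image_image id_apply)
qed

lemma perm_diagram_closed:
  assumes "\<sigma> permutes {1..r}"
  shows "perm_diagram r \<sigma> \<in> brauer_diagrams r"
  unfolding perm_diagram_dact[OF assms] by (intro dact_closed id_diagram_closed permutes_le assms)

text \<open>The exchange of \<open>d\<close> and \<open>r + c\<close> turns the vertical edges
  \<open>{c, r + c}\<close> and \<open>{d, r + d}\<close> into \<open>{c, d}\<close> and
  \<open>{r + c, r + d}\<close>.\<close>

lemma e_diagram_dact:
  assumes "c \<in> {1..r}" "d \<in> {1..r}" "c \<noteq> d"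
  shows "e_diagram r c d = dact (vswap d (r + c)) (perm_diagram r id)"
proof -
  let ?t = "vswap d (r + c)"
  have split: "(\<lambda>k. {k, r + k}) ` {1..r} = {{c, r + c}, {d, r + d}} \<union> (\<lambda>k. {k, r + k}) ` ({1..r} - {c, d})"
    using assms by auto
  have "dact ?t (perm_diagram r id) = (`) ?t ` (\<lambda>k. {k, r + k}) ` {1..r}"
    by (simp only: dact_def perm_diagram_def Setcompr_eq_image id_apply)
  also have "\<dots> = {?t ` {c, r + c}, ?t ` {d, r + d}} \<union> (\<lambda>k. ?t ` {k, r + k}) ` ({1..r} - {c, d})"
    unfolding split by (simp only: image_Un image_insert image_empty image_image)
  also have "?t ` {c, r + c} = {c, d}" using assms by (auto simp: Transposition.transpose_def)
  also have "?t ` {d, r + d} = {r + c, r + d}" using assms by (auto simp: Transposition.transpose_def)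
  also have "(\<lambda>k. ?t ` {k, r + k}) ` ({1..r} - {c, d}) = (\<lambda>k. {k, r + k}) ` ({1..r} - {c, d})"
    by (intro image_cong refl) (use assms in \<open>auto simp: Transposition.transpose_def\<close>)
  finally show ?thesis by (simp only: e_diagram_def Setcompr_eq_image)
qed

lemma e_diagram_closed:
  assumes "c \<in> {1..r}" "d \<in> {1..r}" "c \<noteq> d"
  shows "e_diagram r c d \<in> brauer_diagrams r"
  unfolding e_diagram_dact[OF assms]
  by (intro dact_closed id_diagram_closed permutes_swap_id) (use assms in auto)

lemma compat_perm_diagram:
  "compat h (perm_diagram r \<sigma>) \<longleftrightarrow> (\<forall>i\<in>{1..r}. h (\<sigma> i) = h (r + i))"
  unfolding compat_def perm_diagram_def Setcompr_eq_image by auto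

lemma compat_e_diagram:
  "compat h (e_diagram r c d) \<longleftrightarrow> h c = h d \<and> h (r + c) = h (r + d) \<and> (\<forall>k\<in>{1..r} - {c, d}. h k = h (r + k))"
  unfolding compat_def e_diagram_def Setcompr_eq_image ball_Un by auto

lemma bottom_permutes:
  assumes "\<sigma> permutes {1..r}"
  shows "bottom r \<sigma> permutes {r + 1..2 * r}"
proof (rule inj_imp_permutes)
  show "inj_on (bottom r \<sigma>) {r + 1..2 * r}"
  proof (rule inj_onI)
    fix u v assume uv: "u \<in> {r + 1..2 * r}" "v \<in> {r + 1..2 * r}" "bottom r \<sigma> u = bottom r \<sigma> v"
    then have "\<sigma> (u - r) = \<sigma> (v - r)" by (simp add: bottom_def)
    then have "u - r = v - r" using permutes_inj[OF assms] by (simp add: inj_eq)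
    then show "u = v" using uv by auto
  qed
  show "bottom r \<sigma> v \<in> {r + 1..2 * r}" if "v \<in> {r + 1..2 * r}" for v
  proof -
    have "\<sigma> (v - r) \<in> {1..r}" using that by (subst permutes_in_image[OF assms]) auto
    then show ?thesis using that by (simp add: bottom_def)
  qed
  show "bottom r \<sigma> v = v" if v: "v \<notin> {r + 1..2 * r}" for v
  proof (cases "r < v")
    case True
    have "\<sigma> (v - r) = v - r" by (rule permutes_not_in[OF assms]) (use v True in auto)
    then show ?thesis using True by (simp add: bottom_def)
  qed (simp add: bottom_def)
qed simp

text \<open>The permutation leaves a single possible colouring of the middle row,
  \<open>f \<circ> \<sigma>\<close>, so that no loop arises and the top row of \<open>D\<close> is
  merely renamed.\<close>

lemma perm_diagram_comp_left:
  assumes \<sigma>: "\<sigma> permutes {1..r}" and D: "D \<in> brauer_diagrams r"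
  shows "diagram_comp r (perm_diagram r \<sigma>) D = dact \<sigma> D" "loop_count r (perm_diagram r \<sigma>) D = 0"
proof -
  have in_: "\<sigma> i \<in> {1..r} \<longleftrightarrow> i \<in> {1..r}" for i using \<sigma> by (rule permutes_in_image)
  have "card {k \<in> multi_indices r. compat (join r f k) (perm_diagram r \<sigma>) \<and> compat (join r k g) D} =
       (if compat (join r f g) (dact \<sigma> D) then 1 else 0)" for f g :: "nat \<Rightarrow> bool"
  proof -
    let ?k = "restrict (f \<circ> \<sigma>) {1..r}"
    have "compat (join r f k) (perm_diagram r \<sigma>) \<longleftrightarrow> k = ?k" if k: "k \<in> multi_indices r" for k
    proof -
      have "compat (join r f k) (perm_diagram r \<sigma>) \<longleftrightarrow> (\<forall>i\<in>{1..r}. f (\<sigma> i) = k i)"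
        unfolding compat_perm_diagram using in_ by (intro ball_cong refl) (auto simp: join_def)
      also have "\<dots> \<longleftrightarrow> k = ?k" using k
        by (auto simp: fun_eq_iff multi_indices_def PiE_def extensional_def)
      finally show ?thesis .
    qed
    moreover have "?k \<in> multi_indices r" by (auto simp: multi_indices_def)
    moreover have "compat (join r ?k g) D \<longleftrightarrow> compat (join r f g) (dact \<sigma> D)"
      unfolding compat_dact
    proof (rule compat_cong[OF D])
      fix v assume "v \<in> {1..2 * r}"
      then show "join r ?k g v = (join r f g \<circ> \<sigma>) v"
        using in_[of v] permutes_not_in[OF \<sigma>, of v] by (auto simp: join_def)
    qed
    ultimately have "{k \<in> multi_indices r. compat (join r f k) (perm_diagram r \<sigma>) \<and> compat (join r k g) D} =
      (if compat (join r f g) (dact \<sigma> D) then {?k} else {})" by auto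
    then show ?thesis by simp
  qed
  from diagram_comp_eqI[OF perm_diagram_closed[OF \<sigma>] D dact_closed[OF D permutes_le[OF \<sigma>]] this]
  show "diagram_comp r (perm_diagram r \<sigma>) D = dact \<sigma> D" "loop_count r (perm_diagram r \<sigma>) D = 0" .
qed

text \<open>Here the middle vertex \<open>\<sigma> i\<close> continues to the bottom vertex
  \<open>i\<close>; this is where the inverse comes from.\<close>

lemma perm_diagram_comp_right:
  assumes \<sigma>: "\<sigma> permutes {1..r}" and D: "D \<in> brauer_diagrams r"
  shows "diagram_comp r D (perm_diagram r \<sigma>) = dact (bottom r (inv \<sigma>)) D" "loop_count r D (perm_diagram r \<sigma>) = 0"
proof -
  have \<sigma>': "inv \<sigma> permutes {1..r}" using \<sigma> by (rule permutes_inv)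
  have in_: "\<sigma> i \<in> {1..r} \<longleftrightarrow> i \<in> {1..r}" for i using \<sigma> by (rule permutes_in_image)
  have in': "inv \<sigma> i \<in> {1..r} \<longleftrightarrow> i \<in> {1..r}" for i using \<sigma>' by (rule permutes_in_image)
  have bot: "bottom r (inv \<sigma>) permutes {1..2 * r}"
    by (rule permutes_subset[OF bottom_permutes[OF \<sigma>']]) auto
  have "card {k \<in> multi_indices r. compat (join r f k) D \<and> compat (join r k g) (perm_diagram r \<sigma>)} =
       (if compat (join r f g) (dact (bottom r (inv \<sigma>)) D) then 1 else 0)" for f g :: "nat \<Rightarrow> bool"
  proof -
    let ?k = "restrict (g \<circ> inv \<sigma>) {1..r}"
    have "compat (join r k g) (perm_diagram r \<sigma>) \<longleftrightarrow> k = ?k" if k: "k \<in> multi_indices r" for k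
    proof -
      have "compat (join r k g) (perm_diagram r \<sigma>) \<longleftrightarrow> (\<forall>i\<in>{1..r}. k (\<sigma> i) = g i)"
        unfolding compat_perm_diagram using in_ by (intro ball_cong refl) (auto simp: join_def)
      also have "\<dots> \<longleftrightarrow> (\<forall>i\<in>{1..r}. k i = g (inv \<sigma> i))"
        using in_ in' permutes_inverses[OF \<sigma>] by metis
      also have "\<dots> \<longleftrightarrow> k = ?k" using k
        by (auto simp: fun_eq_iff multi_indices_def PiE_def extensional_def)
      finally show ?thesis .
    qed
    moreover have "?k \<in> multi_indices r" by (auto simp: multi_indices_def)
    moreover have "compat (join r f ?k) D \<longleftrightarrow> compat (join r f g) (dact (bottom r (inv \<sigma>)) D)"
      unfolding compat_dact
    proof (rule compat_cong[OF D])
      fix v assume "v \<in> {1..2 * r}"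
      then show "join r f ?k v = (join r f g \<circ> bottom r (inv \<sigma>)) v"
        using in'[of "v - r"] by (auto simp: join_def bottom_def)
    qed
    ultimately have "{k \<in> multi_indices r. compat (join r f k) D \<and> compat (join r k g) (perm_diagram r \<sigma>)} =
      (if compat (join r f g) (dact (bottom r (inv \<sigma>)) D) then {?k} else {})" by auto
    then show ?thesis by simp
  qed
  from diagram_comp_eqI[OF D perm_diagram_closed[OF \<sigma>] dact_closed[OF D bot] this]
  show "diagram_comp r D (perm_diagram r \<sigma>) = dact (bottom r (inv \<sigma>)) D" "loop_count r D (perm_diagram r \<sigma>) = 0" .
qed

lemma dact_bottom_id_diagram:
  assumes \<sigma>: "\<sigma> permutes {1..r}"
  shows "dact (bottom r \<sigma>) (perm_diagram r id) = dact (inv \<sigma>) (perm_diagram r id)"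
proof -
  note \<sigma>' = permutes_inv[OF \<sigma>]
  have "dact (bottom r (inv (inv \<sigma>))) (perm_diagram r id) = diagram_comp r (perm_diagram r id) (perm_diagram r (inv \<sigma>))"
    by (rule perm_diagram_comp_right(1)[OF \<sigma>' id_diagram_closed, symmetric])
  also have "\<dots> = perm_diagram r (inv \<sigma>)"
    using perm_diagram_comp_left(1)[OF permutes_id perm_diagram_closed[OF \<sigma>']] by simp
  finally show ?thesis unfolding permutes_inv_inv[OF \<sigma>] perm_diagram_dact[OF \<sigma>'] .
qed

lemma compat_cong_edges:
  assumes "\<And>e v. e \<in> E \<Longrightarrow> v \<in> e \<Longrightarrow> h v = h' v"
  shows "compat h E \<longleftrightarrow> compat h' E"
  unfolding compat_def by (intro ball_cong refl) (simp add: assms)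

lemma compat_insert: "compat h (insert {u, w} E) \<longleftrightarrow> h u = h w \<and> compat h E"
  unfolding compat_def by auto

lemma compat_split_edge:
  assumes "{u, w} \<in> D"
  shows "compat h D \<longleftrightarrow> h u = h w \<and> compat h (D - {{u, w}})"
  using compat_insert[of h u w "D - {{u, w}}"] by (simp only: insert_Diff[OF assms])

text \<open>The transposition breaks the edge \<open>{u, w}\<close>: afterwards \<open>y\<close> is
  joined to \<open>w\<close>, and \<open>u\<close> to the old partner of \<open>y\<close>. A common
  colour \<open>z\<close> of \<open>u\<close> and \<open>w\<close> must then be the colour of
  \<open>y\<close>, so that identifying \<open>u\<close> with \<open>w\<close> restores the old edge
  at \<open>y\<close>.\<close>

lemma card_contraction_colours:
  assumes D: "D \<in> brauer_diagrams r" and uw: "{u, w} \<in> D" "u \<noteq> w" and y: "y \<noteq> u" "y \<noteq> w"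
  shows "card {z. compat (H(u := z, w := z)) (dact (vswap y u) D)} =
      (if compat H (D - {{u, w}}) then 1 else 0)"
proof -
  have *: "compat (H(u := z, w := z)) (dact (vswap y u) D) \<longleftrightarrow> z = H y \<and> compat H (D - {{u, w}})" for z
  proof -
    let ?H = "H(u := z, w := z) \<circ> vswap y u"
    have "compat ?H D \<longleftrightarrow> ?H u = ?H w \<and> compat ?H (D - {{u, w}})"
      by (rule compat_split_edge[OF uw(1)])
    also have "?H u = ?H w \<longleftrightarrow> z = H y" using y uw by (auto simp: Transposition.transpose_def)
    also have "z = H y \<and> compat ?H (D - {{u, w}}) \<longleftrightarrow> z = H y \<and> compat H (D - {{u, w}})"
    proof -
      have "?H v = H v" if "e \<in> D - {{u, w}}" "v \<in> e" "z = H y" for e v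
      proof -
        have "v \<noteq> u" "v \<noteq> w"
          using brauer_diagrams_edge_unique[OF D uw(1), of e v] that by auto
        then show ?thesis using that y by (auto simp: Transposition.transpose_def)
      qed
      then show ?thesis by (intro conj_cong refl compat_cong_edges)
    qed
    finally show ?thesis unfolding compat_dact .
  qed
  have "{z. compat (H(u := z, w := z)) (dact (vswap y u) D)} =
     (if compat H (D - {{u, w}}) then {H y} else {})" unfolding * by auto
  then show ?thesis by simp
qed

lemma transpose_closed:
  assumes D: "D \<in> brauer_diagrams r" and uw: "u \<in> {1..2 * r}" "y \<in> {1..2 * r}"
  shows "dact (vswap y u) D \<in> brauer_diagrams r"
  by (intro dact_closed[OF D] permutes_swap_id) (use uw in auto)

text \<open>Every diagram with a horizontal edge in the bottom row is a loop-free product of a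
  diagram in which this edge is broken up and a contraction. No power of the parameter
  appears.\<close>

lemma e_diagram_comp_right:
  assumes D: "D \<in> brauer_diagrams r" and cd: "c \<in> {1..r}" "d \<in> {1..r}" "c \<noteq> d"
    and uw: "{r + c, r + d} \<in> D" and y: "y \<in> {1..2 * r}" "y \<noteq> r + c" "y \<noteq> r + d"
  shows "diagram_comp r (dact (vswap y (r + c)) D) (e_diagram r c d) = D"
    "loop_count r (dact (vswap y (r + c)) D) (e_diagram r c d) = 0"
proof -
  let ?D = "dact (vswap y (r + c)) D"
  have D0: "?D \<in> brauer_diagrams r" by (rule transpose_closed[OF D]) (use cd y in auto)
  have "card {k \<in> multi_indices r. compat (join r f k) ?D \<and> compat (join r k g) (e_diagram r c d)} =
       (if compat (join r f g) D then 1 else 0)" for f g :: "nat \<Rightarrow> bool"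
  proof (cases "g c = g d")
    case False
    then have "{k \<in> multi_indices r. compat (join r f k) ?D \<and> compat (join r k g) (e_diagram r c d)} = {}"
      using cd by (auto simp: compat_e_diagram join_def)
    moreover have "\<not> compat (join r f g) D"
      unfolding compat_split_edge[OF uw] using False cd by (auto simp: join_def)
    ultimately show ?thesis by simp
  next
    case True
    \<comment> \<open>A middle colouring compatible with the contraction agrees with
      \<open>g\<close> except for one free colour \<open>z\<close>, common to \<open>c\<close> and
      \<open>d\<close>.\<close>
    let ?k = "\<lambda>z. restrict (g(c := z, d := z)) {1..r}"
    let ?Z = "{z. compat ((join r f g)(r + c := z, r + d := z)) ?D}"
    have J: "compat (join r f (?k z)) ?D \<longleftrightarrow> compat ((join r f g)(r + c := z, r + d := z)) ?D" for z
      by (rule compat_cong[OF D0]) (use cd in \<open>auto simp: join_def\<close>)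
    have "{k \<in> multi_indices r. compat (join r f k) ?D \<and> compat (join r k g) (e_diagram r c d)} = ?k ` ?Z"
    proof safe
      fix k :: "nat \<Rightarrow> bool" assume k: "k \<in> multi_indices r" "compat (join r f k) ?D"
        "compat (join r k g) (e_diagram r c d)"
      have "k = ?k (k c)" using k(1,3) cd
        by (fastforce simp: compat_e_diagram join_def fun_eq_iff multi_indices_def PiE_def extensional_def)
      moreover from this have "k c \<in> ?Z" using k(2) J[of "k c"] by simp
      ultimately show "k \<in> ?k ` ?Z" by blast
    next
      fix z assume "compat ((join r f g)(r + c := z, r + d := z)) ?D"
      then show "?k z \<in> multi_indices r" "compat (join r f (?k z)) ?D"
        using J by (auto simp: multi_indices_def)
      show "compat (join r (?k z) g) (e_diagram r c d)"
        using cd True by (auto simp: compat_e_diagram join_def)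
    qed
    moreover have "inj ?k"
    proof (rule injI)
      fix a b assume "?k a = ?k b"
      then have "?k a c = ?k b c" by metis
      then show "a = b" using cd by (auto split: if_splits)
    qed
    ultimately have "card {k \<in> multi_indices r. compat (join r f k) ?D \<and> compat (join r k g) (e_diagram r c d)} = card ?Z"
      by (simp add: card_image inj_on_subset[of _ UNIV])
    also have "\<dots> = (if compat (join r f g) (D - {{r + c, r + d}}) then 1 else 0)"
      by (rule card_contraction_colours[OF D uw]) (use cd y in auto)
    finally show ?thesis unfolding compat_split_edge[OF uw] using True cd by (simp add: join_def)
  qed
  from diagram_comp_eqI[OF D0 e_diagram_closed[OF cd] D this]
  show "diagram_comp r ?D (e_diagram r c d) = D" "loop_count r ?D (e_diagram r c d) = 0" .
qed

lemma e_diagram_comp_left: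
  assumes D: "D \<in> brauer_diagrams r" and cd: "c \<in> {1..r}" "d \<in> {1..r}" "c \<noteq> d"
    and uw: "{c, d} \<in> D" and y: "y \<in> {1..2 * r}" "y \<noteq> c" "y \<noteq> d"
  shows "diagram_comp r (e_diagram r c d) (dact (vswap y c) D) = D"
    "loop_count r (e_diagram r c d) (dact (vswap y c) D) = 0"
proof -
  let ?D = "dact (vswap y c) D"
  have D0: "?D \<in> brauer_diagrams r" by (rule transpose_closed[OF D]) (use cd y in auto)
  have "card {k \<in> multi_indices r. compat (join r f k) (e_diagram r c d) \<and> compat (join r k g) ?D} =
       (if compat (join r f g) D then 1 else 0)" for f g :: "nat \<Rightarrow> bool"
  proof (cases "f c = f d")
    case False
    then have "{k \<in> multi_indices r. compat (join r f k) (e_diagram r c d) \<and> compat (join r k g) ?D} = {}"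
      using cd by (auto simp: compat_e_diagram join_def)
    moreover have "\<not> compat (join r f g) D"
      unfolding compat_split_edge[OF uw] using False cd by (auto simp: join_def)
    ultimately show ?thesis by simp
  next
    case True
    let ?k = "\<lambda>z. restrict (f(c := z, d := z)) {1..r}"
    let ?Z = "{z. compat ((join r f g)(c := z, d := z)) ?D}"
    have J: "compat (join r (?k z) g) ?D \<longleftrightarrow> compat ((join r f g)(c := z, d := z)) ?D" for z
      by (rule compat_cong[OF D0]) (use cd in \<open>auto simp: join_def\<close>)
    have "{k \<in> multi_indices r. compat (join r f k) (e_diagram r c d) \<and> compat (join r k g) ?D} = ?k ` ?Z"
    proof safe
      fix k :: "nat \<Rightarrow> bool" assume k: "k \<in> multi_indices r" "compat (join r f k) (e_diagram r c d)"
        "compat (join r k g) ?D"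
      have "k = ?k (k c)" using k(1,2) cd
        by (fastforce simp: compat_e_diagram join_def fun_eq_iff multi_indices_def PiE_def extensional_def)
      moreover from this have "k c \<in> ?Z" using k(3) J[of "k c"] by simp
      ultimately show "k \<in> ?k ` ?Z" by blast
    next
      fix z assume "compat ((join r f g)(c := z, d := z)) ?D"
      then show "?k z \<in> multi_indices r" "compat (join r (?k z) g) ?D"
        using J by (auto simp: multi_indices_def)
      show "compat (join r f (?k z)) (e_diagram r c d)"
        using cd True by (auto simp: compat_e_diagram join_def)
    qed
    moreover have "inj ?k"
    proof (rule injI)
      fix a b assume "?k a = ?k b"
      then have "?k a c = ?k b c" by metis
      then show "a = b" using cd by (auto split: if_splits)
    qed
    ultimately have "card {k \<in> multi_indices r. compat (join r f k) (e_diagram r c d) \<and> compat (join r k g) ?D} = card ?Z"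
      by (simp add: card_image inj_on_subset[of _ UNIV])
    also have "\<dots> = (if compat (join r f g) (D - {{c, d}}) then 1 else 0)"
      by (rule card_contraction_colours[OF D uw]) (use cd y in auto)
    finally show ?thesis unfolding compat_split_edge[OF uw] using True cd by (simp add: join_def)
  qed
  from diagram_comp_eqI[OF e_diagram_closed[OF cd] D0 D this]
  show "diagram_comp r (e_diagram r c d) ?D = D" "loop_count r (e_diagram r c d) ?D = 0" .
qed

section \<open>The Brauer algebra as a ring\<close>

lemma brauer_algebra_simps [simp]:
  "carrier (brauer_algebra r \<delta>) = {x. \<forall>D. D \<notin> brauer_diagrams r \<longrightarrow> x D = 0}"
  "\<one>\<^bsub>brauer_algebra r \<delta>\<^esub> = basis_diagram (perm_diagram r id)"
  "\<zero>\<^bsub>brauer_algebra r \<delta>\<^esub> = (\<lambda>D. 0)"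
  "x \<oplus>\<^bsub>brauer_algebra r \<delta>\<^esub> y = (\<lambda>D. x D + y D)"
  "c \<odot>\<^bsub>brauer_algebra r \<delta>\<^esub> x = (\<lambda>D. c * x D)"
  by (simp_all add: brauer_algebra_def basis_diagram_def)

lemma brauer_mult:
  "x \<otimes>\<^bsub>brauer_algebra r \<delta>\<^esub> y = (\<lambda>D. \<Sum>D\<^sub>1\<in>brauer_diagrams r. \<Sum>D\<^sub>2\<in>brauer_diagrams r.
     x D\<^sub>1 * y D\<^sub>2 * (\<delta> ^ loop_count r D\<^sub>1 D\<^sub>2 * of_bool (diagram_comp r D\<^sub>1 D\<^sub>2 = D)))"
proof
  fix D
  let ?B = "brauer_diagrams r"
  have "(x \<otimes>\<^bsub>brauer_algebra r \<delta>\<^esub> y) D = (\<Sum>p \<in> {(D\<^sub>1, D\<^sub>2). D\<^sub>1 \<in> ?B \<and> D\<^sub>2 \<in> ?B \<and> diagram_comp r D\<^sub>1 D\<^sub>2 = D}.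
           x (fst p) * y (snd p) * \<delta> ^ loop_count r (fst p) (snd p))"
    by (simp add: brauer_algebra_def case_prod_beta)
  also have "\<dots> = (\<Sum>p \<in> ?B \<times> ?B. x (fst p) * y (snd p) *
      (\<delta> ^ loop_count r (fst p) (snd p) * of_bool (diagram_comp r (fst p) (snd p) = D)))"
  proof (rule sum.mono_neutral_cong_left)
    show "\<forall>p\<in>?B \<times> ?B - {(D\<^sub>1, D\<^sub>2). D\<^sub>1 \<in> ?B \<and> D\<^sub>2 \<in> ?B \<and> diagram_comp r D\<^sub>1 D\<^sub>2 = D}.
        x (fst p) * y (snd p) *
          (\<delta> ^ loop_count r (fst p) (snd p) * of_bool (diagram_comp r (fst p) (snd p) = D)) = 0"
    proof
      fix p assume "p \<in> ?B \<times> ?B - {(D\<^sub>1, D\<^sub>2). D\<^sub>1 \<in> ?B \<and> D\<^sub>2 \<in> ?B \<and> diagram_comp r D\<^sub>1 D\<^sub>2 = D}"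
      then have "diagram_comp r (fst p) (snd p) \<noteq> D" by (cases p) simp
      then show "x (fst p) * y (snd p) *
          (\<delta> ^ loop_count r (fst p) (snd p) * of_bool (diagram_comp r (fst p) (snd p) = D)) = 0" by simp
    qed
  qed auto
  also have "\<dots> = (\<Sum>D\<^sub>1\<in>?B. \<Sum>D\<^sub>2\<in>?B. x D\<^sub>1 * y D\<^sub>2 *
      (\<delta> ^ loop_count r D\<^sub>1 D\<^sub>2 * of_bool (diagram_comp r D\<^sub>1 D\<^sub>2 = D)))"
    by (simp only: sum.cartesian_product case_prod_unfold)
  finally show "(x \<otimes>\<^bsub>brauer_algebra r \<delta>\<^esub> y) D = (\<Sum>D\<^sub>1\<in>?B. \<Sum>D\<^sub>2\<in>?B. x D\<^sub>1 * y D\<^sub>2 *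
      (\<delta> ^ loop_count r D\<^sub>1 D\<^sub>2 * of_bool (diagram_comp r D\<^sub>1 D\<^sub>2 = D)))" .
qed

text \<open>Pairing a product with an arbitrary function \<open>\<phi>\<close> of diagrams;
  associativity and the multiplicativity of \<open>ev\<close> are both obtained from this
  expansion.\<close>

lemma brauer_mult_pairing:
  "(\<Sum>E\<in>brauer_diagrams r. (x \<otimes>\<^bsub>brauer_algebra r \<delta>\<^esub> y) E * \<phi> E) =
   (\<Sum>D\<^sub>1\<in>brauer_diagrams r. \<Sum>D\<^sub>2\<in>brauer_diagrams r.
     x D\<^sub>1 * y D\<^sub>2 * (\<delta> ^ loop_count r D\<^sub>1 D\<^sub>2 * \<phi> (diagram_comp r D\<^sub>1 D\<^sub>2)))"
proof -
  let ?B = "brauer_diagrams r"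
  have "(\<Sum>E\<in>?B. (x \<otimes>\<^bsub>brauer_algebra r \<delta>\<^esub> y) E * \<phi> E) =
    (\<Sum>D\<^sub>1\<in>?B. \<Sum>D\<^sub>2\<in>?B. \<Sum>E\<in>?B. x D\<^sub>1 * y D\<^sub>2 * (\<delta> ^ loop_count r D\<^sub>1 D\<^sub>2 * of_bool (diagram_comp r D\<^sub>1 D\<^sub>2 = E)) * \<phi> E)"
    unfolding brauer_mult sum_distrib_right
    by (subst sum.swap, rule sum.cong[OF refl], rule sum.swap)
  also have "\<dots> = (\<Sum>D\<^sub>1\<in>?B. \<Sum>D\<^sub>2\<in>?B.
     x D\<^sub>1 * y D\<^sub>2 * (\<delta> ^ loop_count r D\<^sub>1 D\<^sub>2 * \<phi> (diagram_comp r D\<^sub>1 D\<^sub>2)))"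
  proof (intro sum.cong refl)
    fix D\<^sub>1 D\<^sub>2 assume D: "D\<^sub>1 \<in> ?B" "D\<^sub>2 \<in> ?B"
    have "(\<Sum>E\<in>?B. x D\<^sub>1 * y D\<^sub>2 * (\<delta> ^ loop_count r D\<^sub>1 D\<^sub>2 * of_bool (diagram_comp r D\<^sub>1 D\<^sub>2 = E)) * \<phi> E) =
      (\<Sum>E\<in>?B. if diagram_comp r D\<^sub>1 D\<^sub>2 = E then x D\<^sub>1 * y D\<^sub>2 * (\<delta> ^ loop_count r D\<^sub>1 D\<^sub>2 * \<phi> E) else 0)"
      by (intro sum.cong refl) (simp add: mult.assoc)
    also have "\<dots> = x D\<^sub>1 * y D\<^sub>2 * (\<delta> ^ loop_count r D\<^sub>1 D\<^sub>2 * \<phi> (diagram_comp r D\<^sub>1 D\<^sub>2))"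
      by (subst sum.delta') (simp_all add: diagram_comp_closed[OF D])
    finally show "(\<Sum>E\<in>?B. x D\<^sub>1 * y D\<^sub>2 * (\<delta> ^ loop_count r D\<^sub>1 D\<^sub>2 * of_bool (diagram_comp r D\<^sub>1 D\<^sub>2 = E)) * \<phi> E) =
      x D\<^sub>1 * y D\<^sub>2 * (\<delta> ^ loop_count r D\<^sub>1 D\<^sub>2 * \<phi> (diagram_comp r D\<^sub>1 D\<^sub>2))" .
  qed
  finally show ?thesis .
qed

lemma brauer_mult_closed:
  "x \<otimes>\<^bsub>brauer_algebra r \<delta>\<^esub> y \<in> carrier (brauer_algebra r \<delta>)"
proof -
  have "(x \<otimes>\<^bsub>brauer_algebra r \<delta>\<^esub> y) D = 0" if D: "D \<notin> brauer_diagrams r" for D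
    unfolding brauer_mult
  proof (intro sum.neutral ballI)
    fix D\<^sub>1 D\<^sub>2 assume "D\<^sub>1 \<in> brauer_diagrams r" "D\<^sub>2 \<in> brauer_diagrams r"
    then have "diagram_comp r D\<^sub>1 D\<^sub>2 \<noteq> D" using diagram_comp_closed D by blast
    then show "x D\<^sub>1 * y D\<^sub>2 * (\<delta> ^ loop_count r D\<^sub>1 D\<^sub>2 * of_bool (diagram_comp r D\<^sub>1 D\<^sub>2 = D)) = 0" by simp
  qed
  then show ?thesis by simp
qed

lemma brauer_mult_assoc:
  "(x \<otimes>\<^bsub>brauer_algebra r \<delta>\<^esub> y) \<otimes>\<^bsub>brauer_algebra r \<delta>\<^esub> z =
   x \<otimes>\<^bsub>brauer_algebra r \<delta>\<^esub> (y \<otimes>\<^bsub>brauer_algebra r \<delta>\<^esub> z)"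
proof
  fix D
  let ?B = "brauer_diagrams r" and ?R = "brauer_algebra r \<delta>"
  let ?l = "\<lambda>D E. \<delta> ^ loop_count r D E" and ?c = "diagram_comp r"
  have "((x \<otimes>\<^bsub>?R\<^esub> y) \<otimes>\<^bsub>?R\<^esub> z) D =
    (\<Sum>E\<in>?B. (x \<otimes>\<^bsub>?R\<^esub> y) E * (\<Sum>D\<^sub>3\<in>?B. z D\<^sub>3 * (?l E D\<^sub>3 * of_bool (?c E D\<^sub>3 = D))))"
    unfolding brauer_mult[of r \<delta> "x \<otimes>\<^bsub>?R\<^esub> y" z] by (simp only: sum_distrib_left mult.assoc)
  also have "\<dots> = (\<Sum>D\<^sub>1\<in>?B. \<Sum>D\<^sub>2\<in>?B. \<Sum>D\<^sub>3\<in>?B. x D\<^sub>1 * (y D\<^sub>2 * (z D\<^sub>3 *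
      ((?l D\<^sub>1 D\<^sub>2 * ?l (?c D\<^sub>1 D\<^sub>2) D\<^sub>3) * of_bool (?c (?c D\<^sub>1 D\<^sub>2) D\<^sub>3 = D)))))"
    unfolding brauer_mult_pairing by (simp only: sum_distrib_left mult.assoc mult.left_commute)
  also have "\<dots> = (\<Sum>D\<^sub>1\<in>?B. \<Sum>D\<^sub>2\<in>?B. \<Sum>D\<^sub>3\<in>?B. x D\<^sub>1 * (y D\<^sub>2 * (z D\<^sub>3 *
      ((?l D\<^sub>2 D\<^sub>3 * ?l D\<^sub>1 (?c D\<^sub>2 D\<^sub>3)) * of_bool (?c D\<^sub>1 (?c D\<^sub>2 D\<^sub>3) = D)))))"
    by (intro sum.cong refl) (simp add: diagram_comp_assoc power_add[symmetric])
  also have "\<dots> = (\<Sum>D\<^sub>1\<in>?B. x D\<^sub>1 * (\<Sum>E\<in>?B. (y \<otimes>\<^bsub>?R\<^esub> z) E * (?l D\<^sub>1 E * of_bool (?c D\<^sub>1 E = D))))"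
    unfolding brauer_mult_pairing by (simp only: sum_distrib_left mult.assoc mult.left_commute)
  also have "\<dots> = (x \<otimes>\<^bsub>?R\<^esub> (y \<otimes>\<^bsub>?R\<^esub> z)) D"
    unfolding brauer_mult[of r \<delta> x "y \<otimes>\<^bsub>?R\<^esub> z"] by (simp only: sum_distrib_left mult.assoc)
  finally show "((x \<otimes>\<^bsub>?R\<^esub> y) \<otimes>\<^bsub>?R\<^esub> z) D = (x \<otimes>\<^bsub>?R\<^esub> (y \<otimes>\<^bsub>?R\<^esub> z)) D" .
qed

text \<open>The inverse makes this the linear extension of \<open>dact\<close>: for bijective
  \<open>\<pi>\<close>, the basis element of \<open>D\<close> is mapped to that of
  \<open>dact \<pi> D\<close>.\<close>

definition vact :: "(nat \<Rightarrow> nat) \<Rightarrow> (diagram \<Rightarrow> 'a) \<Rightarrow> diagram \<Rightarrow> 'a" where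
  "vact \<pi> x = (\<lambda>D. x (dact (inv \<pi>) D))"

lemma basis_mult_left:
  assumes D\<^sub>1: "D\<^sub>1 \<in> brauer_diagrams r"
  shows "basis_diagram D\<^sub>1 \<otimes>\<^bsub>brauer_algebra r \<delta>\<^esub> y = (\<lambda>D. \<Sum>D\<^sub>2\<in>brauer_diagrams r.
    y D\<^sub>2 * (\<delta> ^ loop_count r D\<^sub>1 D\<^sub>2 * of_bool (diagram_comp r D\<^sub>1 D\<^sub>2 = D)))"
proof
  fix D
  have "(basis_diagram D\<^sub>1 \<otimes>\<^bsub>brauer_algebra r \<delta>\<^esub> y) D = (\<Sum>D'\<in>brauer_diagrams r. if D' = D\<^sub>1 then
    (\<Sum>D\<^sub>2\<in>brauer_diagrams r. y D\<^sub>2 * (\<delta> ^ loop_count r D' D\<^sub>2 * of_bool (diagram_comp r D' D\<^sub>2 = D))) else 0)"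
    unfolding brauer_mult by (intro sum.cong refl) (simp add: basis_diagram_def)
  then show "(basis_diagram D\<^sub>1 \<otimes>\<^bsub>brauer_algebra r \<delta>\<^esub> y) D = (\<Sum>D\<^sub>2\<in>brauer_diagrams r.
    y D\<^sub>2 * (\<delta> ^ loop_count r D\<^sub>1 D\<^sub>2 * of_bool (diagram_comp r D\<^sub>1 D\<^sub>2 = D)))"
    using D\<^sub>1 by simp
qed

lemma basis_mult_right:
  assumes D\<^sub>2: "D\<^sub>2 \<in> brauer_diagrams r"
  shows "x \<otimes>\<^bsub>brauer_algebra r \<delta>\<^esub> basis_diagram D\<^sub>2 = (\<lambda>D. \<Sum>D\<^sub>1\<in>brauer_diagrams r.
    x D\<^sub>1 * (\<delta> ^ loop_count r D\<^sub>1 D\<^sub>2 * of_bool (diagram_comp r D\<^sub>1 D\<^sub>2 = D)))"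
proof
  fix D
  have "(x \<otimes>\<^bsub>brauer_algebra r \<delta>\<^esub> basis_diagram D\<^sub>2) D = (\<Sum>D\<^sub>1\<in>brauer_diagrams r. \<Sum>D'\<in>brauer_diagrams r.
    if D' = D\<^sub>2 then x D\<^sub>1 * (\<delta> ^ loop_count r D\<^sub>1 D' * of_bool (diagram_comp r D\<^sub>1 D' = D)) else 0)"
    unfolding brauer_mult by (intro sum.cong refl) (simp add: basis_diagram_def)
  then show "(x \<otimes>\<^bsub>brauer_algebra r \<delta>\<^esub> basis_diagram D\<^sub>2) D = (\<Sum>D\<^sub>1\<in>brauer_diagrams r.
    x D\<^sub>1 * (\<delta> ^ loop_count r D\<^sub>1 D\<^sub>2 * of_bool (diagram_comp r D\<^sub>1 D\<^sub>2 = D)))"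
    using D\<^sub>2 by simp
qed

lemma basis_mult_basis:
  assumes "D\<^sub>1 \<in> brauer_diagrams r" "D\<^sub>2 \<in> brauer_diagrams r"
  shows "basis_diagram D\<^sub>1 \<otimes>\<^bsub>brauer_algebra r \<delta>\<^esub> basis_diagram D\<^sub>2 =
    (\<lambda>D. \<delta> ^ loop_count r D\<^sub>1 D\<^sub>2 * basis_diagram (diagram_comp r D\<^sub>1 D\<^sub>2) D)"
proof
  fix D
  have "(basis_diagram D\<^sub>1 \<otimes>\<^bsub>brauer_algebra r \<delta>\<^esub> basis_diagram D\<^sub>2) D =
     (\<Sum>D'\<in>brauer_diagrams r. if D' = D\<^sub>2 then \<delta> ^ loop_count r D\<^sub>1 D' * of_bool (diagram_comp r D\<^sub>1 D' = D) else 0)"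
    unfolding basis_mult_left[OF assms(1)] by (intro sum.cong refl) (simp add: basis_diagram_def)
  also have "\<dots> = \<delta> ^ loop_count r D\<^sub>1 D\<^sub>2 * of_bool (diagram_comp r D\<^sub>1 D\<^sub>2 = D)"
    using assms(2) by simp
  finally show "(basis_diagram D\<^sub>1 \<otimes>\<^bsub>brauer_algebra r \<delta>\<^esub> basis_diagram D\<^sub>2) D =
    \<delta> ^ loop_count r D\<^sub>1 D\<^sub>2 * basis_diagram (diagram_comp r D\<^sub>1 D\<^sub>2) D" by (auto simp: basis_diagram_def)
qed

lemma dact_closed_iff:
  assumes "\<pi> permutes {1..2 * r}"
  shows "dact \<pi> D \<in> brauer_diagrams r \<longleftrightarrow> D \<in> brauer_diagrams r"
  using dact_closed[OF _ assms, of D] dact_closed[OF _ permutes_inv[OF assms], of "dact \<pi> D"]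
    dact_inverse(1)[OF permutes_bij[OF assms], of D] by auto

lemma sum_dact_delta:
  assumes \<pi>: "\<pi> permutes {1..2 * r}" and y: "y \<in> carrier (brauer_algebra r \<delta>)"
  shows "(\<Sum>E\<in>brauer_diagrams r. y E * of_bool (dact \<pi> E = D)) = vact \<pi> y D"
proof -
  note b = permutes_bij[OF \<pi>]
  have "(\<Sum>E\<in>brauer_diagrams r. y E * of_bool (dact \<pi> E = D)) =
     (\<Sum>E\<in>brauer_diagrams r. if E = dact (inv \<pi>) D then y E else 0)"
    by (intro sum.cong refl) (use dact_inverse[OF b] in auto)
  also have "\<dots> = vact \<pi> y D"
    using y by (auto simp: vact_def)
  finally show ?thesis .
qed

lemma perm_mult_left:
  assumes \<sigma>: "\<sigma> permutes {1..r}" and y: "y \<in> carrier (brauer_algebra r \<delta>)"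
  shows "basis_diagram (perm_diagram r \<sigma>) \<otimes>\<^bsub>brauer_algebra r \<delta>\<^esub> y = vact \<sigma> y"
proof
  fix D
  have "(basis_diagram (perm_diagram r \<sigma>) \<otimes>\<^bsub>brauer_algebra r \<delta>\<^esub> y) D =
    (\<Sum>E\<in>brauer_diagrams r. y E * of_bool (dact \<sigma> E = D))"
    unfolding basis_mult_left[OF perm_diagram_closed[OF \<sigma>]]
    by (intro sum.cong refl) (simp add: perm_diagram_comp_left[OF \<sigma>])
  then show "(basis_diagram (perm_diagram r \<sigma>) \<otimes>\<^bsub>brauer_algebra r \<delta>\<^esub> y) D = vact \<sigma> y D"
    using sum_dact_delta[OF permutes_le[OF \<sigma>] y] by simp
qed

lemma bottom_permutes_all:
  assumes "\<sigma> permutes {1..r}"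
  shows "bottom r \<sigma> permutes {1..2 * r}"
  by (rule permutes_subset[OF bottom_permutes[OF assms]]) auto

lemma perm_mult_right:
  assumes \<sigma>: "\<sigma> permutes {1..r}" and y: "y \<in> carrier (brauer_algebra r \<delta>)"
  shows "y \<otimes>\<^bsub>brauer_algebra r \<delta>\<^esub> basis_diagram (perm_diagram r \<sigma>) = vact (bottom r (inv \<sigma>)) y"
proof
  fix D
  have "(y \<otimes>\<^bsub>brauer_algebra r \<delta>\<^esub> basis_diagram (perm_diagram r \<sigma>)) D =
    (\<Sum>E\<in>brauer_diagrams r. y E * of_bool (dact (bottom r (inv \<sigma>)) E = D))"
    unfolding basis_mult_right[OF perm_diagram_closed[OF \<sigma>]]
    by (intro sum.cong refl) (simp add: perm_diagram_comp_right[OF \<sigma>])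
  then show "(y \<otimes>\<^bsub>brauer_algebra r \<delta>\<^esub> basis_diagram (perm_diagram r \<sigma>)) D = vact (bottom r (inv \<sigma>)) y D"
    using sum_dact_delta[OF bottom_permutes_all[OF permutes_inv[OF \<sigma>]] y] by simp
qed

lemma vact_id [simp]: "vact id x = x"
  by (simp add: vact_def)

lemma basis_closed:
  assumes "D \<in> brauer_diagrams r"
  shows "basis_diagram D \<in> carrier (brauer_algebra r \<delta>)"
  using assms by (auto simp: basis_diagram_def)

lemma brauer_ring: "ring (brauer_algebra r (\<delta> :: 'a::comm_ring_1))"
proof (rule ringI)
  let ?R = "brauer_algebra r \<delta>"
  show "abelian_group ?R"
  proof (rule abelian_groupI)
    fix x :: "diagram \<Rightarrow> 'a" assume "x \<in> carrier ?R"
    then show "\<exists>y\<in>carrier ?R. y \<oplus>\<^bsub>?R\<^esub> x = \<zero>\<^bsub>?R\<^esub>" by (intro bexI[of _ "\<lambda>D. - x D"]) auto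
  qed (auto simp: algebra_simps)
  show "monoid ?R"
  proof (rule monoidI)
    show "\<one>\<^bsub>?R\<^esub> \<in> carrier ?R" using basis_closed[OF id_diagram_closed] by simp
    show "\<one>\<^bsub>?R\<^esub> \<otimes>\<^bsub>?R\<^esub> x = x" if "x \<in> carrier ?R" for x
      unfolding brauer_algebra_simps(2) perm_mult_left[OF permutes_id that] by simp
    have "bottom r (inv id) = id" by (auto simp: bottom_def)
    then show "x \<otimes>\<^bsub>?R\<^esub> \<one>\<^bsub>?R\<^esub> = x" if "x \<in> carrier ?R" for x
      unfolding brauer_algebra_simps(2) perm_mult_right[OF permutes_id that] by simp
  qed (rule brauer_mult_closed brauer_mult_assoc)+
qed (simp_all add: brauer_mult distrib_right distrib_left sum.distrib)

lemma brauer_mult_sum_left: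
  "(\<lambda>D. \<Sum>a\<in>A. c a * X a D) \<otimes>\<^bsub>brauer_algebra r \<delta>\<^esub> y =
   (\<lambda>D. \<Sum>a\<in>A. c a * (X a \<otimes>\<^bsub>brauer_algebra r \<delta>\<^esub> y) D)"
proof
  fix D
  let ?B = "brauer_diagrams r"
  let ?w = "\<lambda>D\<^sub>1 D\<^sub>2. \<delta> ^ loop_count r D\<^sub>1 D\<^sub>2 * of_bool (diagram_comp r D\<^sub>1 D\<^sub>2 = D)"
  have "((\<lambda>D. \<Sum>a\<in>A. c a * X a D) \<otimes>\<^bsub>brauer_algebra r \<delta>\<^esub> y) D =
     (\<Sum>D\<^sub>1\<in>?B. \<Sum>D\<^sub>2\<in>?B. \<Sum>a\<in>A. c a * (X a D\<^sub>1 * y D\<^sub>2 * ?w D\<^sub>1 D\<^sub>2))"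
    unfolding brauer_mult by (simp only: sum_distrib_right mult.assoc)
  also have "\<dots> = (\<Sum>D\<^sub>1\<in>?B. \<Sum>a\<in>A. \<Sum>D\<^sub>2\<in>?B. c a * (X a D\<^sub>1 * y D\<^sub>2 * ?w D\<^sub>1 D\<^sub>2))"
    by (intro sum.cong refl) (rule sum.swap)
  also have "\<dots> = (\<Sum>a\<in>A. \<Sum>D\<^sub>1\<in>?B. \<Sum>D\<^sub>2\<in>?B. c a * (X a D\<^sub>1 * y D\<^sub>2 * ?w D\<^sub>1 D\<^sub>2))"
    by (rule sum.swap)
  finally show "((\<lambda>D. \<Sum>a\<in>A. c a * X a D) \<otimes>\<^bsub>brauer_algebra r \<delta>\<^esub> y) D =
      (\<Sum>a\<in>A. c a * (X a \<otimes>\<^bsub>brauer_algebra r \<delta>\<^esub> y) D)"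
    unfolding brauer_mult by (simp only: sum_distrib_left)
qed

lemma brauer_mult_sum_right:
  "y \<otimes>\<^bsub>brauer_algebra r \<delta>\<^esub> (\<lambda>D. \<Sum>a\<in>A. c a * X a D) =
   (\<lambda>D. \<Sum>a\<in>A. c a * (y \<otimes>\<^bsub>brauer_algebra r \<delta>\<^esub> X a) D)"
proof
  fix D
  let ?B = "brauer_diagrams r"
  let ?w = "\<lambda>D\<^sub>1 D\<^sub>2. \<delta> ^ loop_count r D\<^sub>1 D\<^sub>2 * of_bool (diagram_comp r D\<^sub>1 D\<^sub>2 = D)"
  have "(y \<otimes>\<^bsub>brauer_algebra r \<delta>\<^esub> (\<lambda>D. \<Sum>a\<in>A. c a * X a D)) D =
     (\<Sum>D\<^sub>1\<in>?B. \<Sum>D\<^sub>2\<in>?B. \<Sum>a\<in>A. c a * (y D\<^sub>1 * X a D\<^sub>2 * ?w D\<^sub>1 D\<^sub>2))"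
    unfolding brauer_mult sum_distrib_left sum_distrib_right by (simp only: mult.assoc mult.left_commute)
  also have "\<dots> = (\<Sum>D\<^sub>1\<in>?B. \<Sum>a\<in>A. \<Sum>D\<^sub>2\<in>?B. c a * (y D\<^sub>1 * X a D\<^sub>2 * ?w D\<^sub>1 D\<^sub>2))"
    by (intro sum.cong refl) (rule sum.swap)
  also have "\<dots> = (\<Sum>a\<in>A. \<Sum>D\<^sub>1\<in>?B. \<Sum>D\<^sub>2\<in>?B. c a * (y D\<^sub>1 * X a D\<^sub>2 * ?w D\<^sub>1 D\<^sub>2))"
    by (rule sum.swap)
  finally show "(y \<otimes>\<^bsub>brauer_algebra r \<delta>\<^esub> (\<lambda>D. \<Sum>a\<in>A. c a * X a D)) D =
      (\<Sum>a\<in>A. c a * (y \<otimes>\<^bsub>brauer_algebra r \<delta>\<^esub> X a) D)"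
    unfolding brauer_mult by (simp only: sum_distrib_left)
qed

definition linear_subset :: "(diagram \<Rightarrow> 'a::comm_ring_1) set \<Rightarrow> bool" where
  "linear_subset P \<longleftrightarrow> (\<lambda>D. 0) \<in> P \<and> (\<forall>x\<in>P. \<forall>y\<in>P. (\<lambda>D. x D + y D) \<in> P) \<and>
     (\<forall>c. \<forall>x\<in>P. (\<lambda>D. c * x D) \<in> P)"

lemma linear_subset_scale:
  assumes "linear_subset P" "x \<in> P"
  shows "(\<lambda>D. c * x D) \<in> P"
  using assms by (auto simp: linear_subset_def)

lemma linear_subset_add:
  assumes "linear_subset P" "x \<in> P" "y \<in> P"
  shows "(\<lambda>D. x D + y D) \<in> P"
  using assms by (auto simp: linear_subset_def)

lemma linear_subset_diff:
  assumes "linear_subset P" "x \<in> P" "y \<in> P"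
  shows "(\<lambda>D. x D - y D) \<in> P"
  using linear_subset_add[OF assms(1,2) linear_subset_scale[OF assms(1,3), of "- 1"]] by simp

lemma linear_subset_sum:
  assumes P: "linear_subset P" and "\<And>a. a \<in> A \<Longrightarrow> X a \<in> P"
  shows "(\<lambda>D. \<Sum>a\<in>A. X a D) \<in> P"
proof (cases "finite A")
  case True
  then show ?thesis using assms(2)
  proof (induction A)
    case empty
    then show ?case using P by (simp add: linear_subset_def)
  next
    case (insert a A)
    then have "(\<lambda>D. X a D + (\<Sum>a\<in>A. X a D)) \<in> P" by (intro linear_subset_add[OF P]) auto
    then show ?case using insert.hyps by simp
  qed
next
  case False
  then show ?thesis using P by (simp add: linear_subset_def)
qed

text \<open>Scalars act through multiples of the identity diagram, so every ideal is a
  subspace.\<close>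

lemma ideal_linear_subset:
  assumes I: "ideal I (brauer_algebra r \<delta>)"
  shows "linear_subset I"
proof -
  interpret ideal I "brauer_algebra r \<delta>" by (rule I)
  have "(\<lambda>D. c * x D) \<in> I" if x: "x \<in> I" for c x
  proof -
    have xc: "x \<in> carrier (brauer_algebra r \<delta>)" using a_subset x by blast
    have "(\<lambda>D. c * basis_diagram (perm_diagram r id) D) \<in> carrier (brauer_algebra r \<delta>)"
      using basis_closed[OF id_diagram_closed, of r \<delta>] by simp
    then have "(\<lambda>D. c * basis_diagram (perm_diagram r id) D) \<otimes>\<^bsub>brauer_algebra r \<delta>\<^esub> x \<in> I"
      by (rule I_l_closed[OF x])
    also have "(\<lambda>D. c * basis_diagram (perm_diagram r id) D) \<otimes>\<^bsub>brauer_algebra r \<delta>\<^esub> x =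
      (\<lambda>D. c * (basis_diagram (perm_diagram r id) \<otimes>\<^bsub>brauer_algebra r \<delta>\<^esub> x) D)"
      using brauer_mult_sum_left[of r \<delta> "\<lambda>_. c" "\<lambda>_. basis_diagram (perm_diagram r id)" "{()}" x] by simp
    also have "\<dots> = (\<lambda>D. c * x D)" unfolding perm_mult_left[OF permutes_id xc] by simp
    finally show ?thesis .
  qed
  moreover have "(\<lambda>D. 0) \<in> I" using additive_subgroup.zero_closed[OF additive_subgroup_axioms] by simp
  moreover have "(\<lambda>D. x D + y D) \<in> I" if "x \<in> I" "y \<in> I" for x y
    using additive_subgroup.a_closed[OF additive_subgroup_axioms that] by simp
  ultimately show ?thesis by (auto simp: linear_subset_def)
qed

section \<open>Antisymmetrisers on vertex sets\<close>

text \<open>\<open>J\<close> may contain vertices of both rows. For an interval within one row this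
  is multiplication by \<open>antisymmetrizer\<close> from the left or from the right, see
  \<open>antisymmetrizer_mult_left\<close> and \<open>antisymmetrizer_mult_right\<close>.\<close>

definition asym :: "nat set \<Rightarrow> (diagram \<Rightarrow> 'a::comm_ring_1) \<Rightarrow> diagram \<Rightarrow> 'a" where
  "asym J x = (\<lambda>D. \<Sum>\<pi> | \<pi> permutes J. of_int (sign \<pi>) * vact \<pi> x D)"

lemma vact_basis: "bij \<pi> \<Longrightarrow> vact \<pi> (basis_diagram D) = basis_diagram (dact \<pi> D)"
  unfolding vact_def basis_diagram_def using dact_inverse[of \<pi>] by (auto simp: fun_eq_iff)

lemma vact_comp:
  assumes "bij \<pi>" "bij \<sigma>"
  shows "vact (\<pi> \<circ> \<sigma>) x = vact \<pi> (vact \<sigma> x)"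
  unfolding vact_def o_inv_distrib[OF assms] dact_comp ..

lemma vact_closed:
  assumes "\<pi> permutes {1..2 * r}" "x \<in> carrier (brauer_algebra r \<delta>)"
  shows "vact \<pi> x \<in> carrier (brauer_algebra r \<delta>)"
  using assms(2) dact_closed_iff[OF permutes_inv[OF assms(1)]] by (auto simp: vact_def)

lemma vact_sum: "vact \<pi> (\<lambda>D. \<Sum>a\<in>A. c a * X a D) = (\<lambda>D. \<Sum>a\<in>A. c a * vact \<pi> (X a) D)"
  by (simp add: vact_def)

lemma asym_basis:
  "asym J (basis_diagram D) = (\<lambda>D'. \<Sum>\<pi> | \<pi> permutes J. of_int (sign \<pi>) * basis_diagram (dact \<pi> D) D')"
  unfolding asym_def by (intro ext sum.cong refl) (simp add: vact_basis permutes_bij)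

lemma asym_closed:
  assumes "J \<subseteq> {1..2 * r}" "x \<in> carrier (brauer_algebra r \<delta>)"
  shows "asym J x \<in> carrier (brauer_algebra r \<delta>)"
  using vact_closed[OF permutes_subset[OF _ assms(1)] assms(2)]
  by (auto simp: asym_def intro!: sum.neutral)

lemma asym_sum: "asym J (\<lambda>D. \<Sum>a\<in>A. c a * X a D) = (\<lambda>D. \<Sum>a\<in>A. c a * asym J (X a) D)"
  unfolding asym_def vact_sum sum_distrib_left
  by (subst sum.swap) (simp only: mult.left_commute)

lemma finite_permutes_sign:
  assumes "\<pi> permutes J" "\<sigma> permutes J" "finite J"
  shows "sign (\<pi> \<circ> \<sigma>) = sign \<pi> * sign \<sigma>"
  using assms permutation_permutes sign_compose by metis

lemma vact_asym:
  assumes \<tau>: "\<tau> permutes J" and J: "finite J"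
  shows "vact \<tau> (asym J x) = (\<lambda>D. of_int (sign \<tau>) * asym J x D)"
proof
  fix D
  have "asym J x D = (\<Sum>\<pi> | \<pi> permutes J. of_int (sign (\<tau> \<circ> \<pi>)) * vact (\<tau> \<circ> \<pi>) x D)"
    unfolding asym_def by (rule setum_permutations_compose_left[OF \<tau>])
  also have "\<dots> = of_int (sign \<tau>) * vact \<tau> (asym J x) D"
    unfolding asym_def vact_sum sum_distrib_left
    by (intro sum.cong refl) (simp add: finite_permutes_sign[OF \<tau> _ J] vact_comp permutes_bij[OF \<tau>] permutes_bij mult.assoc)
  finally have "of_int (sign \<tau>) * asym J x D = of_int (sign \<tau> * sign \<tau>) * vact \<tau> (asym J x) D"
    by (simp only: of_int_mult mult.assoc)
  then show "vact \<tau> (asym J x) D = of_int (sign \<tau>) * asym J x D" by (simp only: sign_idempotent of_int_1 mult_1)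
qed

lemma asym_vact:
  assumes \<tau>: "\<tau> permutes J" and J: "finite J"
  shows "asym J (vact \<tau> x) = (\<lambda>D. of_int (sign \<tau>) * asym J x D)"
proof
  fix D
  have "asym J x D = (\<Sum>\<pi> | \<pi> permutes J. of_int (sign (\<pi> \<circ> \<tau>)) * vact (\<pi> \<circ> \<tau>) x D)"
    unfolding asym_def by (rule sum_permutations_compose_right[OF \<tau>])
  also have "\<dots> = of_int (sign \<tau>) * asym J (vact \<tau> x) D"
    unfolding asym_def sum_distrib_left
    by (intro sum.cong refl) (simp add: finite_permutes_sign[OF _ \<tau> J] vact_comp permutes_bij[OF \<tau>] permutes_bij mult.assoc)
  finally have "of_int (sign \<tau>) * asym J x D = of_int (sign \<tau> * sign \<tau>) * asym J (vact \<tau> x) D"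
    by (simp only: of_int_mult mult.assoc)
  then show "asym J (vact \<tau> x) D = of_int (sign \<tau>) * asym J x D" by (simp only: sign_idempotent of_int_1 mult_1)
qed

lemma permutes_conj:
  assumes g: "bij g" and p: "\<pi> permutes J"
  shows "g \<circ> \<pi> \<circ> inv g permutes g ` J"
proof -
  have "bij (g \<circ> \<pi> \<circ> inv g)" using g p by (intro bij_comp bij_imp_bij_inv permutes_bij)
  moreover have "(g \<circ> \<pi> \<circ> inv g) x = x" if "x \<notin> g ` J" for x
  proof -
    have "inv g x \<notin> J" using that g by (metis bij_inv_eq_iff image_eqI)
    then show ?thesis using p g by (simp add: permutes_not_in bij_is_surj surj_f_inv_f)
  qed
  moreover from calculation(1) have "g \<circ> \<pi> \<circ> inv g permutes UNIV" by (rule bij_imp_permutes) simp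
  ultimately show ?thesis by (elim permutes_superset) simp
qed

lemma sign_conj:
  assumes g: "permutation g" and p: "permutation \<pi>"
  shows "sign (g \<circ> \<pi> \<circ> inv g) = sign \<pi>"
  using assms by (simp add: sign_compose permutation_compose permutation_inverse sign_inverse)

lemma vact_asym_conj:
  assumes g: "permutation g" and J: "finite J"
  shows "vact g (asym J x) = asym (g ` J) (vact g x)"
proof
  fix D
  have b: "bij g" using g by (simp add: permutation_bijective)
  have gi: "g \<circ> inv g = id" "inv g \<circ> g = id" using b by (simp_all add: bij_is_inj bij_is_surj surj_iff[THEN iffD1])
  have cancel: "inv g \<circ> (g \<circ> \<pi> \<circ> inv g) \<circ> g = \<pi>" "g \<circ> (inv g \<circ> \<pi> \<circ> g) \<circ> inv g = \<pi>" for \<pi>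
    using gi by (metis comp_assoc comp_id id_comp)+
  have bb: "bij_betw (\<lambda>\<pi>. g \<circ> \<pi> \<circ> inv g) {\<pi>. \<pi> permutes J} {\<pi>. \<pi> permutes g ` J}"
  proof (rule bij_betw_byWitness[where f' = "\<lambda>\<pi>. inv g \<circ> \<pi> \<circ> g"])
    show "(\<lambda>\<pi>. g \<circ> \<pi> \<circ> inv g) ` {\<pi>. \<pi> permutes J} \<subseteq> {\<pi>. \<pi> permutes g ` J}"
      using permutes_conj[OF b] by blast
    have "inv g ` g ` J = J" using b by (simp add: bij_is_inj image_inv_f_f)
    then have "inv g \<circ> \<pi> \<circ> g permutes J" if "\<pi> permutes g ` J" for \<pi>
      using permutes_conj[OF bij_imp_bij_inv[OF b] that] b by (simp add: inv_inv_eq)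
    then show "(\<lambda>\<pi>. inv g \<circ> \<pi> \<circ> g) ` {\<pi>. \<pi> permutes g ` J} \<subseteq> {\<pi>. \<pi> permutes J}" by blast
  qed (use cancel in auto)
  have "asym (g ` J) (vact g x) D =
     (\<Sum>\<pi> | \<pi> permutes J. of_int (sign (g \<circ> \<pi> \<circ> inv g)) * vact (g \<circ> \<pi> \<circ> inv g) (vact g x) D)"
    unfolding asym_def by (rule sum.reindex_bij_betw[OF bb, symmetric])
  also have "\<dots> = (\<Sum>\<pi> | \<pi> permutes J. of_int (sign \<pi>) * vact g (vact \<pi> x) D)"
  proof (intro sum.cong refl, simp only: mem_Collect_eq)
    fix \<pi> assume p: "\<pi> permutes J"
    have "vact (g \<circ> \<pi> \<circ> inv g) (vact g x) = vact (g \<circ> \<pi> \<circ> inv g \<circ> g) x"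
      by (rule vact_comp[OF permutes_bij[OF permutes_conj[OF b p]] b, symmetric])
    also have "g \<circ> \<pi> \<circ> inv g \<circ> g = g \<circ> \<pi>" using gi by (simp add: comp_assoc)
    also have "vact (g \<circ> \<pi>) x = vact g (vact \<pi> x)" by (rule vact_comp[OF b permutes_bij[OF p]])
    finally show "of_int (sign (g \<circ> \<pi> \<circ> inv g)) * vact (g \<circ> \<pi> \<circ> inv g) (vact g x) D =
       of_int (sign \<pi>) * vact g (vact \<pi> x) D"
      using sign_conj[OF g, of \<pi>] permutation_permutes p J by metis
  qed
  also have "\<dots> = vact g (asym J x) D" unfolding asym_def vact_sum ..
  finally show "vact g (asym J x) D = asym (g ` J) (vact g x) D" ..
qed

text \<open>Coset decomposition of the permutations of \<open>insert y J\<close> over those of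
  \<open>J\<close>, with the identity and the transpositions of \<open>y\<close> with the elements
  of \<open>J\<close> as representatives. When the left hand side vanishes, this is a Garnir
  relation.\<close>

lemma asym_insert:
  assumes J: "finite J" and y: "y \<notin> J"
  shows "asym (insert y J) x D = asym J x D - (\<Sum>j\<in>J. vact (vswap y j) (asym J x) D)"
proof -
  have *: "(\<Sum>\<pi> | \<pi> permutes J. of_int (sign (vswap y b \<circ> \<pi>)) * vact (vswap y b \<circ> \<pi>) x D) =
     - vact (vswap y b) (asym J x) D" if "b \<in> J" for b
  proof -
    have "sign (vswap y b \<circ> \<pi>) = - sign \<pi>" if "\<pi> permutes J" for \<pi>
    proof -
      have "permutation \<pi>" using that J permutation_permutes by blast
      then show ?thesis using y \<open>b \<in> J\<close> by (auto simp: sign_compose permutation_swap_id sign_swap_id)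
    qed
    then have "(\<Sum>\<pi> | \<pi> permutes J. of_int (sign (vswap y b \<circ> \<pi>)) * vact (vswap y b \<circ> \<pi>) x D) =
       (\<Sum>\<pi> | \<pi> permutes J. - (of_int (sign \<pi>) * vact (vswap y b) (vact \<pi> x) D))"
      by (intro sum.cong refl) (simp add: vact_comp permutes_bij)
    then show ?thesis unfolding asym_def vact_sum sum_negf by simp
  qed
  have "asym (insert y J) x D =
     (\<Sum>b\<in>insert y J. \<Sum>\<pi> | \<pi> permutes J. of_int (sign (vswap y b \<circ> \<pi>)) * vact (vswap y b \<circ> \<pi>) x D)"
    unfolding asym_def by (rule sum_over_permutations_insert[OF J y])
  also have "\<dots> = asym J x D + (\<Sum>b\<in>J. - vact (vswap y b) (asym J x) D)"
    using J y * by (simp add: asym_def)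
  finally show ?thesis by (simp add: sum_negf)
qed

lemma asym_eq_0:
  fixes x :: "diagram \<Rightarrow> 'a::field"
  assumes J: "finite J" and two: "(2 :: 'a) \<noteq> 0" and uv: "u \<in> J" "v \<in> J" "u \<noteq> v"
    and fx: "vact (vswap u v) x = x"
  shows "asym J x = (\<lambda>D. 0)"
proof
  fix D
  have "asym J x D = - asym J x D"
    using fun_cong[OF asym_vact[OF permutes_swap_id[OF uv(1,2)] J, of x], of D] uv(3)
    by (simp only: fx sign_swap_id if_False of_int_minus of_int_1 mult_minus1)
  then have "2 * asym J x D = 0" by (simp only: mult_2 eq_neg_iff_add_eq_0)
  then show "asym J x D = 0" using two by simp
qed

section \<open>Partners\<close>

text \<open>The default value \<open>v\<close> off the diagram makes this an involution on all
  natural numbers, so that it is a permutation in the sense of \<open>permutes\<close>.\<close>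

definition partner :: "diagram \<Rightarrow> nat \<Rightarrow> nat" where
  "partner D v = (if v \<in> \<Union>D then THE w. {v, w} \<in> D else v)"

lemma partner_props:
  assumes D: "D \<in> brauer_diagrams r" and v: "v \<in> {1..2 * r}"
  shows "{v, partner D v} \<in> D" "partner D v \<noteq> v" "partner D v \<in> {1..2 * r}"
    "\<And>w. {v, w} \<in> D \<Longrightarrow> w = partner D v"
proof -
  have vU: "v \<in> \<Union>D" using brauer_diagramsD(1)[OF D] v by simp
  then obtain e where e: "e \<in> D" "v \<in> e" by blast
  have "card e = 2" by (rule brauer_diagramsD(2)[OF D e(1)])
  then obtain w where w: "e = {v, w}" "w \<noteq> v" using e(2) by (auto simp: card_2_iff)
  have uniq: "w' = w" if "{v, w'} \<in> D" for w'
  proof -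
    have "{v, w'} = {v, w}" using brauer_diagrams_edge_unique[OF D that e(1)] e(2) w by auto
    then show ?thesis by (metis doubleton_eq_iff)
  qed
  have "(THE w. {v, w} \<in> D) = w" by (rule the_equality[OF _ uniq]) (use e w in simp)
  then have "partner D v = w" using vU by (simp only: partner_def if_True)
  note pw = this
  show "{v, partner D v} \<in> D" using e(1) by (simp only: pw w(1))
  show "partner D v \<noteq> v" using w(2) by (simp only: pw not_False_eq_True)
  show "w' = partner D v" if "{v, w'} \<in> D" for w' unfolding pw by (rule uniq[OF that])
  show "partner D v \<in> {1..2 * r}"
    unfolding pw using brauer_diagrams_sub[OF D e(1)] unfolding w(1) by blast
qed

lemma partner_eqI:
  assumes "D \<in> brauer_diagrams r" "{v, w} \<in> D"
  shows "partner D v = w"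
  using partner_props(4)[OF assms(1), of v w] brauer_diagrams_sub[OF assms] assms(2) by auto

lemma partner_outside:
  assumes "D \<in> brauer_diagrams r" "v \<notin> {1..2 * r}"
  shows "partner D v = v"
  using assms brauer_diagramsD(1)[OF assms(1)] by (auto simp: partner_def)

lemma partner_partner:
  assumes D: "D \<in> brauer_diagrams r"
  shows "partner D (partner D v) = v"
proof (cases "v \<in> {1..2 * r}")
  case True
  have "{partner D v, v} \<in> D" using partner_props(1)[OF D True] by (simp add: insert_commute)
  then show ?thesis by (rule partner_eqI[OF D])
qed (simp add: partner_outside[OF D])

lemma partner_permutes:
  assumes D: "D \<in> brauer_diagrams r"
  shows "partner D permutes {1..2 * r}"
proof (rule inj_imp_permutes)
  show "inj_on (partner D) {1..2 * r}" by (metis inj_onI partner_partner[OF D])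
qed (use partner_props(3)[OF D] partner_outside[OF D] in auto)

lemma edge_iff_partner:
  assumes D: "D \<in> brauer_diagrams r"
  shows "e \<in> D \<longleftrightarrow> (\<exists>v\<in>{1..2 * r}. e = {v, partner D v})"
proof
  assume e: "e \<in> D"
  have "card e = 2" by (rule brauer_diagramsD(2)[OF D e])
  then obtain v w where "e = {v, w}" by (auto simp: card_2_iff)
  then show "\<exists>v\<in>{1..2 * r}. e = {v, partner D v}"
    using e partner_eqI[OF D, of v w] brauer_diagrams_sub[OF D e] by auto
qed (use partner_props(1)[OF D] in auto)

lemma partner_dact:
  assumes D: "D \<in> brauer_diagrams r" and \<pi>: "\<pi> permutes {1..2 * r}" and v: "v \<in> {1..2 * r}"
  shows "partner (dact \<pi> D) (\<pi> v) = \<pi> (partner D v)"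
proof (rule partner_eqI[OF dact_closed[OF D \<pi>]])
  have "\<pi> ` {v, partner D v} \<in> dact \<pi> D" unfolding dact_def by (intro imageI partner_props[OF D v])
  then show "{\<pi> v, \<pi> (partner D v)} \<in> dact \<pi> D" by simp
qed

lemma dact_fixI:
  assumes D: "D \<in> brauer_diagrams r" and g: "g permutes {1..2 * r}"
    and comm: "\<And>v. v \<in> {1..2 * r} \<Longrightarrow> g (partner D v) = partner D (g v)"
  shows "dact g D = D"
proof -
  have sub: "dact g D \<subseteq> D"
  proof
    fix e assume "e \<in> dact g D"
    then obtain v where v: "v \<in> {1..2 * r}" "e = g ` {v, partner D v}"
      unfolding dact_def using edge_iff_partner[OF D] by auto
    then have "e = {g v, partner D (g v)}" using comm by simp
    moreover have "g v \<in> {1..2 * r}" using v permutes_in_image[OF g] by simp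
    ultimately show "e \<in> D" using edge_iff_partner[OF D] by blast
  qed
  have "finite D" by (rule brauer_diagramsD(5)[OF D])
  moreover have "card (dact g D) = card D"
    unfolding dact_def using permutes_inj[OF g]
    by (intro card_image inj_onI) (auto dest: inj_image_eq_iff[THEN iffD1])
  ultimately show ?thesis using sub by (simp add: card_subset_eq)
qed

lemma diagram_eqI_partner:
  assumes D: "D \<in> brauer_diagrams r" "D' \<in> brauer_diagrams r"
    and "\<And>v. v \<in> {1..2 * r} \<Longrightarrow> partner D v = partner D' v"
  shows "D = D'"
  using edge_iff_partner[OF D(1)] edge_iff_partner[OF D(2)] assms(3) by auto

text \<open>
  Permuting one set of end points of a family of edges has the same effect as applying the inverse
  permutation to the opposite end points.
\<close>

lemma asym_partner:
  assumes D: "D \<in> brauer_diagrams r" and J: "J \<subseteq> {1..2 * r}"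
    and disj: "partner D ` J \<inter> J = {}"
  shows "asym (partner D ` J) (basis_diagram D) = (asym J (basis_diagram D) :: diagram \<Rightarrow> 'a::comm_ring_1)"
proof
  fix D'
  let ?q = "partner D"
  have q: "?q permutes {1..2 * r}" by (rule partner_permutes[OF D])
  have qq: "?q (?q v) = v" for v by (rule partner_partner[OF D])
  have qinv: "inv ?q = ?q" using qq by (intro inv_unique_comp) (auto simp: fun_eq_iff)
  have finJ: "finite J" using J finite_subset by blast
  have qper: "permutation ?q" using q permutation_permutes by blast
  \<comment> \<open>\<open>c \<pi>\<close> is the permutation \<open>\<pi>\<close> transported along
    the edges: it acts on the opposite end points as \<open>\<pi>\<close> acts on
    \<open>J\<close>.\<close>
  define c where "c \<pi> = ?q \<circ> \<pi> \<circ> ?q" for \<pi>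
  have cper: "c \<pi> permutes ?q ` J" if "\<pi> permutes J" for \<pi>
    unfolding c_def using permutes_conj[OF permutes_bij[OF q] that] by (simp add: qinv)
  have cc: "c (c \<pi>) = \<pi>" for \<pi> unfolding c_def by (auto simp: fun_eq_iff qq)
  have qJ: "?q ` ?q ` J = J" using qq by (force simp: image_image)
  have cper': "c \<pi> permutes J" if "\<pi> permutes ?q ` J" for \<pi>
    unfolding c_def using permutes_conj[OF permutes_bij[OF q] that] by (simp only: qinv qJ)
  have bb: "bij_betw (\<lambda>\<pi>. c (inv \<pi>)) {\<pi>. \<pi> permutes J} {\<pi>. \<pi> permutes ?q ` J}"
  proof (rule bij_betw_byWitness[where f' = "\<lambda>\<pi>. inv (c \<pi>)"])
    show "\<forall>\<pi>\<in>{\<pi>. \<pi> permutes J}. inv (c (c (inv \<pi>))) = \<pi>"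
      using cc permutes_inv_inv by auto
    show "\<forall>\<pi>\<in>{\<pi>. \<pi> permutes ?q ` J}. c (inv (inv (c \<pi>))) = \<pi>"
      using cc cper' permutes_inv_inv by (metis mem_Collect_eq)
    show "(\<lambda>\<pi>. c (inv \<pi>)) ` {\<pi>. \<pi> permutes J} \<subseteq> {\<pi>. \<pi> permutes ?q ` J}"
      using cper permutes_inv by blast
    show "(\<lambda>\<pi>. inv (c \<pi>)) ` {\<pi>. \<pi> permutes ?q ` J} \<subseteq> {\<pi>. \<pi> permutes J}"
      using cper' permutes_inv by blast
  qed
  have sgn: "sign (c (inv \<pi>)) = sign \<pi>" if "\<pi> permutes J" for \<pi>
  proof -
    have "permutation \<pi>" using that finJ permutation_permutes by blast
    then show ?thesis unfolding c_def
      using sign_conj[OF qper permutation_inverse] by (simp add: qinv sign_inverse)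
  qed
  have eq: "dact (c (inv \<pi>)) D = dact \<pi> D" if p: "\<pi> permutes J" for \<pi>
  proof -
    have p': "\<pi> permutes {1..2 * r}" by (rule permutes_subset[OF p J])
    have cp: "c \<pi> permutes {1..2 * r}"
      unfolding c_def by (intro permutes_compose q p')
    have fixc: "c \<pi> v = v" if "v \<notin> ?q ` J" for v using permutes_not_in[OF cper[OF p] that] .
    have fixp: "\<pi> v = v" if "v \<notin> J" for v using permutes_not_in[OF p that] .
    \<comment> \<open>Applying \<open>\<pi>\<close> to the end points in \<open>J\<close> and its
      transport \<open>c \<pi>\<close> to the opposite ones moves whole edges, hence fixes
      \<open>D\<close>. So \<open>\<pi>\<close> alone has the same effect on \<open>D\<close> as the
      inverse of \<open>c \<pi>\<close>.\<close>
    let ?g = "c \<pi> \<circ> \<pi>"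
    have inJ: "\<pi> v \<in> J \<longleftrightarrow> v \<in> J" for v using permutes_in_image[OF p] .
    have fixD: "dact ?g D = D"
    proof (rule dact_fixI[OF D])
      show "?g permutes {1..2 * r}" by (intro permutes_compose p' cp)
      fix v assume v: "v \<in> {1..2 * r}"
      have qv: "?q v \<in> ?q ` J \<longleftrightarrow> v \<in> J" for v using qq by (metis image_iff)
      show "?g (?q v) = ?q (?g v)"
      proof (cases "v \<in> J")
        case True
        then have "?q v \<notin> J" "\<pi> v \<notin> ?q ` J" using disj inJ by blast+
        then show ?thesis using fixc fixp by (simp add: c_def qq)
      next
        case False
        note F = this
        show ?thesis
        proof (cases "?q v \<in> J")
          case True
          then have "\<pi> (?q v) \<notin> ?q ` J" using disj inJ by blast
          then show ?thesis using fixp[OF F] fixc by (simp add: c_def qq)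
        next
          case False
          then have "v \<notin> ?q ` J" using qq by (metis image_iff)
          moreover have "?q v \<notin> ?q ` J" using qv F by blast
          ultimately show ?thesis using fixp[OF F] fixp[OF False] fixc by simp
        qed
      qed
    qed
    have "c (inv \<pi>) \<circ> c \<pi> = c (inv \<pi> \<circ> \<pi>)" unfolding c_def by (auto simp: fun_eq_iff qq)
    also have "\<dots> = id" using permutes_inv_o[OF p] by (auto simp: c_def fun_eq_iff qq)
    finally have "c (inv \<pi>) \<circ> ?g = \<pi>" by (simp add: comp_assoc[symmetric])
    then have "dact \<pi> D = dact (c (inv \<pi>)) (dact ?g D)" by (simp only: dact_comp[symmetric])
    then show ?thesis unfolding fixD ..
  qed
  have "asym (?q ` J) (basis_diagram D) D' =
     (\<Sum>\<pi> | \<pi> permutes J. of_int (sign (c (inv \<pi>))) * basis_diagram (dact (c (inv \<pi>)) D) D' :: 'a)"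
    unfolding asym_basis by (rule sum.reindex_bij_betw[OF bb, symmetric])
  also have "\<dots> = asym J (basis_diagram D) D'"
    unfolding asym_basis by (intro sum.cong refl) (simp add: sgn eq)
  finally show "asym (?q ` J) (basis_diagram D) D' = (asym J (basis_diagram D) D' :: 'a)" .
qed

section \<open>Linear relations between the colouring functionals of diagrams\<close>

text \<open>For \<open>h = join r f g\<close> this is the entry of the matrix of \<open>x\<close> at
  the basis tensors indexed by \<open>f\<close> (image) and \<open>g\<close> (argument), as
  \<open>nu_btensor\<close> will show.\<close>

definition ev :: "nat \<Rightarrow> (diagram \<Rightarrow> 'a::comm_ring_1) \<Rightarrow> (nat \<Rightarrow> 'c) \<Rightarrow> 'a" where
  "ev r x h = (\<Sum>D\<in>brauer_diagrams r. x D * of_bool (compat h D))"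

lemma ev_sum: "ev r (\<lambda>D. \<Sum>a\<in>A. c a * X a D) h = (\<Sum>a\<in>A. c a * ev r (X a) h)"
  unfolding ev_def sum_distrib_right sum_distrib_left
  by (subst sum.swap) (simp only: mult.assoc)

lemma ev_add: "ev r (\<lambda>D. x D + y D) h = ev r x h + ev r y h"
  unfolding ev_def by (simp add: distrib_right sum.distrib)

lemma ev_diff: "ev r (\<lambda>D. x D - y D) h = ev r x h - ev r y h"
  unfolding ev_def by (simp add: left_diff_distrib sum_subtractf)

lemma ev_basis:
  assumes "D \<in> brauer_diagrams r"
  shows "ev r (basis_diagram D) h = of_bool (compat h D)"
proof -
  have "ev r (basis_diagram D) h = (\<Sum>E\<in>brauer_diagrams r. if E = D then of_bool (compat h E) else 0)"
    unfolding ev_def basis_diagram_def by (intro sum.cong refl) simp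
  then show ?thesis using assms by simp
qed

text \<open>By the pigeonhole principle two vertices of \<open>J\<close> have the same colour.
  Composing \<open>\<pi>\<close> with their transposition changes the sign of a summand but not the
  colouring \<open>h \<circ> \<pi>\<close>, so the sum equals its negative.\<close>

lemma ev_asym_eq_0:
  fixes h :: "nat \<Rightarrow> 'c::finite"
  assumes D: "D \<in> brauer_diagrams r" and J: "J \<subseteq> {1..2 * r}" "card J > CARD('c)"
    and two: "(2 :: 'a::field) \<noteq> 0"
  shows "ev r (asym J (basis_diagram D)) h = (0 :: 'a)"
proof -
  have finJ: "finite J" using J finite_subset by blast
  have "\<not> inj_on h J"
  proof
    assume "inj_on h J"
    then have "card J \<le> CARD('c)" by (metis card_image card_mono finite subset_UNIV)
    then show False using J(2) by simp
  qed
  then obtain u v where uv: "u \<in> J" "v \<in> J" "u \<noteq> v" "h u = h v" by (auto simp: inj_on_def)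
  let ?t = "vswap u v"
  have t: "?t permutes J" by (rule permutes_swap_id[OF uv(1,2)])
  have ht: "h \<circ> ?t = h" using uv(4) by (auto simp: fun_eq_iff Transposition.transpose_def)
  have "ev r (asym J (basis_diagram D)) h =
    (\<Sum>\<pi> | \<pi> permutes J. of_int (sign \<pi>) * ev r (basis_diagram (dact \<pi> D)) h :: 'a)"
    unfolding asym_basis by (rule ev_sum)
  also have "\<dots> = (\<Sum>\<pi> | \<pi> permutes J. of_int (sign \<pi>) * of_bool (compat (h \<circ> \<pi>) D))"
  proof (intro sum.cong refl, simp only: mem_Collect_eq)
    fix \<pi> assume "\<pi> permutes J"
    then have "dact \<pi> D \<in> brauer_diagrams r" by (intro dact_closed[OF D] permutes_subset[OF _ J(1)])
    then show "of_int (sign \<pi>) * ev r (basis_diagram (dact \<pi> D)) h = (of_int (sign \<pi>) * of_bool (compat (h \<circ> \<pi>) D) :: 'a)"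
      by (simp add: ev_basis compat_dact)
  qed
  finally have 1: "ev r (asym J (basis_diagram D)) h =
    (\<Sum>\<pi> | \<pi> permutes J. of_int (sign \<pi>) * of_bool (compat (h \<circ> \<pi>) D) :: 'a)" (is "_ = ?S") .
  also have "?S = (\<Sum>\<pi> | \<pi> permutes J. of_int (sign (?t \<circ> \<pi>)) * of_bool (compat (h \<circ> (?t \<circ> \<pi>)) D))"
    by (rule setum_permutations_compose_left[OF t])
  also have "\<dots> = (\<Sum>\<pi> | \<pi> permutes J. - (of_int (sign \<pi>) * of_bool (compat (h \<circ> \<pi>) D)))"
    by (intro sum.cong refl)
      (simp add: finite_permutes_sign[OF t _ finJ] sign_swap_id uv(3) comp_assoc[symmetric] ht)
  also have "\<dots> = - ?S" by (rule sum_negf)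
  finally have "2 * ?S = 0" using 1 by (simp only: mult_2 eq_neg_iff_add_eq_0)
  then show ?thesis using 1 two by simp
qed

text \<open>Each edge is seen from both ends, so this is twice the sum of the products of end
  points. Nested edges make it small, chains make it large.\<close>

definition weight :: "nat \<Rightarrow> diagram \<Rightarrow> nat" where
  "weight r D = (\<Sum>v\<in>{1..2 * r}. v * partner D v)"

text \<open>A family of pairwise non-nested edges, encoded by the set of their upper end points.
  Disjoint edges side by side count as non-nested.\<close>

definition chain :: "nat \<Rightarrow> diagram \<Rightarrow> nat set \<Rightarrow> bool" where
  "chain r D S \<longleftrightarrow> S \<subseteq> {1..2 * r} \<and> (\<forall>x\<in>S. partner D x < x) \<and>
     (\<forall>x\<in>S. \<forall>y\<in>S. x < y \<longrightarrow> partner D x < partner D y)"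

text \<open>The least moved point \<open>x\<close> and its preimage form an inversion, since
  \<open>\<pi>\<close> fixes everything below \<open>x\<close>.\<close>

lemma permutes_inversion:
  fixes S :: "nat set"
  assumes p: "\<pi> permutes S" and "\<pi> \<noteq> id"
  obtains x z where "x \<in> S" "z \<in> S" "x < z" "\<pi> z < \<pi> x"
proof -
  have "\<exists>x. \<pi> x \<noteq> x" using assms(2) by (auto simp: fun_eq_iff)
  define x where "x = (LEAST x. \<pi> x \<noteq> x)"
  have x: "\<pi> x \<noteq> x" unfolding x_def by (rule LeastI_ex) fact
  have least: "\<pi> y = y" if "y < x" for y using not_less_Least[of y "\<lambda>x. \<pi> x \<noteq> x"] that unfolding x_def by blast
  define z where "z = inv \<pi> x"
  have z: "\<pi> z = x" unfolding z_def by (rule permutes_inverses(1)[OF p])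
  have inj: "inj \<pi>" by (rule permutes_inj[OF p])
  have "\<not> z < x" using least[of z] z by auto
  then have "x < z" using x z by (metis nat_neq_iff)
  moreover have "x < \<pi> x"
  proof (rule ccontr)
    assume "\<not> x < \<pi> x"
    then have "\<pi> x < x" using x by simp
    then have "\<pi> (\<pi> x) = \<pi> x" by (rule least)
    then show False using inj x by (simp add: inj_eq)
  qed
  moreover have "x \<in> S" using permutes_not_in[OF p] x by blast
  moreover have "z \<in> S" using permutes_not_in[OF p, of z] x z by fastforce
  ultimately show ?thesis using that z by simp
qed

text \<open>Undoing an inversion strictly increases the sum because \<open>q\<close> is strictly
  increasing on \<open>S\<close>; hence the maximum over all permutations is attained at the
  identity only.\<close>

lemma rearrangement_strict:
  fixes q :: "nat \<Rightarrow> nat"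
  assumes fin: "finite S" and mono: "\<And>x y. x \<in> S \<Longrightarrow> y \<in> S \<Longrightarrow> x < y \<Longrightarrow> q x < q y"
    and p: "\<pi> permutes S" "\<pi> \<noteq> id"
  shows "(\<Sum>x\<in>S. \<pi> x * q x) < (\<Sum>x\<in>S. x * q x)"
proof -
  define f where "f \<rho> = (\<Sum>x\<in>S. \<rho> x * q x)" for \<rho> :: "nat \<Rightarrow> nat"
  have improve: "\<exists>\<rho>'. \<rho>' permutes S \<and> f \<rho> < f \<rho>'" if \<rho>: "\<rho> permutes S" "\<rho> \<noteq> id" for \<rho>
  proof -
    obtain x z where xz: "x \<in> S" "z \<in> S" "x < z" "\<rho> z < \<rho> x" using permutes_inversion[OF \<rho>] .
    let ?\<rho> = "\<rho> \<circ> vswap x z"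
    have "?\<rho> permutes S" by (intro permutes_compose permutes_swap_id xz \<rho>)
    have split: "f \<sigma> = \<sigma> x * q x + (\<sigma> z * q z + (\<Sum>y\<in>S - {x} - {z}. \<sigma> y * q y))" for \<sigma> :: "nat \<Rightarrow> nat"
      unfolding f_def using fin xz
      by (subst sum.remove[of S x], simp, simp, subst sum.remove[of "S - {x}" z]) auto
    have rest: "(\<Sum>y\<in>S - {x} - {z}. ?\<rho> y * q y) = (\<Sum>y\<in>S - {x} - {z}. \<rho> y * q y)"
      by (intro sum.cong refl) (auto simp: Transposition.transpose_def)
    have sw: "?\<rho> x = \<rho> z" "?\<rho> z = \<rho> x" using xz by (simp_all add: Transposition.transpose_def)
    obtain a where a: "\<rho> x = \<rho> z + a" "a > 0" by (rule that[of "\<rho> x - \<rho> z"]) (use xz(4) in auto)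
    obtain b where b: "q z = q x + b" "b > 0" by (rule that[of "q z - q x"]) (use mono[OF xz(1-3)] in auto)
    have "\<rho> x * q x + \<rho> z * q z < \<rho> z * q x + \<rho> x * q z"
      unfolding a b by (use a(2) b(2) in \<open>simp add: algebra_simps\<close>)
    then have "f \<rho> < f ?\<rho>" unfolding split[of \<rho>] split[of ?\<rho>] rest sw by simp
    then show ?thesis using \<open>?\<rho> permutes S\<close> by blast
  qed
  let ?F = "f ` {\<rho>. \<rho> permutes S}"
  have finF: "finite ?F" using finite_permutations[OF fin] by simp
  have "Max ?F \<in> ?F" by (rule Max_in[OF finF]) (use permutes_id in blast)
  then obtain \<rho> where \<rho>: "\<rho> permutes S" "f \<rho> = Max ?F" by auto
  have le: "f \<sigma> \<le> Max ?F" if "\<sigma> permutes S" for \<sigma> using that finF by (intro Max_ge) auto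
  have "\<rho> = id" using improve[OF \<rho>(1)] le \<rho>(2) by (metis leD)
  then have top: "f id = Max ?F" using \<rho>(2) by simp
  obtain \<rho>' where "\<rho>' permutes S" "f \<pi> < f \<rho>'" using improve[OF p] by blast
  then have "f \<pi> < f id" using le[of \<rho>'] top by simp
  then show ?thesis by (simp add: f_def)
qed

text \<open>The lower end points of a chain lie outside \<open>S\<close> and are fixed by
  \<open>\<pi>\<close>, so the chain contributes twice the sum of \<open>\<pi> x * ?q x\<close> over
  \<open>S\<close>, while the other edges are unchanged. The rearrangement inequality compares the
  two sums.\<close>

lemma weight_dact_chain:
  assumes D: "D \<in> brauer_diagrams r" and S: "chain r D S" and p: "\<pi> permutes S" "\<pi> \<noteq> id"
  shows "weight r (dact \<pi> D) < weight r D"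
proof -
  let ?q = "partner D" and ?V = "{1..2 * r}"
  have SV: "S \<subseteq> ?V" and lt: "\<And>x. x \<in> S \<Longrightarrow> ?q x < x" using S by (auto simp: chain_def)
  have finS: "finite S" using SV finite_subset by blast
  have pV: "\<pi> permutes ?V" by (rule permutes_subset[OF p(1) SV])
  have qq: "?q (?q v) = v" for v by (rule partner_partner[OF D])
  have qV: "?q permutes ?V" by (rule partner_permutes[OF D])
  have nin: "?q x \<notin> S" if "x \<in> S" for x using lt[of "?q x"] lt[OF that] by (auto simp: qq)
  have fx: "\<pi> v = v" if "v \<notin> S" for v using permutes_not_in[OF p(1) that] .
  have "weight r (dact \<pi> D) = (\<Sum>v\<in>?V. \<pi> v * partner (dact \<pi> D) (\<pi> v))"
    unfolding weight_def by (rule sum.permute[OF pV, unfolded comp_def])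
  also have "\<dots> = (\<Sum>v\<in>?V. \<pi> v * \<pi> (?q v))" by (intro sum.cong refl) (simp add: partner_dact[OF D pV])
  finally have w: "weight r (dact \<pi> D) = (\<Sum>v\<in>?V. \<pi> v * \<pi> (?q v))" .
  have split: "(\<Sum>v\<in>?V. \<sigma> v * \<sigma> (?q v)) = 2 * (\<Sum>x\<in>S. \<sigma> x * ?q x) + (\<Sum>v\<in>?V - (S \<union> ?q ` S). \<sigma> v * \<sigma> (?q v))"
    if \<sigma>: "\<And>v. v \<notin> S \<Longrightarrow> \<sigma> v = v" for \<sigma> :: "nat \<Rightarrow> nat"
  proof -
    have qS: "?q ` S \<subseteq> ?V" using SV permutes_image[OF qV] by blast
    have "(\<Sum>v\<in>?V. \<sigma> v * \<sigma> (?q v)) = (\<Sum>v\<in>S \<union> ?q ` S. \<sigma> v * \<sigma> (?q v)) + (\<Sum>v\<in>?V - (S \<union> ?q ` S). \<sigma> v * \<sigma> (?q v))"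
      by (subst add.commute, rule sum.subset_diff) (use SV qS in auto)
    also have "(\<Sum>v\<in>S \<union> ?q ` S. \<sigma> v * \<sigma> (?q v)) = (\<Sum>v\<in>S. \<sigma> v * \<sigma> (?q v)) + (\<Sum>v\<in>?q ` S. \<sigma> v * \<sigma> (?q v))"
      by (rule sum.union_disjoint) (use finS nin in auto)
    also have "(\<Sum>v\<in>?q ` S. \<sigma> v * \<sigma> (?q v)) = (\<Sum>x\<in>S. \<sigma> (?q x) * \<sigma> x)"
      by (subst sum.reindex) (auto simp: qq intro: inj_on_subset[OF permutes_inj[OF qV]])
    also have "(\<Sum>v\<in>S. \<sigma> v * \<sigma> (?q v)) = (\<Sum>x\<in>S. \<sigma> x * ?q x)"
      by (intro sum.cong refl) (simp add: \<sigma> nin)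
    also have "(\<Sum>x\<in>S. \<sigma> (?q x) * \<sigma> x) = (\<Sum>x\<in>S. \<sigma> x * ?q x)"
      by (intro sum.cong refl) (simp add: \<sigma> nin)
    finally show ?thesis by simp
  qed
  have "(\<Sum>v\<in>?V - (S \<union> ?q ` S). \<pi> v * \<pi> (?q v)) = (\<Sum>v\<in>?V - (S \<union> ?q ` S). v * ?q v)"
  proof (intro sum.cong refl)
    fix v assume "v \<in> ?V - (S \<union> ?q ` S)"
    then have "v \<notin> S" "?q v \<notin> S" using imageI[of "?q v" S ?q] by (auto simp: qq)
    then show "\<pi> v * \<pi> (?q v) = v * ?q v" by (simp add: fx)
  qed
  moreover have "(\<Sum>x\<in>S. \<pi> x * ?q x) < (\<Sum>x\<in>S. x * ?q x)"
    by (rule rearrangement_strict[OF finS _ p]) (use S in \<open>auto simp: chain_def\<close>)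
  ultimately show ?thesis
    using w split[of \<pi>, OF fx] split[of "\<lambda>v. v"] by (simp add: weight_def)
qed

text \<open>Each colour class is a rainbow, one edge enclosing the next; equivalently, no two edges
  of the same colour form a chain.\<close>

definition nested :: "nat \<Rightarrow> (nat \<Rightarrow> 'c) \<Rightarrow> diagram \<Rightarrow> bool" where
  "nested r h D \<longleftrightarrow> (\<forall>v\<in>{1..2 * r}. \<forall>w\<in>{1..2 * r}. partner D v < v \<longrightarrow> partner D w < w \<longrightarrow>
     v < w \<longrightarrow> h v = h w \<longrightarrow> partner D w < partner D v)"

lemma compat_partner:
  assumes "D \<in> brauer_diagrams r" "compat h D" "v \<in> {1..2 * r}"
  shows "h (partner D v) = h v"
  using partner_props(1)[OF assms(1,3)] assms(2) unfolding compat_def by blast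

text \<open>In a rainbow the least vertex not yet matched is joined to the greatest available vertex
  of its colour. So at the first disagreement \<open>D\<close> cannot have the smaller
  partner.\<close>

lemma nested_unique_aux:
  assumes D: "D \<in> brauer_diagrams r" "compat h D" "nested r h D"
    and D': "D' \<in> brauer_diagrams r" "compat h D'"
    and x: "x \<in> {1..2 * r}" "partner D x < partner D' x"
    and least: "\<And>z. z < x \<Longrightarrow> partner D z = partner D' z"
  shows False
proof -
  let ?q = "partner D" and ?q' = "partner D'" and ?V = "{1..2 * r}"
  have qq: "?q (?q v) = v" "?q' (?q' v) = v" for v
    using partner_partner D(1) D'(1) by auto
  \<comment> \<open>The edge \<open>{w, y'}\<close> of \<open>D\<close> has the same colour as
    \<open>{x, y}\<close>. If \<open>w < y'\<close>, nesting forces \<open>w < x\<close>, where both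
    diagrams agree; if \<open>y' < w\<close>, it forces \<open>y' < x\<close>. Both are
    absurd.\<close>
  define y y' w where "y = ?q x" and "y' = ?q' x" and "w = ?q y'"
  have V: "y \<in> ?V" "y' \<in> ?V" unfolding y_def y'_def
    using partner_props(3)[OF D(1) x(1)] partner_props(3)[OF D'(1) x(1)] by auto
  then have wV: "w \<in> ?V" unfolding w_def using partner_props(3)[OF D(1)] by blast
  have "y \<noteq> x" unfolding y_def by (rule partner_props(2)[OF D(1) x(1)])
  moreover have "\<not> y < x"
  proof
    assume "y < x"
    then have "?q' y = x" using least[of y] qq y_def by simp
    then have "?q' x = y" using qq by metis
    then show False using x(2) y_def by simp
  qed
  ultimately have xy: "x < y" by simp
  have yy': "y < y'" using x(2) y_def y'_def by simp
  have hy: "h y = h x" "h y' = h x"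
    unfolding y_def y'_def using compat_partner[OF D(1,2) x(1)] compat_partner[OF D'(1,2) x(1)] by auto
  have hw: "h w = h x" unfolding w_def using compat_partner[OF D(1,2) V(2)] hy by simp
  have qy: "?q y = x" "?q w = y'" using qq by (simp_all add: y_def w_def)
  have "w \<noteq> y'" unfolding w_def by (rule partner_props(2)[OF D(1) V(2)])
  then consider "w < y'" | "y' < w" by linarith
  then show False
  proof cases
    case 1
    then have "w < x"
      using D(3) V xy yy' hy qy(1) w_def unfolding nested_def by metis
    then have "?q' w = y'" using least[of w] qy by simp
    then have "?q' y' = w" using qq by metis
    then show False using qq y'_def \<open>w < x\<close> by simp
  next
    case 2
    have "?q w < ?q y"
      by (rule D(3)[unfolded nested_def, rule_format]) (use 2 V wV xy yy' hy hw qy in auto)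
    then show False using qy xy yy' by simp
  qed
qed

lemma nested_unique:
  assumes D: "D \<in> brauer_diagrams r" "compat h D" "nested r h D"
    and D': "D' \<in> brauer_diagrams r" "compat h D'" "nested r h D'"
  shows "D = D'"
proof (rule diagram_eqI_partner[OF D(1) D'(1)], rule ccontr)
  fix v assume v: "v \<in> {1..2 * r}" "partner D v \<noteq> partner D' v"
  define x where "x = (LEAST v. partner D v \<noteq> partner D' v)"
  have x: "partner D x \<noteq> partner D' x" unfolding x_def by (rule LeastI) (rule v(2))
  have least: "partner D z = partner D' z" if "z < x" for z
    using not_less_Least that unfolding x_def by blast
  have xV: "x \<in> {1..2 * r}" using x partner_outside D(1) D'(1) by metis
  from x consider "partner D x < partner D' x" | "partner D' x < partner D x" by linarith
  then show False
  proof cases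
    case 1
    show ?thesis by (rule nested_unique_aux[OF D D'(1,2) xV 1 least])
  next
    case 2
    show ?thesis by (rule nested_unique_aux[OF D' D(1,2) xV 2 least[symmetric]])
  qed
qed

text \<open>Two equally coloured edges that are not nested form a chain of length two. Exchanging
  their upper end points keeps the colouring compatible and lowers the weight.\<close>

lemma nested_if_minimal:
  assumes D: "D \<in> brauer_diagrams r" "compat h D"
    and min: "\<And>D'. D' \<in> brauer_diagrams r \<Longrightarrow> compat h D' \<Longrightarrow> weight r D \<le> weight r D'"
  shows "nested r h D"
  unfolding nested_def
proof (intro ballI impI, rule ccontr)
  fix v w assume vw: "v \<in> {1..2 * r}" "w \<in> {1..2 * r}" "partner D v < v" "partner D w < w" "v < w" "h v = h w"
    "\<not> partner D w < partner D v"
  have "partner D v \<noteq> partner D w" using partner_partner[OF D(1)] vw(5) by (metis less_irrefl)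
  then have ch: "chain r D {v, w}" using vw by (auto simp: chain_def)
  have t: "vswap v w permutes {v, w}" by (rule permutes_swap_id) auto
  have "vswap v w \<noteq> id"
  proof
    assume "vswap v w = id"
    then have "vswap v w v = v" by simp
    then show False using vw(5) by simp
  qed
  then have "weight r (dact (vswap v w) D) < weight r D" by (rule weight_dact_chain[OF D(1) ch t])
  moreover have "dact (vswap v w) D \<in> brauer_diagrams r" by (rule transpose_closed[OF D(1) vw(2,1)])
  moreover have "compat h (dact (vswap v w) D)"
  proof -
    have "h \<circ> vswap v w = h" using vw(6) by (auto simp: fun_eq_iff Transposition.transpose_def)
    then show ?thesis using D(2) by (simp add: compat_dact)
  qed
  ultimately show False using min by fastforce
qed

text \<open>A compatible diagram of least weight is nested, hence equal to \<open>D\<close> by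
  uniqueness; another one of the same weight would be nested too.\<close>

lemma nested_weight_less:
  assumes D: "D \<in> brauer_diagrams r" "compat h D" "nested r h D"
    and D': "D' \<in> brauer_diagrams r" "compat h D'" "D' \<noteq> D"
  shows "weight r D < weight r D'"
proof -
  let ?C = "{E \<in> brauer_diagrams r. compat h E}"
  have fin: "finite (weight r ` ?C)" by simp
  have "Min (weight r ` ?C) \<in> weight r ` ?C" by (rule Min_in[OF fin]) (use D in auto)
  then obtain M where M: "M \<in> brauer_diagrams r" "compat h M" "weight r M = Min (weight r ` ?C)" by auto
  have le: "weight r M \<le> weight r E" if "E \<in> brauer_diagrams r" "compat h E" for E
    unfolding M(3) by (rule Min_le[OF fin]) (use that in auto)
  have "nested r h M" by (rule nested_if_minimal[OF M(1,2) le])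
  then have MD: "M = D" using nested_unique[OF M(1,2) _ D] by blast
  have "weight r D' \<noteq> weight r D"
  proof
    assume "weight r D' = weight r D"
    then have "nested r h D'" using nested_if_minimal[OF D'(1,2)] le MD by simp
    then show False using nested_unique[OF D'(1,2) _ D] D'(3) by blast
  qed
  then show ?thesis using le[OF D'(1,2)] MD by simp
qed

text \<open>
  The rank of an edge is the length of the longest chain ending in it; edges of the same rank are
  pairwise nested. Without chains of length \<open>n + 1\<close> the ranks serve as \<open>n\<close> colours.
\<close>

lemma nested_colouring_exists:
  assumes D: "D \<in> brauer_diagrams r" and no: "\<And>S. chain r D S \<Longrightarrow> card S \<noteq> CARD('c::finite) + 1"
  obtains h :: "nat \<Rightarrow> 'c::finite" where "compat h D" "nested r h D"
proof -
  let ?q = "partner D" and ?V = "{1..2 * r}"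
  have qq: "?q (?q v) = v" for v by (rule partner_partner[OF D])
  \<comment> \<open>\<open>A v\<close> consists of the chains whose last edge is the one with upper
    end point \<open>v\<close>.\<close>
  define A where "A v = {S. chain r D S \<and> v \<in> S \<and> S \<subseteq> {..v}}" for v
  define rk where "rk v = Max (card ` A v)" for v
  have finA: "finite (card ` A v)" for v
    by (intro finite_imageI finite_subset[of "A v" "Pow ?V"]) (auto simp: A_def chain_def)
  have bound: "card S \<le> CARD('c)" if "chain r D S" for S
  proof (rule ccontr)
    assume "\<not> card S \<le> CARD('c)"
    then have "CARD('c) + 1 \<le> card S" by simp
    then obtain T where T: "T \<subseteq> S" "card T = CARD('c) + 1" by (rule obtain_subset_with_card_n)
    have "chain r D T" using that T(1) unfolding chain_def by blast
    then show False using no T by blast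
  qed
  have sing: "{v} \<in> A v" if "v \<in> ?V" "?q v < v" for v using that by (auto simp: A_def chain_def)
  have rk_range: "rk v \<in> {1..CARD('c)}" if v: "v \<in> ?V" "?q v < v" for v
  proof -
    have "rk v \<in> card ` A v" unfolding rk_def by (rule Max_in[OF finA]) (use sing[OF v] in blast)
    then have "rk v \<le> CARD('c)" using bound by (auto simp: A_def)
    moreover have "card {v} \<le> rk v" unfolding rk_def by (rule Max_ge[OF finA]) (use sing[OF v] in blast)
    ultimately show ?thesis by simp
  qed
  have rk_less: "rk v < rk w" if v: "v \<in> ?V" "?q v < v" and w: "w \<in> ?V" "?q w < w" and vw: "v < w" "?q v < ?q w" for v w
  proof -
    have "rk v \<in> card ` A v" unfolding rk_def by (rule Max_in[OF finA]) (use sing[OF v] in blast)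
    then obtain S where S: "S \<in> A v" "rk v = card S" by auto
    have finS: "finite S" by (rule finite_subset[of _ ?V]) (use S(1) in \<open>auto simp: A_def chain_def\<close>)
    have below: "x < w \<and> ?q x < ?q w" if "x \<in> S" for x
    proof -
      have "x \<le> v" using S(1) that by (auto simp: A_def)
      moreover have "?q x < ?q v" if "x < v" using S(1) \<open>x \<in> S\<close> that by (auto simp: A_def chain_def)
      ultimately show ?thesis using vw by (cases "x = v") auto
    qed
    have "chain r D (insert w S)" unfolding chain_def
    proof (intro conjI ballI impI)
      show "insert w S \<subseteq> ?V" using S(1) w(1) by (auto simp: A_def chain_def)
      show "?q x < x" if "x \<in> insert w S" for x using that S(1) w(2) by (auto simp: A_def chain_def)
      show "?q x < ?q y" if "x \<in> insert w S" "y \<in> insert w S" "x < y" for x y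
        using that S(1) below by (auto simp: A_def chain_def dest: less_asym)
    qed
    moreover have "insert w S \<subseteq> {..w}" using below by (auto intro: less_imp_le)
    ultimately have "insert w S \<in> A w" by (simp add: A_def)
    then have "card (insert w S) \<le> rk w" unfolding rk_def by (intro Max_ge[OF finA]) blast
    moreover have "w \<notin> S" using below by blast
    ultimately show ?thesis using S(2) finS by simp
  qed
  obtain c :: "nat \<Rightarrow> 'c" where c: "bij_betw c {1..CARD('c)} UNIV"
    using ex_bij_betw_nat_finite_1[OF finite, of "UNIV :: 'c set"] by blast
  \<comment> \<open>\<open>max v (?q v)\<close> is the upper end point of the edge at
    \<open>v\<close>, so that \<open>h\<close> depends on the edge only; \<open>c\<close> turns
    ranks into colours.\<close>
  define h where "h v = c (rk (max v (?q v)))" for v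
  have "compat h D"
    unfolding compat_def
  proof (intro ballI)
    fix e u v assume e: "e \<in> D" "u \<in> e" "v \<in> e"
    then obtain x where x: "e = {x, ?q x}" using edge_iff_partner[OF D] by blast
    have "h (?q x) = h x" by (simp add: h_def qq max.commute)
    then show "h u = h v" using e x by auto
  qed
  moreover have "nested r h D"
    unfolding nested_def
  proof (intro ballI impI)
    fix v w assume vw: "v \<in> ?V" "w \<in> ?V" "?q v < v" "?q w < w" "v < w" "h v = h w"
    have "c (rk v) = c (rk w)" using vw by (simp add: h_def max_def)
    then have "rk v = rk w"
      using c rk_range[OF vw(1,3)] rk_range[OF vw(2,4)] by (auto simp: bij_betw_def dest: inj_onD)
    then have "\<not> ?q v < ?q w" using rk_less[OF vw(1,3) vw(2,4) vw(5)] by auto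
    moreover have "?q v \<noteq> ?q w" using qq vw(5) by (metis less_irrefl)
    ultimately show "?q w < ?q v" by simp
  qed
  ultimately show ?thesis using that by blast
qed

text \<open>Elimination of leading terms. If all colourings annihilate \<open>x\<close>, then each
  of its heaviest diagrams contains a chain of \<open>CARD('c) + 1\<close> edges. Subtracting the
  antisymmetrisations over these chains, whose other summands are lighter, lowers the greatest
  weight in \<open>x\<close>. \<open>P\<close> is any subspace that contains such
  antisymmetrisations; it will be the ideal.\<close>

theorem colouring_relations:
  fixes x :: "diagram \<Rightarrow> 'a::field"
  assumes two: "(2 :: 'a) \<noteq> 0" and P: "linear_subset P"
    and gadgets: "\<And>D J. D \<in> brauer_diagrams r \<Longrightarrow> J \<subseteq> {1..2 * r} \<Longrightarrow> card J = CARD('c::finite) + 1 \<Longrightarrow>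
      asym J (basis_diagram D) \<in> P"
    and x: "x \<in> carrier (brauer_algebra r \<delta>)" "\<And>h :: nat \<Rightarrow> 'c::finite. ev r x h = 0"
  shows "x \<in> P"
proof -
  have "x \<in> P" if "x \<in> carrier (brauer_algebra r \<delta>)" "\<And>h :: nat \<Rightarrow> 'c. ev r x h = 0"
    "\<And>D. x D \<noteq> 0 \<Longrightarrow> weight r D < M" for x M
    using that
  proof (induction M arbitrary: x)
    case 0
    then have "x = (\<lambda>D. 0)" by (intro ext) blast
    then show ?case using P by (simp add: linear_subset_def)
  next
    case (Suc M)
    define T where "T = {D \<in> brauer_diagrams r. weight r D = M \<and> x D \<noteq> 0}"
    have finT: "finite T" by (simp add: T_def)
    have x0: "x D = 0" if "D \<notin> brauer_diagrams r" for D using Suc.prems(1) that by simp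
    have "\<exists>J. chain r D J \<and> card J = CARD('c) + 1" if D: "D \<in> T" for D
    proof (rule ccontr)
      assume "\<nexists>J. chain r D J \<and> card J = CARD('c) + 1"
      then have no: "card S \<noteq> CARD('c) + 1" if "chain r D S" for S using that by blast
      have DB: "D \<in> brauer_diagrams r" "weight r D = M" "x D \<noteq> 0" using D by (auto simp: T_def)
      obtain h :: "nat \<Rightarrow> 'c" where h: "compat h D" "nested r h D"
        using nested_colouring_exists[OF DB(1) no] .
      \<comment> \<open>For a nested colouring \<open>h\<close> of \<open>D\<close>, every other
        compatible diagram is heavier than \<open>D\<close> and so does not occur in
        \<open>x\<close>. Evaluation at \<open>h\<close> isolates the coefficient of
        \<open>D\<close>, which contradicts its being nonzero.\<close>
      have "ev r x h = (\<Sum>E\<in>brauer_diagrams r. if E = D then x D else 0)"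
        unfolding ev_def
      proof (intro sum.cong refl)
        fix E assume E: "E \<in> brauer_diagrams r"
        show "x E * of_bool (compat h E) = (if E = D then x D else 0)"
        proof (cases "E = D \<or> \<not> compat h E")
          case False
          then have "M < weight r E" using nested_weight_less[OF DB(1) h E] DB(2) by simp
          then have "x E = 0" using Suc.prems(3)[of E] by (cases "x E = 0") simp_all
          then show ?thesis using False by simp
        qed (use h in auto)
      qed
      then have "ev r x h = x D" using DB(1) by simp
      then show False using Suc.prems(2) DB(3) by metis
    qed
    then obtain J where J: "\<And>D. D \<in> T \<Longrightarrow> chain r D (J D)" "\<And>D. D \<in> T \<Longrightarrow> card (J D) = CARD('c) + 1"
      by metis
    let ?g = "\<lambda>D. asym (J D) (basis_diagram D) :: diagram \<Rightarrow> 'a"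
    have T: "D \<in> brauer_diagrams r" "J D \<subseteq> {1..2 * r}" if "D \<in> T" for D
      using that J(1)[OF that] by (auto simp: T_def chain_def)
    \<comment> \<open>Only the identity permutation contributes a diagram of weight at least
      \<open>M\<close>, and this is \<open>D\<close> itself.\<close>
    have lead: "?g D D' = of_bool (D' = D)" if D: "D \<in> T" and w: "M \<le> weight r D'" for D D'
    proof -
      have finJ: "finite (J D)" using T[OF D] finite_subset by blast
      have "?g D D' = (\<Sum>\<pi> | \<pi> permutes J D. if \<pi> = id then of_bool (D' = D) else 0)"
        unfolding asym_basis
      proof (intro sum.cong refl, simp only: mem_Collect_eq)
        fix \<pi> assume p: "\<pi> permutes J D"
        show "of_int (sign \<pi>) * basis_diagram (dact \<pi> D) D' = (if \<pi> = id then of_bool (D' = D) else 0 :: 'a)"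
        proof (cases "\<pi> = id")
          case False
          have "weight r (dact \<pi> D) < weight r D"
            by (rule weight_dact_chain[OF T(1)[OF D] J(1)[OF D] p False])
          then have "D' \<noteq> dact \<pi> D" using w D by (auto simp: T_def)
          then show ?thesis using False by (simp add: basis_diagram_def)
        qed (simp add: basis_diagram_def)
      qed
      also have "\<dots> = of_bool (D' = D)"
        using finite_permutations[OF finJ] by (subst sum.delta) auto
      finally show ?thesis .
    qed
    define y where "y = (\<lambda>D'. x D' - (\<Sum>D\<in>T. x D * ?g D D'))"
    have gP: "(\<lambda>D'. \<Sum>D\<in>T. x D * ?g D D') \<in> P"
      by (intro linear_subset_sum[OF P] linear_subset_scale[OF P] gadgets T J(2))
    have gcar: "?g D \<in> carrier (brauer_algebra r \<delta>)" if "D \<in> T" for D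
      by (intro asym_closed T[OF that] basis_closed)
    have "y \<in> P"
    proof (rule Suc.IH)
      have "y D' = 0" if "D' \<notin> brauer_diagrams r" for D'
        unfolding y_def using x0[OF that] gcar that by (simp add: sum.neutral)
      then show "y \<in> carrier (brauer_algebra r \<delta>)" by simp
      show "ev r y h = 0" for h :: "nat \<Rightarrow> 'c"
      proof -
        have "ev r (?g D) h = 0" if "D \<in> T" for D
          by (rule ev_asym_eq_0[OF T[OF that] _ two]) (simp add: J(2)[OF that])
        then show ?thesis unfolding y_def ev_diff ev_sum using Suc.prems(2) by (simp add: sum.neutral)
      qed
      show "weight r D' < M" if "y D' \<noteq> 0" for D'
      proof (rule ccontr)
        assume "\<not> weight r D' < M"
        then have w: "M \<le> weight r D'" by simp
        have "(\<Sum>D\<in>T. x D * ?g D D') = (\<Sum>D\<in>T. if D' = D then x D' else 0)"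
          by (intro sum.cong refl) (simp add: lead[OF _ w])
        also have "\<dots> = (if D' \<in> T then x D' else 0)" using finT by simp
        also have "\<dots> = x D'"
          using w Suc.prems(3)[of D'] x0[of D'] by (cases "x D' = 0") (auto simp: T_def)
        finally have "y D' = 0" by (simp add: y_def)
        then show False using that by simp
      qed
    qed
    then have "(\<lambda>D'. y D' + (\<Sum>D\<in>T. x D * ?g D D')) \<in> P" by (rule linear_subset_add[OF P _ gP])
    then show ?case by (simp add: y_def)
  qed
  note ind = this
  have "x D = 0" if "D \<notin> brauer_diagrams r" for D using x(1) that by simp
  then have "weight r D < Suc (Max (weight r ` brauer_diagrams r))" if "x D \<noteq> 0" for D
    using that by (metis Max_ge finite_brauer_diagrams finite_imageI imageI le_imp_less_Suc)
  then show ?thesis using ind[OF x] by blast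
qed

section \<open>Averaging over subsets\<close>

text \<open>Double counting of pairs: \<open>(C, z)\<close> with \<open>z \<in> C\<close>
  corresponds to \<open>(B, z)\<close> with \<open>B = C - {z}\<close> and
  \<open>z \<in> W - B\<close>.\<close>

lemma sum_subsets_remove:
  fixes \<phi> :: "'b set \<Rightarrow> 'a::comm_semiring_1"
  assumes W: "finite W"
  shows "(\<Sum>C | C \<subseteq> W \<and> card C = Suc q. \<Sum>z\<in>C. \<phi> (C - {z})) =
    of_nat (card W - q) * (\<Sum>B | B \<subseteq> W \<and> card B = q. \<phi> B)"
proof -
  have fin: "finite {C. C \<subseteq> W \<and> card C = k}" for k
    by (rule finite_subset[of _ "Pow W"]) (use W in auto)
  have finC: "finite C" if "C \<subseteq> W" for C using that W finite_subset by blast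
  have "(\<Sum>C | C \<subseteq> W \<and> card C = Suc q. \<Sum>z\<in>C. \<phi> (C - {z})) =
    (\<Sum>p\<in>(SIGMA C:{C. C \<subseteq> W \<and> card C = Suc q}. C). \<phi> (fst p - {snd p}))"
    by (subst sum.Sigma) (use fin finC in \<open>auto simp: case_prod_unfold\<close>)
  also have "\<dots> = (\<Sum>p\<in>(SIGMA B:{B. B \<subseteq> W \<and> card B = q}. W - B). \<phi> (fst p))"
  proof (rule sum.reindex_bij_betw[symmetric, THEN trans])
    show "bij_betw (\<lambda>p. (insert (snd p) (fst p), snd p))
      (SIGMA B:{B. B \<subseteq> W \<and> card B = q}. W - B) (SIGMA C:{C. C \<subseteq> W \<and> card C = Suc q}. C)"
      by (rule bij_betw_byWitness[where f' = "\<lambda>p. (fst p - {snd p}, snd p)"])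
        (use finC in \<open>auto simp: card_insert_if insert_absorb\<close>)
  qed (auto intro!: sum.cong)
  also have "\<dots> = (\<Sum>B | B \<subseteq> W \<and> card B = q. \<Sum>z\<in>W - B. \<phi> B)"
    by (subst sum.Sigma) (use fin W in \<open>auto simp: case_prod_unfold\<close>)
  also have "\<dots> = (\<Sum>B | B \<subseteq> W \<and> card B = q. of_nat (card W - q) * \<phi> B)"
    by (intro sum.cong refl) (use finC in \<open>auto simp: card_Diff_subset\<close>)
  finally show ?thesis by (simp only: sum_distrib_left)
qed

text \<open>Over the rationals this is the fact that the inclusion matrix between
  \<open>k\<close>-subsets and \<open>(k + 1)\<close>-subsets of a set of at least
  \<open>2k + 1\<close> elements has full rank. The argument divides only by
  \<open>1, ..., k + 1\<close>. It averages over an auxiliary set \<open>W\<close> of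
  \<open>k + 1\<close> elements disjoint from \<open>S\<close>, whence the bound on
  \<open>card X\<close>.\<close>

lemma subset_averaging:
  fixes u :: "nat set \<Rightarrow> diagram \<Rightarrow> 'a::field"
  assumes P: "linear_subset P" and X: "finite X" "2 * k + 1 \<le> card X"
    and rel: "\<And>T. T \<subseteq> X \<Longrightarrow> card T = Suc k \<Longrightarrow> (\<lambda>D. \<Sum>z\<in>T. u (T - {z}) D) \<in> P"
    and S: "S \<subseteq> X" "card S = k"
    and nz: "\<And>a. a \<le> k \<Longrightarrow> of_nat (Suc a) \<noteq> (0 :: 'a)"
  shows "u S \<in> P"
proof -
  have finS: "finite S" using S X finite_subset by blast
  have "Suc k \<le> card (X - S)" using X S finS by (simp add: card_Diff_subset)
  then obtain W where W: "W \<subseteq> X - S" "card W = Suc k" by (rule obtain_subset_with_card_n)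
  have finW: "finite W" by (rule finite_subset[OF _ X(1)]) (use W(1) in blast)
  \<comment> \<open>\<open>s A \<in> P\<close> by induction on \<open>card A\<close>: sum the relations over all \<open>T\<close> between \<open>A\<close> and \<open>A \<union> W\<close>\<close>
  define s where "s A = (\<lambda>D. \<Sum>C | C \<subseteq> W \<and> card C = k - card A. u (A \<union> C) D)" for A
  have "s A \<in> P" if "A \<subseteq> S" "card A = a" for A a
    using that
  proof (induction a arbitrary: A)
    case (0 A)
    have "A = {}" using 0 finS finite_subset by fastforce
    have "(\<lambda>D. of_nat (Suc 0) * s A D) \<in> P"
    proof -
      have eq: "{C. C \<subseteq> W \<and> card C = Suc k} = {W}" using W(2) finW by (auto dest: card_subset_eq)
      have "of_nat (Suc 0) * s A D = (\<Sum>z\<in>W. u (W - {z}) D)" for D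
        using sum_subsets_remove[OF finW, of "\<lambda>C. u C D" k] W(2)
        unfolding eq s_def \<open>A = {}\<close> by simp
      moreover have "(\<lambda>D. \<Sum>z\<in>W. u (W - {z}) D) \<in> P" by (rule rel) (use W in auto)
      ultimately show ?thesis by (simp only:)
    qed
    then show ?case by simp
  next
    case (Suc a A)
    have finA: "finite A" using Suc.prems finS finite_subset by blast
    have ak: "Suc a \<le> k" using card_mono[OF finS Suc.prems(1)] Suc.prems(2) S(2) by simp
    have AW: "A \<inter> W = {}" using Suc.prems(1) W(1) by blast
    let ?Cs = "{C. C \<subseteq> W \<and> card C = Suc (k - Suc a)}"
    define R where "R = (\<lambda>D. \<Sum>C\<in>?Cs. \<Sum>z\<in>A \<union> C. u (A \<union> C - {z}) D)"
    have "R \<in> P"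
      unfolding R_def
    proof (rule linear_subset_sum[OF P], rule rel)
      fix C assume C: "C \<in> ?Cs"
      have "finite C" using C finW finite_subset by blast
      show "A \<union> C \<subseteq> X" using C Suc.prems S(1) W(1) by blast
      have "A \<inter> C = {}" using C AW by blast
      then show "card (A \<union> C) = Suc k"
        using C \<open>finite C\<close> finA Suc.prems(2) ak by (simp add: card_Un_disjoint)
    qed
    \<comment> \<open>Deleting \<open>z \<in> A\<close> from \<open>A \<union> C\<close> leaves the
      sums for the smaller set \<open>A - {z}\<close>. Deleting \<open>z \<in> C\<close> produces
      each \<open>A \<union> B\<close> once for every element of \<open>W - B\<close>, and
      \<open>card (W - B) = card A + 1\<close>.\<close>
    have R: "R D = (\<Sum>z\<in>A. s (A - {z}) D) + of_nat (Suc (Suc a)) * s A D" for D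
    proof -
      have "R D = (\<Sum>C\<in>?Cs. (\<Sum>z\<in>A. u ((A - {z}) \<union> C) D) + (\<Sum>z\<in>C. u (A \<union> (C - {z})) D))"
        unfolding R_def
      proof (intro sum.cong refl)
        fix C assume C: "C \<in> ?Cs"
        then have "finite C" "A \<inter> C = {}" using finW finite_subset AW by blast+
        then have "(\<Sum>z\<in>A \<union> C. u (A \<union> C - {z}) D) = (\<Sum>z\<in>A. u (A \<union> C - {z}) D) + (\<Sum>z\<in>C. u (A \<union> C - {z}) D)"
          by (intro sum.union_disjoint finA)
        also have "(\<Sum>z\<in>A. u (A \<union> C - {z}) D) = (\<Sum>z\<in>A. u ((A - {z}) \<union> C) D)"
          using \<open>A \<inter> C = {}\<close> by (intro sum.cong refl arg_cong2[where f = u]) auto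
        also have "(\<Sum>z\<in>C. u (A \<union> C - {z}) D) = (\<Sum>z\<in>C. u (A \<union> (C - {z})) D)"
          using \<open>A \<inter> C = {}\<close> by (intro sum.cong refl arg_cong2[where f = u]) auto
        finally show "(\<Sum>z\<in>A \<union> C. u (A \<union> C - {z}) D) =
          (\<Sum>z\<in>A. u ((A - {z}) \<union> C) D) + (\<Sum>z\<in>C. u (A \<union> (C - {z})) D)" .
      qed
      also have "\<dots> = (\<Sum>C\<in>?Cs. \<Sum>z\<in>A. u ((A - {z}) \<union> C) D) + (\<Sum>C\<in>?Cs. \<Sum>z\<in>C. u (A \<union> (C - {z})) D)"
        by (rule sum.distrib)
      also have "(\<Sum>C\<in>?Cs. \<Sum>z\<in>A. u ((A - {z}) \<union> C) D) = (\<Sum>z\<in>A. s (A - {z}) D)"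
        unfolding s_def by (subst sum.swap) (use ak Suc.prems(2) finA in \<open>auto intro!: sum.cong simp: Suc_diff_Suc\<close>)
      also have "(\<Sum>C\<in>?Cs. \<Sum>z\<in>C. u (A \<union> (C - {z})) D) = of_nat (Suc (Suc a)) * s A D"
        using sum_subsets_remove[OF finW, of "\<lambda>B. u (A \<union> B) D" "k - Suc a"] ak Suc.prems(2) W(2)
        by (simp add: s_def Suc_diff_le)
      finally show ?thesis .
    qed
    have "s (A - {z}) \<in> P" if "z \<in> A" for z
      by (rule Suc.IH) (use Suc.prems finA that in auto)
    then have "(\<lambda>D. \<Sum>z\<in>A. s (A - {z}) D) \<in> P" by (rule linear_subset_sum[OF P])
    from linear_subset_diff[OF P \<open>R \<in> P\<close> this]
    have "(\<lambda>D. of_nat (Suc (Suc a)) * s A D) \<in> P" by (simp add: R)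
    from linear_subset_scale[OF P this, of "inverse (of_nat (Suc (Suc a)))"]
    show ?case using nz[OF ak] by (simp add: mult.assoc[symmetric] del: of_nat_Suc)
  qed
  from this[OF subset_refl S(2)] have "s S \<in> P" .
  moreover have "{C. C \<subseteq> W \<and> card C = 0} = {{}}" using finW finite_subset by fastforce
  ultimately show ?thesis by (simp add: s_def S(2))
qed

lemma permutes_extend:
  assumes fin: "finite S" and f: "inj_on f A" "A \<subseteq> S" "f ` A \<subseteq> S"
  obtains \<pi> where "\<pi> permutes S" "\<And>a. a \<in> A \<Longrightarrow> \<pi> a = f a"
proof -
  have finA: "finite A" using f(2) fin finite_subset by blast
  have "card (S - A) = card (S - f ` A)"
    using f finA by (simp add: card_Diff_subset card_image)
  then obtain g where g: "bij_betw g (S - A) (S - f ` A)"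
    using finite_same_card_bij[of "S - A" "S - f ` A"] fin by auto
  define \<pi> where "\<pi> x = (if x \<in> A then f x else if x \<in> S then g x else x)" for x
  have "bij_betw \<pi> A (f ` A)" using f(1) by (auto simp: \<pi>_def bij_betw_def inj_on_def)
  moreover have "bij_betw \<pi> (S - A) (S - f ` A)"
    using g by (rule bij_betw_cong[THEN iffD1, rotated]) (auto simp: \<pi>_def)
  ultimately have "bij_betw \<pi> (A \<union> (S - A)) (f ` A \<union> (S - f ` A))" by (rule bij_betw_combine) auto
  moreover have "A \<union> (S - A) = S" "f ` A \<union> (S - f ` A) = S" using f by auto
  ultimately have "bij_betw \<pi> S S" by simp
  then have "\<pi> permutes S" by (rule bij_imp_permutes) (use f(2) in \<open>auto simp: \<pi>_def\<close>)
  then show ?thesis using that by (simp add: \<pi>_def)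
qed

lemma permutes_onto:
  assumes "finite S" "A \<subseteq> S" "B \<subseteq> S" "card A = card B"
  obtains \<pi> where "\<pi> permutes S" "\<pi> ` A = B"
proof -
  obtain f where f: "bij_betw f A B"
    using finite_same_card_bij[of A B] assms finite_subset by blast
  then have fAB: "inj_on f A" "f ` A = B" by (auto simp: bij_betw_def)
  obtain \<pi> where \<pi>: "\<pi> permutes S" "\<And>a. a \<in> A \<Longrightarrow> \<pi> a = f a"
    by (rule permutes_extend[OF assms(1) fAB(1) assms(2)]) (use fAB assms(3) in auto)
  then have "\<pi> ` A = B" using fAB(2) by (metis image_cong)
  then show ?thesis using that \<pi>(1) by blast
qed

section \<open>Antisymmetrisers in ideals\<close>

text \<open>The transposition of the two ends of an edge fixes the diagram but has sign -1.\<close>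

lemma asym_edge_eq_0:
  assumes D: "D \<in> brauer_diagrams r" and J: "J \<subseteq> {1..2 * r}" and v: "v \<in> J" "partner D v \<in> J"
    and two: "(2 :: 'a::field) \<noteq> 0"
  shows "asym J (basis_diagram D) = (\<lambda>_. 0 :: 'a)"
proof -
  have vV: "v \<in> {1..2 * r}" using J v by blast
  let ?t = "vswap v (partner D v)"
  have "?t permutes {1..2 * r}" by (intro permutes_swap_id vV partner_props(3)[OF D vV])
  then have "dact ?t D = D"
  proof (rule dact_fixI[OF D])
    fix w assume "w \<in> {1..2 * r}"
    show "?t (partner D w) = partner D (?t w)"
      using partner_partner[OF D] by (metis transpose_apply_first transpose_apply_second transpose_apply_other)
  qed
  then have "vact ?t (basis_diagram D) = (basis_diagram D :: diagram \<Rightarrow> 'a)" by (simp add: vact_basis)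
  moreover have "finite J" using J finite_subset by blast
  ultimately show ?thesis
    using asym_eq_0[OF _ two v] partner_props(2)[OF D vV] by metis
qed

text \<open>The size \<open>m\<close> of the antisymmetrised sets becomes \<open>n + 1\<close>, and
  \<open>P\<close> the ideal generated by \<open>E\<close>. The parameter can stay arbitrary because
  the products with permutations and contractions formed below are loop-free.\<close>

locale gadget_ideal =
  fixes r m :: nat and \<delta> :: "'a::field" and P :: "(diagram \<Rightarrow> 'a) set"
  assumes ideal: "ideal P (brauer_algebra r \<delta>)"
    and two: "(2 :: 'a) \<noteq> 0"
    and nz: "\<And>k. 1 \<le> k \<Longrightarrow> k \<le> m \<Longrightarrow> of_nat k \<noteq> (0 :: 'a)"
    and mr: "m \<le> r"
begin

abbreviation good :: "nat set \<Rightarrow> diagram \<Rightarrow> bool" where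
  "good J D \<equiv> asym J (basis_diagram D) \<in> P"

lemma lin: "linear_subset P"
  by (rule ideal_linear_subset[OF ideal])

lemma P_carrier: "x \<in> P \<Longrightarrow> x \<in> carrier (brauer_algebra r \<delta>)"
  using ideal.axioms(1)[OF ideal] additive_subgroup.a_subset by blast

lemma mult_left: "x \<in> P \<Longrightarrow> y \<in> carrier (brauer_algebra r \<delta>) \<Longrightarrow> y \<otimes>\<^bsub>brauer_algebra r \<delta>\<^esub> x \<in> P"
  using ideal.I_l_closed[OF ideal] by blast

lemma mult_right: "x \<in> P \<Longrightarrow> y \<in> carrier (brauer_algebra r \<delta>) \<Longrightarrow> x \<otimes>\<^bsub>brauer_algebra r \<delta>\<^esub> y \<in> P"
  using ideal.I_r_closed[OF ideal] by blast

lemma vact_top: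
  assumes "x \<in> P" "\<sigma> permutes {1..r}"
  shows "vact \<sigma> x \<in> P"
  using mult_left[OF assms(1) basis_closed[OF perm_diagram_closed[OF assms(2)]]]
  unfolding perm_mult_left[OF assms(2) P_carrier[OF assms(1)]] .

lemma vact_bottom:
  assumes "x \<in> P" "\<sigma> permutes {1..r}"
  shows "vact (bottom r \<sigma>) x \<in> P"
  using mult_right[OF assms(1) basis_closed[OF perm_diagram_closed[OF permutes_inv[OF assms(2)]]]]
  unfolding perm_mult_right[OF permutes_inv[OF assms(2)] P_carrier[OF assms(1)]]
    permutes_inv_inv[OF assms(2)] .

lemma good_vact:
  assumes g: "g permutes {1..2 * r}" and J: "finite J"
    and v: "vact g (asym J (basis_diagram D)) \<in> P"
  shows "good (g ` J) (dact g D)"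
proof -
  have "permutation g" using g permutation_permutes by blast
  then show ?thesis using v by (simp add: vact_asym_conj[OF _ J] vact_basis permutes_bij[OF g])
qed

lemma good_dact:
  assumes J: "finite J" and p: "\<pi> permutes J" and g: "good J (dact \<pi> D)"
  shows "good J D"
proof -
  have "asym J (basis_diagram (dact \<pi> D)) = (\<lambda>D'. of_int (sign \<pi>) * asym J (basis_diagram D) D' :: 'a)"
    using asym_vact[OF p J, of "basis_diagram D"] by (simp add: vact_basis permutes_bij[OF p])
  then have "(\<lambda>D'. of_int (sign \<pi>) * (of_int (sign \<pi>) * asym J (basis_diagram D) D') :: 'a) \<in> P"
    using linear_subset_scale[OF lin g, of "of_int (sign \<pi>)"] by simp
  moreover have "of_int (sign \<pi>) * (of_int (sign \<pi>) * a) = (a :: 'a)" for a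
    by (simp only: mult.assoc[symmetric] of_int_mult[symmetric] sign_idempotent of_int_1 mult_1)
  ultimately show ?thesis by simp
qed

lemma good_zero:
  assumes "D \<in> brauer_diagrams r" "J \<subseteq> {1..2 * r}" "v \<in> J" "partner D v \<in> J"
  shows "good J D"
  using lin by (simp add: asym_edge_eq_0[OF assms two] linear_subset_def)

text \<open>A permutation of \<open>J\<close> fixes \<open>u\<close>, \<open>w\<close> and
  \<open>y\<close>, so it commutes with the exchange of \<open>y\<close> and \<open>u\<close> and
  keeps the edge \<open>{u, w}\<close>. One product with a contraction therefore restores this edge
  in all summands at once.\<close>

lemma good_contract:
  assumes D: "D \<in> brauer_diagrams r" and J: "J \<subseteq> {1..2 * r}"
    and uw: "{u, w} \<in> D" "u \<noteq> w" "u \<le> r \<longleftrightarrow> w \<le> r"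
    and y: "y \<in> {1..2 * r}" "y \<noteq> u" "y \<noteq> w" and nJ: "u \<notin> J" "w \<notin> J" "y \<notin> J"
    and g: "good J (dact (vswap y u) D)"
  shows "good J D"
proof -
  let ?R = "brauer_algebra r \<delta>" and ?D = "dact (vswap y u) D"
  have uV: "u \<in> {1..2 * r}" "w \<in> {1..2 * r}" using brauer_diagrams_sub[OF D uw(1)] by auto
  have comm: "dact \<pi> ?D = dact (vswap y u) (dact \<pi> D)" and edge: "{u, w} \<in> dact \<pi> D"
    and cl: "dact \<pi> D \<in> brauer_diagrams r" "dact \<pi> ?D \<in> brauer_diagrams r" if p: "\<pi> permutes J" for \<pi>
  proof -
    have fx: "\<pi> u = u" "\<pi> w = w" "\<pi> y = y" using permutes_not_in[OF p] nJ by auto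
    have "\<pi> v \<noteq> u" "\<pi> v \<noteq> y" if "v \<noteq> u" "v \<noteq> y" for v
      using fx permutes_inj[OF p] that by (metis inj_eq)+
    then have "\<pi> \<circ> vswap y u = vswap y u \<circ> \<pi>"
      using fx by (auto simp: fun_eq_iff Transposition.transpose_def)
    then show "dact \<pi> ?D = dact (vswap y u) (dact \<pi> D)" by (simp only: dact_comp[symmetric])
    have "\<pi> ` {u, w} \<in> dact \<pi> D" unfolding dact_def by (rule imageI[OF uw(1)])
    then show "{u, w} \<in> dact \<pi> D" using fx by simp
    show "dact \<pi> D \<in> brauer_diagrams r" "dact \<pi> ?D \<in> brauer_diagrams r"
      by (intro dact_closed[OF _ permutes_subset[OF p J]] D transpose_closed uV y)+
  qed
  show ?thesis
  proof (cases "u \<le> r")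
    case True
    then have cd: "u \<in> {1..r}" "w \<in> {1..r}" using uw uV by auto
    have e: "e_diagram r u w \<in> brauer_diagrams r" by (rule e_diagram_closed[OF cd uw(2)])
    have "basis_diagram (e_diagram r u w) \<otimes>\<^bsub>?R\<^esub> asym J (basis_diagram ?D) = asym J (basis_diagram D)"
      unfolding asym_basis brauer_mult_sum_right
    proof (intro ext sum.cong refl, simp only: mem_Collect_eq)
      fix \<pi> D' assume p: "\<pi> permutes J"
      show "of_int (sign \<pi>) * (basis_diagram (e_diagram r u w) \<otimes>\<^bsub>?R\<^esub> basis_diagram (dact \<pi> ?D)) D' =
        of_int (sign \<pi>) * basis_diagram (dact \<pi> D) D'"
        unfolding basis_mult_basis[OF e cl(2)[OF p]] unfolding comm[OF p]
        by (simp add: e_diagram_comp_left[OF cl(1)[OF p] cd uw(2) edge[OF p] y])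
    qed
    then show ?thesis using mult_left[OF g basis_closed[OF e]] by simp
  next
    case False
    define c d where "c = u - r" and "d = w - r"
    then have cd: "c \<in> {1..r}" "d \<in> {1..r}" "c \<noteq> d" and u: "u = r + c" "w = r + d" using uw uV False by auto
    have e: "e_diagram r c d \<in> brauer_diagrams r" by (rule e_diagram_closed[OF cd])
    have "asym J (basis_diagram ?D) \<otimes>\<^bsub>?R\<^esub> basis_diagram (e_diagram r c d) = asym J (basis_diagram D)"
      unfolding asym_basis brauer_mult_sum_left
    proof (intro ext sum.cong refl, simp only: mem_Collect_eq)
      fix \<pi> D' assume p: "\<pi> permutes J"
      show "of_int (sign \<pi>) * (basis_diagram (dact \<pi> ?D) \<otimes>\<^bsub>?R\<^esub> basis_diagram (e_diagram r c d)) D' =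
        of_int (sign \<pi>) * basis_diagram (dact \<pi> D) D'"
        unfolding basis_mult_basis[OF cl(2)[OF p] e] unfolding comm[OF p]
        using e_diagram_comp_right[OF cl(1)[OF p] cd edge[OF p, unfolded u] y[unfolded u]] by (simp add: u)
    qed
    then show ?thesis using mult_right[OF g basis_closed[OF e]] by simp
  qed
qed

text \<open>The name refers to the edges away from \<open>J\<close>. Edges that meet
  \<open>J\<close> may still be horizontal, as the antisymmetriser is free to exchange their end
  points in \<open>J\<close>.\<close>

definition vertical_type :: "nat \<Rightarrow> nat set \<Rightarrow> diagram \<Rightarrow> bool" where
  "vertical_type k J D \<longleftrightarrow> D \<in> brauer_diagrams r \<and> J \<subseteq> {1..2 * r} \<and> card J = m \<and>
     partner D ` J \<inter> J = {} \<and> card (J \<inter> {1..r}) = k \<and>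
     (\<forall>v\<in>{1..2 * r}. v \<notin> J \<longrightarrow> partner D v \<notin> J \<longrightarrow> (v \<le> r \<longleftrightarrow> r < partner D v))"

text \<open>Induction on the number of end points of horizontal edges away from \<open>J\<close>.
  Such an edge \<open>{u, w}\<close> is broken with \<open>good_contract\<close> by exchanging
  \<open>u\<close> with a vertex \<open>y\<close> of the opposite row, chosen so that no new
  horizontal edge away from \<open>J\<close> arises.\<close>

lemma reduce_to_vertical:
  assumes vert: "\<And>k J D. vertical_type k J D \<Longrightarrow> good J D"
  shows "D \<in> brauer_diagrams r \<Longrightarrow> J \<subseteq> {1..2 * r} \<Longrightarrow> card J = m \<Longrightarrow> good J D"
proof (induction "card {v \<in> {1..2 * r}. v \<notin> J \<and> partner D v \<notin> J \<and> (v \<le> r \<longleftrightarrow> partner D v \<le> r)}"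
    arbitrary: D rule: less_induct)
  case less
  let ?q = "partner D" and ?V = "{1..2 * r}"
  let ?H = "\<lambda>D. {v \<in> ?V. v \<notin> J \<and> partner D v \<notin> J \<and> (v \<le> r \<longleftrightarrow> partner D v \<le> r)}"
  have D: "D \<in> brauer_diagrams r" and J: "J \<subseteq> ?V" by fact+
  have finJ: "finite J" using J finite_subset by blast
  have qq: "?q (?q v) = v" for v by (rule partner_partner[OF D])
  have qV: "?q v \<in> ?V" if "v \<in> ?V" for v using that partner_props(3)[OF D] by blast
  show ?case
  proof (cases "?q ` J \<inter> J = {} \<and> ?H D \<noteq> {}")
    case False
    show ?thesis
    proof (cases "?q ` J \<inter> J = {}")
      case True
      then have "?H D = {}" using False by blast
      then have "vertical_type (card (J \<inter> {1..r})) J D"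
        unfolding vertical_type_def
      proof (intro conjI ballI impI)
        fix v assume v: "v \<in> ?V" "v \<notin> J" "?q v \<notin> J"
        have "v \<notin> ?H D" using \<open>?H D = {}\<close> by (simp only: empty_iff not_False_eq_True)
        then have "\<not> (v \<le> r \<longleftrightarrow> ?q v \<le> r)" using v by blast
        then show "v \<le> r \<longleftrightarrow> r < ?q v" by linarith
      qed (use less.prems True in auto)
      then show ?thesis by (rule vert)
    next
      case False
      then obtain v where "v \<in> J" "?q v \<in> J" by blast
      then show ?thesis by (rule good_zero[OF D J])
    qed
  next
    case True
    then have disj: "?q ` J \<inter> J = {}" by blast
    obtain u where u: "u \<in> ?V" "u \<notin> J" "?q u \<notin> J" "u \<le> r \<longleftrightarrow> ?q u \<le> r" using True by blast
    define w where "w = ?q u"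
    define S where "S = {v \<in> ?V. v \<le> r \<longleftrightarrow> u \<le> r}"
    define S' where "S' = {v \<in> ?V. v \<le> r \<longleftrightarrow> \<not> u \<le> r}"
    have card: "card S = r" "card S' = r"
    proof -
      have "S = (if u \<le> r then {1..r} else {r + 1..2 * r})" "S' = (if u \<le> r then {r + 1..2 * r} else {1..r})"
        unfolding S_def S'_def by auto
      then show "card S = r" "card S' = r" by simp_all
    qed
    have fin: "finite S" "finite S'" by (auto simp: S_def S'_def)
    have SS: "S \<inter> S' = {}" "S \<union> S' = ?V" by (auto simp: S_def S'_def)
    have w: "w \<in> S" "u \<in> S" "w \<noteq> u" "w \<in> ?V" "w \<notin> J" "?q w = u"
      using u qV[OF u(1)] partner_props(2)[OF D u(1)] by (auto simp: S_def w_def qq)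
    \<comment> \<open>If there were no such \<open>y\<close>, then \<open>?q\<close> would map the
      opposite row together with \<open>J\<close> injectively into the row of \<open>u\<close>
      without \<open>u\<close>, which has only \<open>r - 1\<close> elements.\<close>
    have "\<exists>y\<in>S' - J. ?q y \<in> J \<or> ?q y \<in> S'"
    proof (rule ccontr)
      assume no: "\<not> (\<exists>y\<in>S' - J. ?q y \<in> J \<or> ?q y \<in> S')"
      have "?q ` (S' \<union> J) \<subseteq> S - {u}"
      proof
        fix z assume "z \<in> ?q ` (S' \<union> J)"
        then obtain v where v: "z = ?q v" "v \<in> S' \<union> J" by blast
        have vV: "v \<in> ?V" using v(2) J by (auto simp: S'_def)
        have "z \<noteq> u"
        proof
          assume "z = u"
          then have "v = w" using v(1) qq w_def by metis
          then show False using v(2) w SS by blast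
        qed
        moreover have "z \<in> S"
        proof (rule ccontr)
          assume "z \<notin> S"
          then have zS: "z \<in> S'" using qV[OF vV] SS v(1) by blast
          show False
          proof (cases "v \<in> J")
            case True
            then have "z \<notin> J" using disj v(1) by blast
            moreover have "?q z \<in> J" using True v(1) qq by simp
            ultimately show ?thesis using no zS by blast
          next
            case False
            then show ?thesis using no zS v by blast
          qed
        qed
        ultimately show "z \<in> S - {u}" by blast
      qed
      then have "card (?q ` (S' \<union> J)) \<le> card (S - {u})" using fin by (intro card_mono) auto
      moreover have "card (?q ` (S' \<union> J)) = card (S' \<union> J)"
        by (intro card_image inj_on_subset[OF permutes_inj[OF partner_permutes[OF D]]]) auto
      moreover have "card S' \<le> card (S' \<union> J)" using fin finJ by (intro card_mono) auto
      moreover have "card (S - {u}) < card S" using fin w by (intro card_Diff1_less) auto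
      ultimately show False using card by linarith
    qed
    then obtain y where y: "y \<in> S'" "y \<notin> J" "?q y \<in> J \<or> ?q y \<in> S'" by blast
    have yV: "y \<in> ?V" using y(1) by (auto simp: S'_def)
    have yu: "y \<noteq> u" "y \<noteq> w" using y(1) w SS by blast+
    let ?t = "vswap y u"
    let ?D = "dact ?t D"
    have t: "?t permutes ?V" by (intro permutes_swap_id yV u(1))
    have D': "?D \<in> brauer_diagrams r" by (rule dact_closed[OF D t])
    have q': "partner ?D (?t v) = ?t (?q v)" if "v \<in> ?V" for v by (rule partner_dact[OF D t that])
    have qy: "?q y \<noteq> u" "?q y \<noteq> w" "?q y \<noteq> y" using qq w yu partner_props(2)[OF D yV] by metis+
    have qu: "partner ?D u = ?q y" using q'[OF yV] qy by simp
    have qy': "partner ?D y = w" using q'[OF u(1)] yu w by (simp add: w_def)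
    have qw: "partner ?D w = y" using q'[OF w(4)] yu w by simp
    have qqy: "partner ?D (?q y) = u" using q'[OF qV[OF yV]] qy by (simp add: qq)
    have rest: "partner ?D v = ?q v" if v: "v \<in> ?V" "v \<notin> {u, w, y, ?q y}" for v
    proof -
      have "?q v \<noteq> u" "?q v \<noteq> y" using v(2) qq w_def by auto
      then show ?thesis using q'[OF v(1)] v(2) by simp
    qed
    \<comment> \<open>The new edges are \<open>{y, w}\<close>, which joins the rows, and
      \<open>{u, ?q y}\<close>, which meets \<open>J\<close> or joins the rows; the horizontal edge
      at \<open>w\<close> is gone.\<close>
    have "?H ?D \<subset> ?H D"
    proof
      show "?H ?D \<subseteq> ?H D"
      proof
        fix v assume v: "v \<in> ?H ?D"
        then have vV: "v \<in> ?V" by blast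
        consider "v = u" | "v = w" | "v = y" | "v = ?q y" | "v \<notin> {u, w, y, ?q y}" by blast
        then show "v \<in> ?H D"
        proof cases
          case 4
          then show ?thesis using v qqy y w by (auto simp: S_def S'_def)
        next
          case 5
          then show ?thesis using v rest[OF vV] by auto
        qed (use v qu qw qy' y w in \<open>auto simp: S_def S'_def\<close>)
      qed
      have "w \<in> ?H D" using w u by (auto simp: w_def qq)
      moreover have "w \<notin> ?H ?D" using qw w y(1) by (auto simp: S_def S'_def)
      ultimately show "?H ?D \<noteq> ?H D" by blast
    qed
    then have "card (?H ?D) < card (?H D)" by (intro psubset_card_mono) auto
    then have "good J ?D" by (rule less.hyps) (use D' J less.prems in auto)
    moreover have "{u, w} \<in> D" unfolding w_def by (rule partner_props(1)[OF D u(1)])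
    ultimately show ?thesis
      by (intro good_contract[OF D J _ _ _ yV yu]) (use u w y in \<open>auto simp: w_def\<close>)
  qed
qed

end

section \<open>Reduction to antisymmetrisations of the identity diagram\<close>

lemma partner_id_diagram:
  assumes "v \<in> {1..2 * r}"
  shows "partner (perm_diagram r id) v = (if v \<le> r then r + v else v - r)"
proof (rule partner_eqI[OF id_diagram_closed])
  show "{v, if v \<le> r then r + v else v - r} \<in> perm_diagram r id"
  proof (cases "v \<le> r")
    case True
    then show ?thesis using assms by (auto simp: perm_diagram_def)
  next
    case False
    then have "{v, v - r} = {id (v - r), r + (v - r)}" "v - r \<in> {1..r}" using assms by auto
    then show ?thesis using False unfolding perm_diagram_def by auto
  qed
qed

lemma diagram_subset_eq:
  assumes D: "D \<in> brauer_diagrams r" "D' \<in> brauer_diagrams r" and "D \<subseteq> D'"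
  shows "D = D'"
proof (rule diagram_eqI_partner[OF D])
  fix v assume "v \<in> {1..2 * r}"
  then have "{v, partner D v} \<in> D'" using partner_props(1)[OF D(1)] assms(3) by blast
  then show "partner D v = partner D' v" using partner_eqI[OF D(2)] by metis
qed

lemma all_vertical_diagram:
  assumes D: "D \<in> brauer_diagrams r" and vert: "\<And>v. v \<in> {1..2 * r} \<Longrightarrow> v \<le> r \<longleftrightarrow> r < partner D v"
  obtains \<sigma> where "\<sigma> permutes {1..r}" "D = perm_diagram r \<sigma>" "\<And>i. i \<in> {1..r} \<Longrightarrow> \<sigma> i = partner D (r + i)"
proof -
  define \<sigma> where "\<sigma> i = (if i \<in> {1..r} then partner D (r + i) else i)" for i
  have in_: "partner D (r + i) \<in> {1..r}" if "i \<in> {1..r}" for i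
    using vert[of "r + i"] partner_props(3)[OF D, of "r + i"] that by auto
  have \<sigma>: "\<sigma> permutes {1..r}"
  proof (rule inj_imp_permutes)
    show "inj_on \<sigma> {1..r}"
    proof (rule inj_onI)
      fix i j assume ij: "i \<in> {1..r}" "j \<in> {1..r}" "\<sigma> i = \<sigma> j"
      then have "partner D (r + i) = partner D (r + j)" by (simp add: \<sigma>_def)
      then have "r + i = r + j" using partner_partner[OF D] by metis
      then show "i = j" by simp
    qed
  qed (use in_ in \<open>auto simp: \<sigma>_def\<close>)
  have "perm_diagram r \<sigma> \<subseteq> D"
  proof
    fix e assume "e \<in> perm_diagram r \<sigma>"
    then obtain i where i: "i \<in> {1..r}" "e = {\<sigma> i, r + i}" by (auto simp: perm_diagram_def)
    have "{r + i, partner D (r + i)} \<in> D" by (rule partner_props(1)[OF D]) (use i in auto)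
    then show "e \<in> D" using i by (simp add: \<sigma>_def insert_commute)
  qed
  then have "D = perm_diagram r \<sigma>" using diagram_subset_eq[OF perm_diagram_closed[OF \<sigma>] D] by blast
  then show ?thesis using that \<sigma> by (simp add: \<sigma>_def)
qed

lemma exists_permutes_pair:
  assumes "T \<subseteq> {1..r}" "U \<subseteq> {1..r}" "T \<inter> U = {}" "card T = k" "card U = m - k" "k \<le> m" "m \<le> r"
  obtains \<rho> where "\<rho> permutes {1..r :: nat}" "\<rho> ` {1..k} = T" "\<rho> ` {k + 1..m} = U"
proof -
  have fin: "finite T" "finite U" using assms finite_subset by blast+
  obtain f where f: "bij_betw f {1..k} T"
    using finite_same_card_bij[of "{1..k}" T] fin assms(4) by auto
  obtain f' where f': "bij_betw f' {k + 1..m} U"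
    using finite_same_card_bij[of "{k + 1..m}" U] fin assms(5) by auto
  define h where "h x = (if x \<le> k then f x else f' x)" for x
  have "bij_betw h {1..k} T"
    using f by (rule bij_betw_cong[THEN iffD1, rotated]) (simp add: h_def)
  moreover have "bij_betw h {k + 1..m} U"
    using f' by (rule bij_betw_cong[THEN iffD1, rotated]) (simp add: h_def)
  ultimately have h: "bij_betw h {1..k} T" "bij_betw h {k + 1..m} U" .
  then have "bij_betw h ({1..k} \<union> {k + 1..m}) (T \<union> U)" by (rule bij_betw_combine) (rule assms)
  moreover have e: "{1..k} \<union> {k + 1..m} = {1..m}" using assms by auto
  ultimately have hb: "inj_on h {1..m}" "h ` {1..m} = T \<union> U" by (simp_all add: bij_betw_def)
  obtain \<rho> where \<rho>: "\<rho> permutes {1..r}" "\<And>a. a \<in> {1..m} \<Longrightarrow> \<rho> a = h a"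
    by (rule permutes_extend[of "{1..r}" h "{1..m}"]) (use hb assms in auto)
  have "\<rho> ` {1..k} = h ` {1..k}" by (intro image_cong refl \<rho>(2)) (use assms in auto)
  moreover have "\<rho> ` {k + 1..m} = h ` {k + 1..m}" by (intro image_cong refl \<rho>(2)) (use assms in auto)
  ultimately show ?thesis using that \<rho>(1) h by (auto simp: bij_betw_def)
qed

lemma card_permutation_image:
  assumes "\<pi> permutes S"
  shows "card (\<pi> ` A) = card A"
  by (intro card_image inj_on_subset[OF permutes_inj[OF assms]]) simp

context gadget_ideal
begin

lemma vertical_typeD:
  assumes "vertical_type k J D"
  shows "D \<in> brauer_diagrams r" "J \<subseteq> {1..2 * r}" "card J = m" "partner D ` J \<inter> J = {}"
    "card (J \<inter> {1..r}) = k"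
    "\<And>v. v \<in> {1..2 * r} \<Longrightarrow> v \<notin> J \<Longrightarrow> partner D v \<notin> J \<Longrightarrow> v \<le> r \<longleftrightarrow> r < partner D v"
  using assms unfolding vertical_type_def by blast+

text \<open>Both rows have \<open>r\<close> vertices, and the edges away from \<open>J\<close> use
  equally many of each. Comparing the rows shows that \<open>J\<close> has as many vertices in the
  top row as there are opposite end points in the bottom row.\<close>

lemma vertical_type_count:
  assumes t: "vertical_type k J D"
  shows "card {j \<in> J. r < partner D j} = k" "card {j \<in> J. partner D j \<le> r} = m - k" "k \<le> m"
    "card (J \<inter> {r + 1..2 * r}) = m - k"
proof -
  let ?q = "partner D" and ?V = "{1..2 * r}"
  have D: "D \<in> brauer_diagrams r" and J: "J \<subseteq> ?V" "card J = m" and disj: "?q ` J \<inter> J = {}"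
    and k: "card (J \<inter> {1..r}) = k"
    and vert: "\<And>v. v \<in> ?V \<Longrightarrow> v \<notin> J \<Longrightarrow> ?q v \<notin> J \<Longrightarrow> v \<le> r \<longleftrightarrow> r < ?q v"
    using vertical_typeD[OF t] by (simp_all only:)
  have finJ: "finite J" using J finite_subset by blast
  have qq: "?q (?q v) = v" for v by (rule partner_partner[OF D])
  have qV: "?q v \<in> ?V" if "v \<in> ?V" for v using that partner_props(3)[OF D] by blast
  have injq: "inj_on ?q A" for A by (rule inj_on_subset[OF permutes_inj[OF partner_permutes[OF D]]]) simp
  define Ft where "Ft = {v \<in> {1..r}. v \<notin> J \<and> ?q v \<notin> J}"
  define Fb where "Fb = {v \<in> {r + 1..2 * r}. v \<notin> J \<and> ?q v \<notin> J}"
  define At where "At = {j \<in> J. ?q j \<le> r}"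
  define Ab where "Ab = {j \<in> J. r < ?q j}"
  have fin: "finite Ft" "finite Fb" "finite At" "finite Ab"
    using finJ by (auto simp: Ft_def Fb_def At_def Ab_def)
  have "?q ` Ft = Fb"
  proof
    show "?q ` Ft \<subseteq> Fb"
    proof safe
      fix v assume v: "v \<in> Ft"
      then have "v \<in> ?V" by (auto simp: Ft_def)
      then show "?q v \<in> Fb" using vert[of v] qV[of v] v by (auto simp: Ft_def Fb_def qq)
    qed
    show "Fb \<subseteq> ?q ` Ft"
    proof
      fix v assume v: "v \<in> Fb"
      then have vV: "v \<in> ?V" by (auto simp: Fb_def)
      then have "?q v \<in> Ft" using vert[of v] qV[of v] v by (auto simp: Ft_def Fb_def qq)
      then show "v \<in> ?q ` Ft" using qq by (metis imageI)
    qed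
  qed
  then have F: "card Ft = card Fb" using card_image[OF injq] by metis
  have top: "{1..r} = (J \<inter> {1..r}) \<union> (?q ` At \<union> Ft)"
  proof
    show "{1..r} \<subseteq> (J \<inter> {1..r}) \<union> (?q ` At \<union> Ft)"
    proof
      fix v assume v: "v \<in> {1..r}"
      have "v \<in> ?q ` At" if "?q v \<in> J"
        using that v qq[of v] by (intro image_eqI[of _ _ "?q v"]) (auto simp: At_def qq)
      then show "v \<in> (J \<inter> {1..r}) \<union> (?q ` At \<union> Ft)" using v by (auto simp: Ft_def)
    qed
    show "(J \<inter> {1..r}) \<union> (?q ` At \<union> Ft) \<subseteq> {1..r}"
      using J qV by (fastforce simp: At_def Ft_def)
  qed
  have bot: "{r + 1..2 * r} = (J \<inter> {r + 1..2 * r}) \<union> (?q ` Ab \<union> Fb)"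
  proof
    show "{r + 1..2 * r} \<subseteq> (J \<inter> {r + 1..2 * r}) \<union> (?q ` Ab \<union> Fb)"
    proof
      fix v assume v: "v \<in> {r + 1..2 * r}"
      have "v \<in> ?q ` Ab" if "?q v \<in> J"
        using that v qq[of v] by (intro image_eqI[of _ _ "?q v"]) (auto simp: Ab_def qq)
      then show "v \<in> (J \<inter> {r + 1..2 * r}) \<union> (?q ` Ab \<union> Fb)" using v by (auto simp: Fb_def)
    qed
    show "(J \<inter> {r + 1..2 * r}) \<union> (?q ` Ab \<union> Fb) \<subseteq> {r + 1..2 * r}"
      using J qV by (fastforce simp: Ab_def Fb_def)
  qed
  have d1: "?q ` At \<inter> Ft = {}" "?q ` Ab \<inter> Fb = {}"
    by (auto simp: At_def Ab_def Ft_def Fb_def qq)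
  have d2: "(J \<inter> {1..r}) \<inter> (?q ` At \<union> Ft) = {}" "(J \<inter> {r + 1..2 * r}) \<inter> (?q ` Ab \<union> Fb) = {}"
    using disj by (auto simp: At_def Ab_def Ft_def Fb_def)
  have "r = card {1..r}" by simp
  also have "\<dots> = k + (card At + card Ft)"
    by (subst top, subst card_Un_disjoint)
      (use finJ fin d1 d2 k in \<open>auto simp: card_Un_disjoint card_image[OF injq]\<close>)
  finally have c1: "r = k + (card At + card Ft)" .
  have "r = card {r + 1..2 * r}" by simp
  also have "\<dots> = card (J \<inter> {r + 1..2 * r}) + (card Ab + card Fb)"
    by (subst bot, subst card_Un_disjoint)
      (use finJ fin d1 d2 in \<open>auto simp: card_Un_disjoint card_image[OF injq]\<close>)
  finally have c2: "r = card (J \<inter> {r + 1..2 * r}) + (card Ab + card Fb)" .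
  have "J = At \<union> Ab" "At \<inter> Ab = {}" by (auto simp: At_def Ab_def)
  then have c3: "m = card At + card Ab" using fin J(2) by (metis card_Un_disjoint)
  have "J = (J \<inter> {1..r}) \<union> (J \<inter> {r + 1..2 * r})" using J(1) by auto
  then have "card J = card ((J \<inter> {1..r}) \<union> (J \<inter> {r + 1..2 * r}))" by (rule arg_cong)
  also have "\<dots> = card (J \<inter> {1..r}) + card (J \<inter> {r + 1..2 * r})"
    by (rule card_Un_disjoint) (use finJ in auto)
  finally have c4: "m = k + card (J \<inter> {r + 1..2 * r})" using J(2) k by simp
  have "card Ab = k" using c1 c2 c3 c4 F by linarith
  then show "card {j \<in> J. r < ?q j} = k" "card {j \<in> J. ?q j \<le> r} = m - k" "k \<le> m"
    "card (J \<inter> {r + 1..2 * r}) = m - k" using c3 c4 by (auto simp: Ab_def At_def)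
qed

lemma vertical_type_swap:
  assumes t: "vertical_type k J D"
  shows "vertical_type (m - k) (partner D ` J) D"
proof -
  let ?q = "partner D"
  have D: "D \<in> brauer_diagrams r" and J: "J \<subseteq> {1..2 * r}" and disj: "?q ` J \<inter> J = {}"
    using vertical_typeD[OF t] by (simp_all only:)
  have qq: "?q (?q v) = v" for v by (rule partner_partner[OF D])
  have pq: "?q permutes {1..2 * r}" by (rule partner_permutes[OF D])
  have sub: "?q ` J \<subseteq> {1..2 * r}" using J permutes_image[OF pq] by blast
  have "?q ` J \<inter> {1..r} = ?q ` {j \<in> J. ?q j \<le> r}" using sub by auto
  then have "card (?q ` J \<inter> {1..r}) = m - k"
    using vertical_type_count(2)[OF t] card_permutation_image[OF pq] by simp
  moreover have "?q ` ?q ` J \<inter> ?q ` J = {}" using disj by (auto simp: image_image qq)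
  moreover have "v \<le> r \<longleftrightarrow> r < ?q v" if v: "v \<in> {1..2 * r}" "v \<notin> ?q ` J" "?q v \<notin> ?q ` J" for v
  proof (rule vertical_typeD(6)[OF t v(1)])
    show "v \<notin> J" using v(3) by blast
    show "?q v \<notin> J" using v(2) imageI[of "?q v" J ?q] by (auto simp: qq)
  qed
  moreover have "card (?q ` J) = m"
    using card_permutation_image[OF pq, of J] vertical_typeD(3)[OF t] by simp
  ultimately show ?thesis using D sub unfolding vertical_type_def by blast
qed

lemma good_partner:
  assumes "vertical_type k J D" "good (partner D ` J) D"
  shows "good J D"
  using assms(2) unfolding asym_partner[OF vertical_typeD(1,2,4)[OF assms(1)]] .

text \<open>One end point from each of the first \<open>m\<close> edges of the identity: the top one
  for the first \<open>k\<close>, the bottom one for the others. For \<open>m = n + 1\<close> and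
  \<open>k = (n + 1) div 2\<close> this is the vertex set of the generator.\<close>

definition std_set :: "nat \<Rightarrow> nat set" where
  "std_set k = {1..k} \<union> {r + k + 1..r + m}"

text \<open>Three normalisations: a permutation of \<open>J\<close> makes all edges of
  \<open>D\<close> vertical, so that \<open>D\<close> becomes the diagram of a permutation
  \<open>\<sigma>\<close>; left multiplication removes \<open>\<sigma>\<close>; and renaming both
  rows by the same \<open>\<rho>\<close>, which fixes the identity diagram, moves the set to
  standard position.\<close>

lemma good_std_imp_good:
  assumes std: "good (std_set k) (perm_diagram r id)" and t: "vertical_type k J D"
  shows "good J D"
proof -
  let ?q = "partner D" and ?V = "{1..2 * r}" and ?I = "perm_diagram r id"
  have D: "D \<in> brauer_diagrams r" and J: "J \<subseteq> ?V" "card J = m" and disj: "?q ` J \<inter> J = {}"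
    and k: "card (J \<inter> {1..r}) = k"
    and vert: "\<And>v. v \<in> ?V \<Longrightarrow> v \<notin> J \<Longrightarrow> ?q v \<notin> J \<Longrightarrow> v \<le> r \<longleftrightarrow> r < ?q v"
    using vertical_typeD[OF t] by (simp_all only:)
  have finJ: "finite J" using J finite_subset by blast
  have qq: "?q (?q v) = v" for v by (rule partner_partner[OF D])
  have qV: "?q v \<in> ?V" if "v \<in> ?V" for v using that partner_props(3)[OF D] by blast
  \<comment> \<open>Edges whose opposite end point is in the bottom row receive the vertices of
    \<open>J\<close> in the top row; by \<open>vertical_type_count\<close> there are equally many of
    both.\<close>
  obtain \<pi> where \<pi>: "\<pi> permutes J" "\<pi> ` {j \<in> J. r < ?q j} = J \<inter> {1..r}"
    by (rule permutes_onto[OF finJ, of "{j \<in> J. r < ?q j}" "J \<inter> {1..r}"])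
      (use vertical_type_count(1)[OF t] k in auto)
  have \<pi>J: "\<pi> v \<in> J \<longleftrightarrow> v \<in> J" for v using permutes_in_image[OF \<pi>(1)] .
  have \<pi>fx: "\<pi> v = v" if "v \<notin> J" for v using permutes_not_in[OF \<pi>(1) that] .
  have \<pi>V: "\<pi> permutes ?V" by (rule permutes_subset[OF \<pi>(1) J(1)])
  define D1 where "D1 = dact \<pi> D"
  let ?q1 = "partner D1"
  have D1: "D1 \<in> brauer_diagrams r" unfolding D1_def by (rule dact_closed[OF D \<pi>V])
  have q1: "?q1 (\<pi> v) = \<pi> (?q v)" if "v \<in> ?V" for v unfolding D1_def by (rule partner_dact[OF D \<pi>V that])
  have q1q1: "?q1 (?q1 v) = v" for v by (rule partner_partner[OF D1])
  have side: "\<pi> j \<le> r \<longleftrightarrow> r < ?q j" if j: "j \<in> J" for j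
  proof -
    have "\<pi> j \<in> \<pi> ` {j \<in> J. r < ?q j} \<longleftrightarrow> j \<in> {j \<in> J. r < ?q j}"
      using permutes_inj[OF \<pi>(1)] by (simp add: inj_image_mem_iff)
    moreover have pj: "\<pi> j \<in> J" using j \<pi>J by simp
    moreover have "\<pi> j \<in> ?V" using pj J(1) by blast
    ultimately show ?thesis using j unfolding \<pi>(2) by simp
  qed
  have q1J: "?q1 (\<pi> j) = ?q j" if j: "j \<in> J" for j
  proof -
    have "j \<in> ?V" "?q j \<notin> J" using j J(1) disj by blast+
    then show ?thesis by (simp only: q1 \<pi>fx not_False_eq_True)
  qed
  have vert1: "v \<le> r \<longleftrightarrow> r < ?q1 v" if v: "v \<in> ?V" for v
  proof -
    consider "v \<in> J" | "v \<notin> J" "?q v \<in> J" | "v \<notin> J" "?q v \<notin> J" by blast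
    then show ?thesis
    proof cases
      case 1
      then obtain j where j: "v = \<pi> j" "j \<in> J" using permutes_image[OF \<pi>(1)] by blast
      show ?thesis unfolding j(1) q1J[OF j(2)] by (rule side[OF j(2)])
    next
      case 2
      have "?q1 v = \<pi> (?q v)" using q1[OF v] \<pi>fx[OF 2(1)] by simp
      moreover have "\<pi> (?q v) \<le> r \<longleftrightarrow> r < v" using side[OF 2(2)] by (simp add: qq)
      ultimately show ?thesis by linarith
    next
      case 3
      have "?q1 v = ?q v" using q1[OF v] \<pi>fx[OF 3(1)] \<pi>fx[OF 3(2)] by simp
      then show ?thesis using vert[OF v 3] by simp
    qed
  qed
  obtain \<sigma> where \<sigma>: "\<sigma> permutes {1..r}" "D1 = perm_diagram r \<sigma>" "\<And>i. i \<in> {1..r} \<Longrightarrow> \<sigma> i = ?q1 (r + i)"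
    using all_vertical_diagram[OF D1 vert1] by blast
  have \<sigma>fx: "\<sigma> v = v" if "v \<notin> {1..r}" for v using permutes_not_in[OF \<sigma>(1) that] .
  define J' where "J' = inv \<sigma> ` J"
  have \<sigma>b: "bij \<sigma>" by (rule permutes_bij[OF \<sigma>(1)])
  have \<sigma>J': "\<sigma> ` J' = J" unfolding J'_def using \<sigma>b by (simp add: image_f_inv_f bij_is_surj)
  have memJ': "v \<in> J' \<longleftrightarrow> \<sigma> v \<in> J" for v
    using \<sigma>J' permutes_inj[OF \<sigma>(1)] by (metis inj_image_mem_iff)
  have finJ': "finite J'" using finJ by (simp add: J'_def)
  define T where "T = J' \<inter> {1..r}"
  define U where "U = {i \<in> {1..r}. r + i \<in> J'}"
  have U: "i \<in> U \<longleftrightarrow> i \<in> {1..r} \<and> r + i \<in> J" for i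
    unfolding U_def memJ' using \<sigma>fx[of "r + i"] by auto
  \<comment> \<open>An index in both sets would give an edge with both end points in
    \<open>J\<close>.\<close>
  have "T \<inter> U = {}"
  proof (rule ccontr)
    assume "T \<inter> U \<noteq> {}"
    then obtain i where i: "i \<in> T" "i \<in> U" by blast
    then have "i \<in> {1..r}" "\<sigma> i \<in> J" "r + i \<in> J" using U by (auto simp: T_def memJ')
    then have "?q1 (r + i) \<in> J" using \<sigma>(3) by simp
    moreover obtain j where "r + i = \<pi> j" "j \<in> J" using \<open>r + i \<in> J\<close> permutes_image[OF \<pi>(1)] by blast
    ultimately have "?q j \<in> J" using q1J by simp
    then show False using disj \<open>j \<in> J\<close> by blast
  qed
  have "\<sigma> ` T = J \<inter> {1..r}"
    unfolding T_def using \<sigma>J' permutes_image[OF \<sigma>(1)] permutes_inj[OF \<sigma>(1)] by (simp add: image_Int)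
  then have cT: "card T = k" using k card_permutation_image[OF \<sigma>(1), of T] by simp
  have JU: "J \<inter> {r + 1..2 * r} = (+) r ` U"
  proof
    show "J \<inter> {r + 1..2 * r} \<subseteq> (+) r ` U"
    proof
      fix v assume v: "v \<in> J \<inter> {r + 1..2 * r}"
      then show "v \<in> (+) r ` U" by (intro image_eqI[of _ _ "v - r"]) (auto simp: U)
    qed
  qed (auto simp: U)
  then have cU: "card U = m - k"
    using vertical_type_count(4)[OF t] card_image[of "(+) r" U] by simp
  obtain \<rho> where \<rho>: "\<rho> permutes {1..r}" "\<rho> ` {1..k} = T" "\<rho> ` {k + 1..m} = U"
    by (rule exists_permutes_pair[OF _ _ \<open>T \<inter> U = {}\<close> cT cU vertical_type_count(3)[OF t] mr])
      (auto simp: T_def U_def)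
  let ?b = "bottom r \<rho>"
  let ?g = "\<rho> \<circ> ?b"
  have gV: "?g permutes ?V"
    by (intro permutes_compose permutes_le bottom_permutes_all \<rho>(1))
  have \<rho>fx: "\<rho> v = v" if "v \<notin> {1..r}" for v using permutes_not_in[OF \<rho>(1) that] .
  have \<rho>in: "\<rho> v \<in> {1..r} \<longleftrightarrow> v \<in> {1..r}" for v using permutes_in_image[OF \<rho>(1)] .
  have g1: "?g v = \<rho> v" if "v \<le> r" for v using that by (simp add: bottom_def)
  have g2: "?g (r + v) = r + \<rho> v" if "v \<in> {1..r}" for v
    using that \<rho>in[of v] \<rho>fx[of "r + \<rho> v"] by (simp add: bottom_def)
  have fixI: "dact ?g ?I = ?I"
    unfolding dact_comp dact_bottom_id_diagram[OF \<rho>(1)] by (rule dact_inverse(2)[OF permutes_bij[OF \<rho>(1)]])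
  have gstd: "?g ` std_set k = J'"
  proof -
    have "?g ` {1..k} = \<rho> ` {1..k}"
      by (intro image_cong refl g1) (use vertical_type_count(3)[OF t] mr in auto)
    moreover have "?g ` {r + k + 1..r + m} = (+) r ` U"
    proof -
      have e: "{r + k + 1..r + m} = (+) r ` {k + 1..m}" by (simp add: image_add_atLeastAtMost add.assoc)
      have "?g ` {r + k + 1..r + m} = (\<lambda>v. ?g (r + v)) ` {k + 1..m}" unfolding e by (simp only: image_image)
      also have "\<dots> = (\<lambda>v. r + \<rho> v) ` {k + 1..m}" by (intro image_cong refl g2) (use mr in auto)
      finally show ?thesis by (simp add: \<rho>(3)[symmetric] image_image)
    qed
    ultimately have "?g ` std_set k = T \<union> (+) r ` U" unfolding std_set_def image_Un \<rho>(2) by simp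
    also have "\<dots> = J'"
    proof -
      have "J' \<subseteq> ?V" unfolding J'_def using J(1) permutes_image[OF permutes_le[OF permutes_inv[OF \<sigma>(1)]]] by blast
      moreover have "(+) r ` U = J' \<inter> {r + 1..2 * r}"
        unfolding JU[symmetric] using memJ' \<sigma>fx by (auto; fastforce)
      ultimately show ?thesis by (auto simp: T_def)
    qed
    finally show ?thesis .
  qed
  have finS: "finite (std_set k)" by (simp add: std_set_def)
  have "vact ?g (asym (std_set k) (basis_diagram ?I)) \<in> P"
    unfolding vact_comp[OF permutes_bij[OF \<rho>(1)] permutes_bij[OF bottom_permutes[OF \<rho>(1)]]]
    by (intro vact_top vact_bottom std \<rho>(1))
  from good_vact[OF gV finS this] have "good J' ?I" unfolding gstd fixI .
  then have "vact \<sigma> (asym J' (basis_diagram ?I)) \<in> P" by (rule vact_top[OF _ \<sigma>(1)])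
  from good_vact[OF permutes_le[OF \<sigma>(1)] finJ' this]
  have "good J D1" unfolding \<sigma>J' perm_diagram_dact[OF \<sigma>(1), symmetric] \<sigma>(2) .
  then show ?thesis unfolding D1_def by (rule good_dact[OF finJ \<pi>(1)])
qed

end

text \<open>Such an \<open>h\<close> splits into a permutation of \<open>J\<close> and one of the
  opposite end points. The first acts on the antisymmetrisation by its sign; so does the second,
  since antisymmetrising over the opposite end points gives the same element.\<close>

lemma vact_stabiliser:
  assumes D: "D \<in> brauer_diagrams r" and J: "J \<subseteq> {1..2 * r}" and disj: "partner D ` J \<inter> J = {}"
    and h: "h permutes J \<union> partner D ` J" "h ` J = J"
  shows "vact h (asym J (basis_diagram D)) =
    (\<lambda>D'. of_int (sign h) * asym J (basis_diagram D) D' :: 'a::comm_ring_1)"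
proof -
  let ?I = "partner D ` J"
  have fin: "finite J" using J finite_subset by blast
  have "inj_on h J" by (rule inj_on_subset[OF permutes_inj[OF h(1)]]) simp
  then obtain h1 where h1: "h1 permutes J" "\<And>a. a \<in> J \<Longrightarrow> h1 a = h a"
    using permutes_extend[OF fin, of h J] h(2) by auto
  define h2 where "h2 = inv h1 \<circ> h"
  have "inv h1 permutes J \<union> ?I" by (rule permutes_subset[OF permutes_inv[OF h1(1)]]) blast
  then have h2u: "h2 permutes J \<union> ?I" unfolding h2_def by (intro permutes_compose h(1))
  have h2f: "h2 a = a" if "a \<in> J" for a
    using h1(2)[OF that] permutes_inverses(2)[OF h1(1)] by (simp add: h2_def, metis)
  have h2: "h2 permutes ?I" by (rule permutes_superset[OF h2u]) (use h2f in blast)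
  have hh: "h = h1 \<circ> h2" unfolding h2_def using permutes_inverses(1)[OF h1(1)] by (auto simp: fun_eq_iff)
  have finI: "finite ?I" using fin by simp
  have "vact h (asym J (basis_diagram D)) = vact h1 (vact h2 (asym ?I (basis_diagram D) :: diagram \<Rightarrow> 'a))"
    unfolding hh asym_partner[OF D J disj] by (rule vact_comp[OF permutes_bij[OF h1(1)] permutes_bij[OF h2]])
  also have "vact h2 (asym ?I (basis_diagram D)) = (\<lambda>D'. of_int (sign h2) * asym ?I (basis_diagram D) D' :: 'a)"
    by (rule vact_asym[OF h2 finI])
  also have "vact h1 \<dots> = (\<lambda>D'. of_int (sign h2) * vact h1 (asym J (basis_diagram D)) D')"
    unfolding asym_partner[OF D J disj] by (simp add: vact_def)
  also have "\<dots> = (\<lambda>D'. of_int (sign h) * asym J (basis_diagram D) D')"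
  proof -
    have "permutation h1" "permutation h2" using h1(1) h2 fin finI permutation_permutes by blast+
    then have "sign h = sign h1 * sign h2" unfolding hh by (rule sign_compose)
    then show ?thesis unfolding vact_asym[OF h1(1) fin] by (simp add: mult_ac)
  qed
  finally show ?thesis .
qed

context gadget_ideal
begin

text \<open>\<open>W\<close> consists of the \<open>2m\<close> end points of the edges that meet
  \<open>J\<close>. With the bottom part \<open>U\<close> of \<open>J\<close> fixed, the Garnir
  relation for \<open>T \<union> U\<close> expresses the sum of
  \<open>v ((T - {z}) \<union> U)\<close> over \<open>z \<in> T\<close> through elements with
  \<open>k + 1\<close> vertices in the top row, which lie in \<open>P\<close> already;
  \<open>subset_averaging\<close> isolates a single term.\<close>

lemma good_step:
  assumes good: "\<And>J D. vertical_type (Suc k) J D \<Longrightarrow> good J D" and km: "2 * k + 1 \<le> m"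
    and t: "vertical_type k J D"
  shows "good J D"
proof -
  let ?q = "partner D" and ?V = "{1..2 * r}"
  have D: "D \<in> brauer_diagrams r" and J: "J \<subseteq> ?V" "card J = m" and disj: "?q ` J \<inter> J = {}"
    and k: "card (J \<inter> {1..r}) = k"
    and vert: "\<And>v. v \<in> ?V \<Longrightarrow> v \<notin> J \<Longrightarrow> ?q v \<notin> J \<Longrightarrow> v \<le> r \<longleftrightarrow> r < ?q v"
    using vertical_typeD[OF t] by (simp_all only:)
  have finJ: "finite J" using J finite_subset by blast
  have qq: "?q (?q v) = v" for v by (rule partner_partner[OF D])
  define W where "W = J \<union> ?q ` J"
  have WV: "W \<subseteq> ?V" unfolding W_def using J(1) permutes_image[OF partner_permutes[OF D]] by blast
  have finW: "finite W" using WV finite_subset by blast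
  have JW: "J \<subseteq> W" by (simp add: W_def)
  have qW: "?q v \<in> W \<longleftrightarrow> v \<in> W" for v
    using inj_image_mem_iff[OF permutes_inj[OF partner_permutes[OF D]], of v J]
      inj_image_mem_iff[OF permutes_inj[OF partner_permutes[OF D]], of "?q v" J]
    by (auto simp: W_def qq)
  define G :: "diagram \<Rightarrow> 'a" where "G = asym J (basis_diagram D)"
  \<comment> \<open>Up to sign, the image of \<open>G\<close> under any \<open>g\<close> that maps \<open>J\<close> to \<open>J'\<close>\<close>
  define v where "v J' = (\<lambda>D'. of_int (sign (SOME g. g permutes W \<and> g ` J = J')) *
      vact (SOME g. g permutes W \<and> g ` J = J') G D')" for J'
  have per: "permutation g" if "g permutes W" for g using that finW permutation_permutes by blast
  have v_eq: "v (g ` J) = (\<lambda>D'. of_int (sign g) * vact g G D')" if g: "g permutes W" for g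
  proof -
    define g0 where "g0 = (SOME g'. g' permutes W \<and> g' ` J = g ` J)"
    have "g0 permutes W \<and> g0 ` J = g ` J"
      unfolding g0_def by (rule someI[of "\<lambda>g'. g' permutes W \<and> g' ` J = g ` J" g]) (simp add: g)
    then have g0: "g0 permutes W" "g0 ` J = g ` J" by auto
    define h where "h = inv g \<circ> g0"
    have h: "h permutes W" unfolding h_def by (intro permutes_compose permutes_inv g g0)
    have "h ` J = J"
      unfolding h_def image_comp[symmetric] g0(2) by (rule image_inv_f_f[OF permutes_inj[OF g]])
    then have hG: "vact h G = (\<lambda>D'. of_int (sign h) * G D')"
      unfolding G_def using vact_stabiliser[OF D J(1) disj h[unfolded W_def]] by blast
    have gh: "g0 = g \<circ> h" unfolding h_def using permutes_inverses(1)[OF g] by (auto simp: fun_eq_iff)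
    have s: "sign g0 = sign g * sign h" unfolding gh by (intro sign_compose per g h)
    have "vact g0 G = vact g (vact h G)"
      unfolding gh by (rule vact_comp[OF permutes_bij[OF g] permutes_bij[OF h]])
    also have "\<dots> = (\<lambda>D'. of_int (sign h) * vact g G D')" unfolding hG by (simp add: vact_def)
    finally have "v (g ` J) = (\<lambda>D'. of_int (sign g * sign h) * (of_int (sign h) * vact g G D'))"
      unfolding v_def g0_def[symmetric] s by simp
    moreover have "(of_int (sign g * sign h) * (of_int (sign h) * a) :: 'a) = of_int (sign g) * a" for a
      by (simp only: mult.assoc[symmetric] of_int_mult[symmetric]) (simp only: mult.assoc sign_idempotent mult_1_right)
    ultimately show ?thesis by (simp only:)
  qed
  \<comment> \<open>Garnir relations: \<open>m + 1\<close> of the \<open>2m\<close> end points of the edges that meet \<open>J\<close> contain an edge,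
    so antisymmetrising over them gives 0\<close>
  have garnir: "(\<Sum>z\<in>T. v (T - {z}) D') = 0" if T: "T \<subseteq> W" "card T = Suc m" for T D'
  proof -
    have finT: "finite T" using T(1) finW finite_subset by blast
    obtain t where t: "t \<in> T" using T(2) by fastforce
    obtain g where g: "g permutes W" "g ` J = T - {t}"
      by (rule permutes_onto[OF finW JW, of "T - {t}"]) (use T t J finT in auto)
    define y where "y = inv g t"
    have gy: "g y = t" unfolding y_def by (rule permutes_inverses(1)[OF g(1)])
    have yJ: "y \<notin> J" using g(2) gy by blast
    have yW: "y \<in> W" using t T(1) gy permutes_in_image[OF g(1), of y] by auto
    then obtain j0 where j0: "j0 \<in> J" "y = ?q j0" using yJ by (auto simp: W_def)
    have "asym (insert y J) (basis_diagram D) = (\<lambda>_. 0 :: 'a)"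
      by (rule asym_edge_eq_0[OF D _ _ _ two, of _ j0]) (use j0 yW WV J in auto)
    then have rel: "G E - (\<Sum>j\<in>J. vact (vswap y j) G E) = 0" for E
      using asym_insert[OF finJ yJ, of "basis_diagram D :: diagram \<Rightarrow> 'a" E] by (simp add: G_def)
    have vj: "v (T - {g j}) D' = - (of_int (sign g) * vact g (vact (vswap y j) G) D')" if j: "j \<in> J" for j
    proof -
      \<comment> \<open>Since the transposition of \<open>y\<close> and \<open>j\<close> replaces
        \<open>j\<close> by \<open>y\<close> in \<open>J\<close>, composing it with \<open>g\<close>
        maps \<open>J\<close> to \<open>T - {g j}\<close>; its sign is the minus sign
        claimed.\<close>
      let ?t = "vswap y j"
      have tW: "?t permutes W" by (rule permutes_swap_id) (use yW j JW in auto)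
      have "?t ` J = insert y J - {j}"
        using j yJ by (auto simp: Transposition.transpose_def image_iff)
      then have "(g \<circ> ?t) ` J = insert (g y) (g ` J) - {g j}"
        unfolding image_comp[symmetric] using permutes_inj[OF g(1)] by (simp add: image_set_diff)
      also have "\<dots> = T - {g j}" unfolding g(2) gy using t by blast
      finally have im: "(g \<circ> ?t) ` J = T - {g j}" .
      have "y \<noteq> j" using yJ j by blast
      then have "sign (g \<circ> ?t) = - sign g"
        by (simp add: sign_compose per[OF g(1)] permutation_swap_id sign_swap_id)
      moreover have "vact (g \<circ> ?t) G = vact g (vact ?t G)"
        by (rule vact_comp[OF permutes_bij[OF g(1)] permutes_bij[OF tW]])
      ultimately show ?thesis
        using v_eq[of "g \<circ> ?t"] permutes_compose[OF tW g(1)] unfolding im by simp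
    qed
    have inj: "inj_on g (insert y J)" by (rule inj_on_subset[OF permutes_inj[OF g(1)]]) simp
    have Tg: "T = g ` insert y J" using g(2) gy t by auto
    have "(\<Sum>z\<in>T. v (T - {z}) D') = (\<Sum>j\<in>insert y J. v (T - {g j}) D')"
      unfolding Tg by (rule sum.reindex[OF inj, unfolded comp_def])
    also have "\<dots> = v (T - {g y}) D' + (\<Sum>j\<in>J. v (T - {g j}) D')" using finJ yJ by simp
    also have "v (T - {g y}) D' = of_int (sign g) * vact g G D'"
      unfolding gy g(2)[symmetric] v_eq[OF g(1)] ..
    also have "(\<Sum>j\<in>J. v (T - {g j}) D') = - (of_int (sign g) * (\<Sum>j\<in>J. vact g (vact (vswap y j) G) D'))"
      unfolding sum_distrib_left sum_negf[symmetric] by (intro sum.cong refl vj)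
    also have "of_int (sign g) * vact g G D' + \<dots> =
       of_int (sign g) * (vact g G D' - (\<Sum>j\<in>J. vact g (vact (vswap y j) G) D'))"
      by (simp add: algebra_simps)
    also have "\<dots> = 0" using rel[of "dact (inv g) D'"] by (simp add: vact_def)
    finally show ?thesis .
  qed
  \<comment> \<open>Outside \<open>W\<close> the permutation \<open>g\<close> changes nothing, so
    the edges away from \<open>J'\<close> still join the rows and the hypothesis for
    \<open>Suc k\<close> applies.\<close>
  have vP: "v J' \<in> P" if J': "J' \<subseteq> W" "card J' = m" "card (J' \<inter> {1..r}) = Suc k" for J'
  proof -
    obtain g where g: "g permutes W" "g ` J = J'"
      by (rule permutes_onto[OF finW JW J'(1)]) (use J J' in auto)
    have gV: "g permutes ?V" by (rule permutes_subset[OF g(1) WV])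
    let ?D = "dact g D"
    have D': "?D \<in> brauer_diagrams r" by (rule dact_closed[OF D gV])
    have q': "partner ?D (g w) = g (?q w)" if "w \<in> ?V" for w by (rule partner_dact[OF D gV that])
    have "vertical_type (Suc k) J' ?D"
      unfolding vertical_type_def
    proof (intro conjI ballI impI)
      show "J' \<subseteq> ?V" using J'(1) WV by blast
      show "partner ?D ` J' \<inter> J' = {}"
      proof -
        have "partner ?D ` J' = g ` ?q ` J" unfolding g(2)[symmetric] image_image
          by (intro image_cong refl q') (use J(1) in blast)
        then show ?thesis unfolding g(2)[symmetric] using disj permutes_inj[OF g(1)]
          by (simp add: image_Int[symmetric])
      qed
      fix w assume w: "w \<in> ?V" "w \<notin> J'" "partner ?D w \<notin> J'"
      define w0 where "w0 = inv g w"
      have gw: "g w0 = w" unfolding w0_def by (rule permutes_inverses(1)[OF g(1)])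
      have w0V: "w0 \<in> ?V" using permutes_in_image[OF gV, of w0] gw w by simp
      have w0J: "w0 \<notin> J" using w(2) g(2) gw by blast
      have qw0: "?q w0 \<notin> J" using w(3) q'[OF w0V] gw g(2) by auto
      have "w0 \<notin> W" using w0J qw0 qq by (auto simp: W_def)
      then have "g w0 = w0" "g (?q w0) = ?q w0" using permutes_not_in[OF g(1)] qW by auto
      then have "w = w0" "partner ?D w = ?q w0" using gw q'[OF w0V] by auto
      then show "w \<le> r \<longleftrightarrow> r < partner ?D w" using vert[OF w0V w0J qw0] by simp
    qed (use D' J' in auto)
    then have "good J' ?D" by (rule good)
    moreover have "v J' = (\<lambda>D'. of_int (sign g) * asym J' (basis_diagram ?D) D')"
      using v_eq[OF g(1)] vact_asym_conj[OF per[OF g(1)] finJ, of "basis_diagram D :: diagram \<Rightarrow> 'a"]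
      by (simp add: g(2) G_def vact_basis permutes_bij[OF g(1)])
    ultimately show ?thesis using linear_subset_scale[OF lin] by simp
  qed
  define X where "X = W \<inter> {1..r}"
  define U where "U = J \<inter> {r + 1..2 * r}"
  have finU: "finite U" using finJ by (simp add: U_def)
  have cU: "card U = m - k" unfolding U_def by (rule vertical_type_count(4)[OF t])
  have kle: "k \<le> m" by (rule vertical_type_count(3)[OF t])
  have finX: "finite X" by (simp add: X_def)
  \<comment> \<open>The top row contains \<open>k\<close> elements of \<open>J\<close> and
    \<open>m - k\<close> opposite end points. Hence \<open>2 * k + 1 \<le> m\<close> is exactly the
    size condition for averaging over \<open>X\<close>.\<close>
  have cX: "card X = m"
  proof -
    have "X = (J \<inter> {1..r}) \<union> (?q ` J \<inter> {1..r})" by (auto simp: X_def W_def)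
    then have "card X = card ((J \<inter> {1..r}) \<union> (?q ` J \<inter> {1..r}))" by simp
    also have "\<dots> = card (J \<inter> {1..r}) + card (?q ` J \<inter> {1..r})"
      by (rule card_Un_disjoint) (use finJ disj in auto)
    also have "\<dots> = k + (m - k)" unfolding k vertical_typeD(5)[OF vertical_type_swap[OF t]] ..
    finally show ?thesis using kle by simp
  qed
  have "(\<lambda>D'. v ((J \<inter> {1..r}) \<union> U) D') \<in> P"
  proof (rule subset_averaging[OF lin finX, of k "\<lambda>S. v (S \<union> U)" "J \<inter> {1..r}"])
    show "2 * k + 1 \<le> card X" using km cX by simp
    show "J \<inter> {1..r} \<subseteq> X" using JW by (auto simp: X_def)
    show "card (J \<inter> {1..r}) = k" by (rule k)
    show "of_nat (Suc a) \<noteq> (0 :: 'a)" if "a \<le> k" for a by (rule nz) (use that km in auto)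
    fix T assume T: "T \<subseteq> X" "card T = Suc k"
    have finT: "finite T" using T finX finite_subset by blast
    have TU: "T \<inter> U = {}" using T by (auto simp: X_def U_def)
    have UW: "U \<subseteq> W" using JW by (auto simp: U_def)
    have TW: "T \<union> U \<subseteq> W" using T(1) UW by (auto simp: X_def)
    have cTU: "card (T \<union> U) = Suc m" using finT finU TU T(2) cU kle by (simp add: card_Un_disjoint)
    have "(\<lambda>D'. \<Sum>z\<in>T. v ((T - {z}) \<union> U) D') = (\<lambda>D'. - 1 * (\<Sum>z\<in>U. v (T \<union> U - {z}) D'))"
    proof
      fix D'
      have "0 = (\<Sum>z\<in>T \<union> U. v (T \<union> U - {z}) D')" by (rule garnir[OF TW cTU, symmetric])
      also have "\<dots> = (\<Sum>z\<in>T. v (T \<union> U - {z}) D') + (\<Sum>z\<in>U. v (T \<union> U - {z}) D')"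
        by (rule sum.union_disjoint[OF finT finU TU])
      also have "(\<Sum>z\<in>T. v (T \<union> U - {z}) D') = (\<Sum>z\<in>T. v ((T - {z}) \<union> U) D')"
        using TU by (intro sum.cong refl arg_cong2[where f = v]) (auto intro!: arg_cong[of _ _ "\<lambda>A. v A D'"])
      finally show "(\<Sum>z\<in>T. v ((T - {z}) \<union> U) D') = - 1 * (\<Sum>z\<in>U. v (T \<union> U - {z}) D')"
        by (simp add: eq_neg_iff_add_eq_0)
    qed
    moreover have "(\<lambda>D'. \<Sum>z\<in>U. v (T \<union> U - {z}) D') \<in> P"
    proof (rule linear_subset_sum[OF lin], rule vP)
      fix z assume z: "z \<in> U"
      show "T \<union> U - {z} \<subseteq> W" using TW by blast
      show "card (T \<union> U - {z}) = m" using z cTU finT finU by simp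
      have "(T \<union> U - {z}) \<inter> {1..r} = T" using z T(1) by (auto simp: X_def U_def)
      then show "card ((T \<union> U - {z}) \<inter> {1..r}) = Suc k" using T(2) by simp
    qed
    ultimately show "(\<lambda>D'. \<Sum>z\<in>T. v ((T - {z}) \<union> U) D') \<in> P"
      using linear_subset_scale[OF lin] by (simp only:)
  qed
  moreover have "(J \<inter> {1..r}) \<union> U = id ` J" using J(1) by (auto simp: U_def)
  ultimately show ?thesis using v_eq[OF permutes_id] by (simp add: G_def)
qed

text \<open>\<open>good_step\<close> descends from the middle value \<open>m div 2\<close> to every
  smaller \<open>k\<close>; a larger \<open>k\<close> becomes \<open>m - k \<le> m div 2\<close> on
  passing to the opposite end points.\<close>

theorem all_good:
  assumes std: "good (std_set (m div 2)) (perm_diagram r id)"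
    and "D \<in> brauer_diagrams r" "J \<subseteq> {1..2 * r}" "card J = m"
  shows "good J D"
proof (rule reduce_to_vertical[OF _ assms(2-4)])
  have low: "vertical_type k J D \<Longrightarrow> good J D" if "k \<le> m div 2" for k J D
    using that
  proof (induction k arbitrary: J D rule: inc_induct)
    case base
    then show ?case using good_std_imp_good[OF std] by blast
  next
    case (step k)
    then show ?case using good_step[of k] by simp
  qed
  fix k J D assume t: "vertical_type k J D"
  show "good J D"
  proof (cases "k \<le> m div 2")
    case True
    then show ?thesis using low t by blast
  next
    case False
    then have "m - k \<le> m div 2" by simp
    then show ?thesis using low vertical_type_swap[OF t] good_partner[OF t] by blast
  qed
qed

end

section \<open>Block permutations\<close>

lemma permutes_image_disjoint:
  assumes "\<pi> permutes T" "S \<inter> T = {}"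
  shows "\<pi> ` S = S"
proof -
  have "\<pi> ` S = (\<lambda>v. v) ` S"
  proof (rule image_cong[OF refl])
    fix v assume "v \<in> S"
    then have "v \<notin> T" using assms(2) by blast
    then show "\<pi> v = v" by (rule permutes_not_in[OF assms(1)])
  qed
  then show ?thesis by simp
qed

text \<open>The Young subgroup of two blocks, written as a stabiliser; for disjoint blocks
  \<open>block_perms_bij\<close> gives the product form.\<close>

definition block_perms :: "'a set \<Rightarrow> 'a set \<Rightarrow> ('a \<Rightarrow> 'a) set" where
  "block_perms A B = {h. h permutes A \<union> B \<and> h ` A = A}"

lemma block_perms_bij:
  assumes disj: "A \<inter> B = {}"
  shows "bij_betw (\<lambda>p. fst p \<circ> snd p) ({\<beta>. \<beta> permutes B} \<times> {\<alpha>. \<alpha> permutes A}) (block_perms A B)"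
proof (rule bij_betw_byWitness[where f' = "\<lambda>h. (restrict_id h B, restrict_id h A)"])
  have fx: "\<alpha> v = v" if "\<alpha> permutes A" "v \<notin> A" for \<alpha> v using permutes_not_in that by metis
  have fx': "\<beta> v = v" if "\<beta> permutes B" "v \<notin> B" for \<beta> v using permutes_not_in that by metis
  have in_: "\<alpha> v \<in> A \<longleftrightarrow> v \<in> A" if "\<alpha> permutes A" for \<alpha> v by (rule permutes_in_image[OF that])
  have in': "\<beta> v \<in> B \<longleftrightarrow> v \<in> B" if "\<beta> permutes B" for \<beta> v by (rule permutes_in_image[OF that])
  show "\<forall>p\<in>{\<beta>. \<beta> permutes B} \<times> {\<alpha>. \<alpha> permutes A}.
     (restrict_id (fst p \<circ> snd p) B, restrict_id (fst p \<circ> snd p) A) = p"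
  proof
    fix p assume "p \<in> {\<beta>. \<beta> permutes B} \<times> {\<alpha>. \<alpha> permutes A}"
    then obtain \<beta> \<alpha> where p: "\<beta> permutes B" "\<alpha> permutes A" "p = (\<beta>, \<alpha>)" by auto
    have r1: "restrict_id (\<beta> \<circ> \<alpha>) B v = \<beta> v" for v
    proof (cases "v \<in> B")
      case True
      then have "v \<notin> A" using disj by blast
      then show ?thesis using True fx[OF p(2)] by simp
    qed (simp add: fx'[OF p(1)])
    have r2: "restrict_id (\<beta> \<circ> \<alpha>) A v = \<alpha> v" for v
    proof (cases "v \<in> A")
      case True
      then have "\<alpha> v \<notin> B" using in_[OF p(2)] disj by blast
      then show ?thesis using True fx'[OF p(1)] by simp
    qed (simp add: fx[OF p(2)])
    have "restrict_id (\<beta> \<circ> \<alpha>) B = \<beta>" "restrict_id (\<beta> \<circ> \<alpha>) A = \<alpha>"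
      by (rule ext, rule r1) (rule ext, rule r2)
    then show "(restrict_id (fst p \<circ> snd p) B, restrict_id (fst p \<circ> snd p) A) = p"
      by (simp only: p(3) fst_conv snd_conv)
  qed
  have hB: "h ` B = B" if h: "h permutes A \<union> B" "h ` A = A" for h
  proof -
    have "h ` (A \<union> B - A) = (A \<union> B) - A"
      using permutes_image[OF h(1)] h(2) permutes_inj[OF h(1)] by (simp only: image_set_diff)
    moreover have "A \<union> B - A = B" using disj by blast
    ultimately show ?thesis by simp
  qed
  have bb: "bij_betw h A A" "bij_betw h B B" if h: "h permutes A \<union> B" "h ` A = A" for h
    using h hB[OF h] permutes_inj[OF h(1)] by (auto simp: bij_betw_def intro: inj_on_subset)
  show "\<forall>h\<in>block_perms A B. fst (restrict_id h B, restrict_id h A) \<circ> snd (restrict_id h B, restrict_id h A) = h"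
  proof
    fix h assume "h \<in> block_perms A B"
    then have h: "h permutes A \<union> B" "h ` A = A" by (auto simp: block_perms_def)
    have "restrict_id h B (restrict_id h A v) = h v" for v
    proof (cases "v \<in> A")
      case True
      then have "h v \<in> A" using h(2) by blast
      then have "h v \<notin> B" using disj by blast
      then show ?thesis using True by simp
    next
      case False
      then show ?thesis using permutes_not_in[OF h(1), of v] by (cases "v \<in> B") auto
    qed
    then show "fst (restrict_id h B, restrict_id h A) \<circ> snd (restrict_id h B, restrict_id h A) = h"
      by (auto simp: fun_eq_iff)
  qed
  show "(\<lambda>p. fst p \<circ> snd p) ` ({\<beta>. \<beta> permutes B} \<times> {\<alpha>. \<alpha> permutes A}) \<subseteq> block_perms A B"
  proof safe
    fix \<beta> \<alpha> assume p: "\<beta> permutes B" "\<alpha> permutes A"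
    have "\<beta> \<circ> \<alpha> permutes A \<union> B"
      by (rule permutes_compose) (rule permutes_subset[OF p(2)], blast, rule permutes_subset[OF p(1)], blast)
    moreover have "\<beta> ` A = A" by (rule permutes_image_disjoint[OF p(1) disj])
    then have "(\<beta> \<circ> \<alpha>) ` A = A" unfolding image_comp[symmetric] permutes_image[OF p(2)] .
    ultimately show "fst (\<beta>, \<alpha>) \<circ> snd (\<beta>, \<alpha>) \<in> block_perms A B" by (simp add: block_perms_def)
  qed
  show "(\<lambda>h. (restrict_id h B, restrict_id h A)) ` block_perms A B \<subseteq> {\<beta>. \<beta> permutes B} \<times> {\<alpha>. \<alpha> permutes A}"
    using bb by (auto simp: block_perms_def intro!: permutes_restrict_id)
qed

lemma card_block_perms:
  assumes "A \<inter> B = {}" "finite A" "finite B"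
  shows "card (block_perms A B) = fact (card A) * fact (card B)"
  using bij_betw_same_card[OF block_perms_bij[OF assms(1)]] assms
  by (simp add: card_cartesian_product card_permutations mult.commute)

text \<open>If the cardinalities agree, these permutations form a coset of the stabiliser of
  \<open>X\<close>.\<close>

lemma card_permutes_onto:
  assumes S: "finite S" and XZ: "X \<subseteq> S" "Z \<subseteq> S"
  shows "card {p. p permutes S \<and> p ` X = Z} =
    (if card X = card Z then fact (card X) * fact (card S - card X) else 0)"
proof (cases "card X = card Z")
  case False
  then have "\<not> (p permutes S \<and> p ` X = Z)" for p using card_permutation_image[of p S X] by auto
  then have "{p. p permutes S \<and> p ` X = Z} = {}" by blast
  then show ?thesis using False by (simp only: card.empty if_False)
next
  case True
  obtain \<sigma> where \<sigma>: "\<sigma> permutes S" "\<sigma> ` X = Z" by (rule permutes_onto[OF S XZ True])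
  have XS: "X \<union> (S - X) = S" using XZ by blast
  have inv1: "inv \<sigma> \<circ> \<sigma> = id" "\<sigma> \<circ> inv \<sigma> = id" by (rule permutes_inv_o[OF \<sigma>(1)])+
  have "bij_betw ((\<circ>) \<sigma>) (block_perms X (S - X)) {p. p permutes S \<and> p ` X = Z}"
  proof (rule bij_betw_byWitness[where f' = "(\<circ>) (inv \<sigma>)"])
    show "\<forall>p\<in>block_perms X (S - X). inv \<sigma> \<circ> (\<sigma> \<circ> p) = p" by (simp add: comp_assoc[symmetric] inv1)
    show "\<forall>p\<in>{p. p permutes S \<and> p ` X = Z}. \<sigma> \<circ> (inv \<sigma> \<circ> p) = p" by (simp add: comp_assoc[symmetric] inv1)
    have bp: "block_perms X (S - X) = {p. p permutes S \<and> p ` X = X}" by (simp only: block_perms_def XS)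
    show "(\<circ>) \<sigma> ` block_perms X (S - X) \<subseteq> {p. p permutes S \<and> p ` X = Z}"
    proof
      fix q assume "q \<in> (\<circ>) \<sigma> ` block_perms X (S - X)"
      then obtain p where p: "p permutes S" "p ` X = X" "q = \<sigma> \<circ> p" unfolding bp by blast
      have "q ` X = Z" unfolding p(3) image_comp[symmetric] p(2) \<sigma>(2) ..
      moreover have "q permutes S" unfolding p(3) by (rule permutes_compose[OF p(1) \<sigma>(1)])
      ultimately show "q \<in> {p. p permutes S \<and> p ` X = Z}" by blast
    qed
    show "(\<circ>) (inv \<sigma>) ` {p. p permutes S \<and> p ` X = Z} \<subseteq> block_perms X (S - X)"
    proof
      fix q assume "q \<in> (\<circ>) (inv \<sigma>) ` {p. p permutes S \<and> p ` X = Z}"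
      then obtain p where p: "p permutes S" "p ` X = Z" "q = inv \<sigma> \<circ> p" by blast
      have "q ` X = X"
        unfolding p(3) image_comp[symmetric] p(2) \<sigma>(2)[symmetric]
        by (rule image_inv_f_f[OF permutes_inj[OF \<sigma>(1)]])
      moreover have "q permutes S" unfolding p(3) by (rule permutes_compose[OF p(1) permutes_inv[OF \<sigma>(1)]])
      ultimately show "q \<in> block_perms X (S - X)" unfolding bp by blast
    qed
  qed
  then have "card {p. p permutes S \<and> p ` X = Z} = card (block_perms X (S - X))"
    by (metis bij_betw_same_card)
  also have "\<dots> = fact (card X) * fact (card (S - X))"
    by (rule card_block_perms) (use S XZ finite_subset in auto)
  also have "card (S - X) = card S - card X" by (rule card_Diff_subset) (use S XZ finite_subset in auto)
  finally show ?thesis unfolding if_P[OF True] .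
qed

lemma card_block_perms_onto:
  assumes disj: "A \<inter> B = {}" and fin: "finite A" "finite B" and XZ: "X \<subseteq> A \<union> B" "Z \<subseteq> A \<union> B"
  shows "card {h \<in> block_perms A B. h ` X = Z} =
    card {p. p permutes B \<and> p ` (X \<inter> B) = Z \<inter> B} * card {p. p permutes A \<and> p ` (X \<inter> A) = Z \<inter> A}"
proof -
  let ?c = "\<lambda>p :: ('a \<Rightarrow> 'a) \<times> ('a \<Rightarrow> 'a). fst p \<circ> snd p"
  let ?S = "{p. p permutes B \<and> p ` (X \<inter> B) = Z \<inter> B} \<times> {p. p permutes A \<and> p ` (X \<inter> A) = Z \<inter> A}"
  have iff: "(\<beta> \<circ> \<alpha>) ` X = Z \<longleftrightarrow> \<beta> ` (X \<inter> B) = Z \<inter> B \<and> \<alpha> ` (X \<inter> A) = Z \<inter> A"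
    if p: "\<beta> permutes B" "\<alpha> permutes A" for \<alpha> \<beta>
  proof -
    have sub: "\<alpha> ` (X \<inter> A) \<subseteq> A" "\<beta> ` (X \<inter> B) \<subseteq> B"
      using permutes_image[OF p(2)] permutes_image[OF p(1)] by blast+
    have "(\<beta> \<circ> \<alpha>) ` (X \<inter> A) = \<alpha> ` (X \<inter> A)"
      unfolding image_comp[symmetric] by (rule permutes_image_disjoint[OF p(1)]) (use sub(1) disj in blast)
    moreover have "(\<beta> \<circ> \<alpha>) ` (X \<inter> B) = \<beta> ` (X \<inter> B)"
    proof (rule image_cong[OF refl])
      fix v assume "v \<in> X \<inter> B"
      then have "\<alpha> v = v" using disj permutes_not_in[OF p(2)] by blast
      then show "(\<beta> \<circ> \<alpha>) v = \<beta> v" by simp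
    qed
    moreover have "X = (X \<inter> A) \<union> (X \<inter> B)" using XZ by blast
    then have "(\<beta> \<circ> \<alpha>) ` X = (\<beta> \<circ> \<alpha>) ` (X \<inter> A) \<union> (\<beta> \<circ> \<alpha>) ` (X \<inter> B)" by (metis image_Un)
    ultimately have eq: "(\<beta> \<circ> \<alpha>) ` X = \<alpha> ` (X \<inter> A) \<union> \<beta> ` (X \<inter> B)" by simp
    have "U \<union> V = Z \<longleftrightarrow> V = Z \<inter> B \<and> U = Z \<inter> A" if UV: "U \<subseteq> A" "V \<subseteq> B" for U V
    proof
      assume "U \<union> V = Z"
      then show "V = Z \<inter> B \<and> U = Z \<inter> A" using UV disj by blast
    next
      assume "V = Z \<inter> B \<and> U = Z \<inter> A"
      then show "U \<union> V = Z" using XZ(2) by blast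
    qed
    from this[OF sub] show ?thesis unfolding eq .
  qed
  have b: "inj_on ?c ({\<beta>. \<beta> permutes B} \<times> {\<alpha>. \<alpha> permutes A})"
    "?c ` ({\<beta>. \<beta> permutes B} \<times> {\<alpha>. \<alpha> permutes A}) = block_perms A B"
    using block_perms_bij[OF disj] by (simp_all add: bij_betw_def)
  have "{h \<in> block_perms A B. h ` X = Z} = ?c ` ?S"
  proof
    show "?c ` ?S \<subseteq> {h \<in> block_perms A B. h ` X = Z}"
    proof
      fix h assume "h \<in> ?c ` ?S"
      then obtain \<beta> \<alpha> where p: "(\<beta>, \<alpha>) \<in> ?S" "h = \<beta> \<circ> \<alpha>" by force
      then have "h ` X = Z" using iff[of \<beta> \<alpha>] by simp
      moreover have "?c (\<beta>, \<alpha>) \<in> block_perms A B" unfolding b(2)[symmetric] by (rule imageI) (use p in simp)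
      ultimately show "h \<in> {h \<in> block_perms A B. h ` X = Z}" using p(2) by simp
    qed
    show "{h \<in> block_perms A B. h ` X = Z} \<subseteq> ?c ` ?S"
    proof
      fix h assume "h \<in> {h \<in> block_perms A B. h ` X = Z}"
      then have h: "h \<in> block_perms A B" "h ` X = Z" by auto
      obtain \<beta> \<alpha> where p: "\<beta> permutes B" "\<alpha> permutes A" "h = \<beta> \<circ> \<alpha>"
        using h(1) unfolding b(2)[symmetric] by auto
      then have mem: "(\<beta>, \<alpha>) \<in> ?S" using iff[OF p(1,2)] h(2) by simp
      show "h \<in> ?c ` ?S" by (rule image_eqI[OF _ mem]) (simp add: p(3))
    qed
  qed
  moreover have "inj_on ?c ?S" by (rule inj_on_subset[OF b(1)]) auto
  ultimately show ?thesis by (simp add: card_image card_cartesian_product)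
qed

lemma asym_asym_disjoint:
  assumes disj: "A \<inter> B = {}" and fin: "finite A" "finite B"
  shows "asym B (asym A x) = (\<lambda>D. \<Sum>h\<in>block_perms A B. of_int (sign h) * vact h x D)"
proof
  fix D
  have "asym B (asym A x) D = (\<Sum>\<beta> | \<beta> permutes B. of_int (sign \<beta>) * vact \<beta> (\<lambda>D. \<Sum>\<alpha> | \<alpha> permutes A. of_int (sign \<alpha>) * vact \<alpha> x D) D)"
    unfolding asym_def ..
  also have "\<dots> = (\<Sum>\<beta> | \<beta> permutes B. \<Sum>\<alpha> | \<alpha> permutes A. of_int (sign (\<beta> \<circ> \<alpha>)) * vact (\<beta> \<circ> \<alpha>) x D)"
    unfolding vact_sum sum_distrib_left
  proof (intro sum.cong refl, simp only: mem_Collect_eq)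
    fix \<beta> \<alpha> assume p: "\<beta> permutes B" "\<alpha> permutes A"
    then have "permutation \<alpha>" "permutation \<beta>" using fin permutation_permutes by blast+
    then show "of_int (sign \<beta>) * (of_int (sign \<alpha>) * vact \<beta> (vact \<alpha> x) D) = of_int (sign (\<beta> \<circ> \<alpha>)) * vact (\<beta> \<circ> \<alpha>) x D"
      by (simp add: sign_compose vact_comp permutes_bij[OF p(1)] permutes_bij[OF p(2)] mult.assoc)
  qed
  also have "\<dots> = (\<Sum>p\<in>{\<beta>. \<beta> permutes B} \<times> {\<alpha>. \<alpha> permutes A}. of_int (sign (fst p \<circ> snd p)) * vact (fst p \<circ> snd p) x D)"
    by (simp only: sum.cartesian_product case_prod_unfold)
  also have "\<dots> = (\<Sum>h\<in>block_perms A B. of_int (sign h) * vact h x D)"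
    by (rule sum.reindex_bij_betw[OF block_perms_bij[OF disj]])
  finally show "asym B (asym A x) D = (\<Sum>h\<in>block_perms A B. of_int (sign h) * vact h x D)" .
qed

lemma asym_vact_disjoint:
  assumes \<tau>: "\<tau> permutes T" "finite T" and S: "finite S" "S \<inter> T = {}"
  shows "asym S (vact \<tau> x) = vact \<tau> (asym S x)"
proof -
  have "permutation \<tau>" using \<tau> permutation_permutes by blast
  moreover have "\<tau> ` S = S" by (rule permutes_image_disjoint[OF \<tau>(1) S(2)])
  ultimately show ?thesis using vact_asym_conj[of \<tau> S x] S(1) by simp
qed

lemma asym_commute:
  assumes "finite S" "finite T" "S \<inter> T = {}"
  shows "asym S (asym T x) = asym T (asym S x)"
proof -
  have "asym S (asym T x) = (\<lambda>D. \<Sum>\<pi> | \<pi> permutes T. of_int (sign \<pi>) * asym S (vact \<pi> x) D)"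
    unfolding asym_def[of T x] by (rule asym_sum)
  also have "\<dots> = asym T (asym S x)"
    unfolding asym_def[of T "asym S x"]
    by (intro ext sum.cong refl) (simp add: asym_vact_disjoint[OF _ assms(2,1,3)])
  finally show ?thesis .
qed

section \<open>The generator as an antisymmetrised diagram\<close>

lemma antisymmetrizer_mult_left:
  assumes "1 \<le> k" "l \<le> r" "x \<in> carrier (brauer_algebra r \<delta>)"
  shows "antisymmetrizer r k l \<otimes>\<^bsub>brauer_algebra r \<delta>\<^esub> x = asym {k..l} x"
  unfolding antisymmetrizer_def brauer_mult_sum_left asym_def
proof (intro ext sum.cong refl, simp only: mem_Collect_eq)
  fix D \<sigma> assume "\<sigma> permutes {k..l}"
  then have "\<sigma> permutes {1..r}" by (rule permutes_subset) (use assms in auto)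
  then show "of_int (sign \<sigma>) * (basis_diagram (perm_diagram r \<sigma>) \<otimes>\<^bsub>brauer_algebra r \<delta>\<^esub> x) D =
    of_int (sign \<sigma>) * vact \<sigma> x D"
    using assms(3) by (simp only: perm_mult_left)
qed

lemma bottom_map_permutation:
  assumes "\<sigma> permutes {k..l}" "1 \<le> k"
  shows "bottom r \<sigma> = map_permutation {k..l} ((+) r) \<sigma>"
proof
  fix v
  show "bottom r \<sigma> v = map_permutation {k..l} ((+) r) \<sigma> v"
  proof (cases "v \<in> (+) r ` {k..l}")
    case True
    then obtain a where a: "v = r + a" "a \<in> {k..l}" by blast
    then show ?thesis using map_permutation_apply[of "(+) r" "{k..l}" a \<sigma>] assms(2) by (auto simp: bottom_def)
  next
    case False
    have "v - r \<notin> {k..l}" if "r < v"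
    proof
      assume "v - r \<in> {k..l}"
      then have "v \<in> (+) r ` {k..l}" using that by (intro image_eqI[of _ _ "v - r"]) auto
      then show False using False by blast
    qed
    then show ?thesis using False permutes_not_in[OF assms(1), of "v - r"]
      by (auto simp: bottom_def map_permutation_def)
  qed
qed

text \<open>Right multiplication by \<open>\<sigma>\<close> acts on the bottom row by the inverse of
  \<open>\<sigma>\<close>, but inversion permutes the summands and preserves signs.\<close>

lemma antisymmetrizer_mult_right:
  assumes "1 \<le> k" "l \<le> r" "x \<in> carrier (brauer_algebra r \<delta>)"
  shows "x \<otimes>\<^bsub>brauer_algebra r \<delta>\<^esub> antisymmetrizer r k l = asym {r + k..r + l} x"
proof
  fix D
  let ?R = "brauer_algebra r \<delta>"
  have "(x \<otimes>\<^bsub>?R\<^esub> antisymmetrizer r k l) D =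
    (\<Sum>\<sigma> | \<sigma> permutes {k..l}. of_int (sign \<sigma>) * (x \<otimes>\<^bsub>?R\<^esub> basis_diagram (perm_diagram r \<sigma>)) D)"
    unfolding antisymmetrizer_def brauer_mult_sum_right ..
  also have "\<dots> = (\<Sum>\<sigma> | \<sigma> permutes {k..l}. of_int (sign (inv \<sigma>)) * vact (bottom r (inv \<sigma>)) x D)"
  proof (intro sum.cong refl, simp only: mem_Collect_eq)
    fix \<sigma> assume p: "\<sigma> permutes {k..l}"
    then have "\<sigma> permutes {1..r}" by (rule permutes_subset) (use assms in auto)
    moreover have "permutation \<sigma>" using p permutation_permutes by blast
    ultimately show "of_int (sign \<sigma>) * (x \<otimes>\<^bsub>?R\<^esub> basis_diagram (perm_diagram r \<sigma>)) D =
      of_int (sign (inv \<sigma>)) * vact (bottom r (inv \<sigma>)) x D"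
      using assms(3) by (simp only: perm_mult_right sign_inverse)
  qed
  also have "\<dots> = (\<Sum>\<sigma> | \<sigma> permutes {k..l}. of_int (sign \<sigma>) * vact (bottom r \<sigma>) x D)"
    by (rule sum_permutations_inverse[symmetric])
  also have "\<dots> = (\<Sum>\<sigma> | \<sigma> permutes {k..l}. of_int (sign (map_permutation {k..l} ((+) r) \<sigma>)) *
      vact (map_permutation {k..l} ((+) r) \<sigma>) x D)"
  proof (intro sum.cong refl, simp only: mem_Collect_eq)
    fix \<sigma> assume p: "\<sigma> permutes {k..l}"
    have "sign (map_permutation {k..l} ((+) r) \<sigma>) = sign \<sigma>" by (rule sign_map_permutation[OF _ p]) auto
    then show "of_int (sign \<sigma>) * vact (bottom r \<sigma>) x D =
      of_int (sign (map_permutation {k..l} ((+) r) \<sigma>)) * vact (map_permutation {k..l} ((+) r) \<sigma>) x D"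
      by (simp only: bottom_map_permutation[OF p assms(1)])
  qed
  also have "\<dots> = asym {r + k..r + l} x D"
  proof -
    have "bij_betw ((+) r) {k..l} {r + k..r + l}" by (simp add: bij_betw_def)
    then have "bij_betw (\<lambda>\<pi> x. if x \<in> {r + k..r + l} then r + \<pi> (inv_into {k..l} ((+) r) x) else x)
      {\<pi>. \<pi> permutes {k..l}} {\<pi>. \<pi> permutes {r + k..r + l}}" by (rule bij_betw_permutations)
    moreover have "(\<lambda>\<pi> x. if x \<in> {r + k..r + l} then r + \<pi> (inv_into {k..l} ((+) r) x) else x) =
      map_permutation {k..l} ((+) r)"
      by (auto simp: map_permutation_def restrict_id_def fun_eq_iff)
    ultimately have b: "bij_betw (map_permutation {k..l} ((+) r))
      {\<pi>. \<pi> permutes {k..l}} {\<pi>. \<pi> permutes {r + k..r + l}}" by (simp only:)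
    show ?thesis unfolding asym_def by (rule sum.reindex_bij_betw[OF b])
  qed
  finally show "(x \<otimes>\<^bsub>?R\<^esub> antisymmetrizer r k l) D = asym {r + k..r + l} x D" .
qed

text \<open>The permutation of vertices that turns the identity into \<open>e\<^sub>i(j)\<close>: it exchanges
  \<open>i - t\<close> with the bottom vertex below \<open>i + t + 1\<close> for \<open>t < j\<close>.\<close>

definition mirror :: "nat \<Rightarrow> nat \<Rightarrow> nat \<Rightarrow> nat \<Rightarrow> nat" where
  "mirror r i j v = (if i - j < v \<and> v \<le> i \<or> r + i < v \<and> v \<le> r + i + j then r + 2 * i + 1 - v else v)"

lemma mirror_mirror: "j \<le> i \<Longrightarrow> i \<le> r \<Longrightarrow> mirror r i j (mirror r i j v) = v"
  by (auto simp: mirror_def)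

lemma mirror_permutes:
  assumes "j \<le> i" "i \<le> r" "i + j \<le> m"
  shows "mirror r i j permutes {1..i} \<union> {r + i + 1..r + m}"
proof (rule inj_imp_permutes)
  show "inj_on (mirror r i j) ({1..i} \<union> {r + i + 1..r + m})"
    by (metis inj_onI mirror_mirror[OF assms(1,2)])
  show "mirror r i j v \<in> {1..i} \<union> {r + i + 1..r + m}" if "v \<in> {1..i} \<union> {r + i + 1..r + m}" for v
    using that assms by (auto simp: mirror_def)
  show "mirror r i j v = v" if "v \<notin> {1..i} \<union> {r + i + 1..r + m}" for v
    using that assms by (auto simp: mirror_def)
qed simp

lemma mirror_Suc:
  assumes "Suc j \<le> i" "i \<le> r"
  shows "mirror r i (Suc j) = vswap (i - j) (r + (i + j + 1)) \<circ> mirror r i j"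
proof
  fix v
  consider "v = i - j" | "v = r + (i + j + 1)" | "v \<noteq> i - j" "v \<noteq> r + (i + j + 1)" by blast
  then show "mirror r i (Suc j) v = (vswap (i - j) (r + (i + j + 1)) \<circ> mirror r i j) v"
    using assms by cases (auto simp: mirror_def Transposition.transpose_def)
qed

lemma sign_mirror:
  assumes "j \<le> i" "i \<le> r"
  shows "sign (mirror r i j) = (- 1) ^ j"
  using assms
proof (induction j)
  case 0
  have "mirror r i 0 = id" by (auto simp: mirror_def)
  then show ?case by simp
next
  case (Suc j)
  have "mirror r i j permutes {1..i} \<union> {r + i + 1..r + (i + j)}"
    by (rule mirror_permutes) (use Suc.prems in auto)
  then have "permutation (mirror r i j)" by (rule permutes_imp_permutation[rotated]) simp
  moreover have "i - j \<noteq> r + (i + j + 1)" using Suc.prems by simp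
  ultimately show ?case
    unfolding mirror_Suc[OF Suc.prems] sign_compose[OF permutation_swap_id \<open>permutation (mirror r i j)\<close>]
    using Suc by (simp add: sign_swap_id)
qed

text \<open>Each new factor contracts two strings that the earlier factors leave vertical.
  \<open>e_diagram_comp_right\<close> is read with the claimed diagram \<open>D\<close> as the
  product: exchanging \<open>c\<close> and \<open>r + d\<close> in \<open>D\<close> gives back the
  diagram of the earlier factors.\<close>

lemma e_prod_mirror:
  assumes "j \<le> i" "i + j \<le> r"
  shows "(e_prod n r i j :: diagram \<Rightarrow> 'a::comm_ring_1) = basis_diagram (dact (mirror r i j) (perm_diagram r id))"
  using assms
proof (induction j)
  case 0
  have "mirror r i 0 = id" by (auto simp: mirror_def)
  then show ?case by (simp only: e_prod.simps brauer_algebra_simps dact_id)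
next
  case (Suc j)
  let ?I = "perm_diagram r id"
  define c d where "c = i - j" and "d = i + j + 1"
  have cd: "d \<in> {1..r}" "c \<in> {1..r}" "d \<noteq> c" using Suc.prems by (auto simp: c_def d_def)
  have ir: "i \<le> r" "Suc j \<le> i" using Suc.prems by auto
  let ?s = "vswap c (r + d)"
  define D where "D = dact (mirror r i (Suc j)) ?I"
  have mp: "mirror r i j permutes {1..2 * r}"
    by (rule permutes_subset[OF mirror_permutes[of j i r "i + j"]]) (use Suc.prems in auto)
  have D0: "dact (mirror r i j) ?I \<in> brauer_diagrams r" by (rule dact_closed[OF id_diagram_closed mp])
  have Ds: "D = dact ?s (dact (mirror r i j) ?I)"
    unfolding D_def mirror_Suc[OF ir(2,1)] dact_comp c_def d_def ..
  have DB: "D \<in> brauer_diagrams r"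
    unfolding Ds by (rule transpose_closed[OF D0]) (use cd in auto)
  have D0s: "dact ?s D = dact (mirror r i j) ?I"
    unfolding Ds dact_comp[symmetric] by (simp only: comp_assoc[symmetric] transpose_comp_involutory id_comp)
  have fx: "mirror r i j d = d" "mirror r i j (r + d) = r + d" "mirror r i j c = c" "mirror r i j (r + c) = r + c"
    using Suc.prems by (auto simp: mirror_def c_def d_def)
  have edge: "{r + d, r + c} \<in> D"
  proof -
    have "{c, r + c} \<in> ?I" using cd by (auto simp: perm_diagram_def)
    then have "?s ` mirror r i j ` {c, r + c} \<in> D" unfolding Ds dact_def by (intro imageI)
    moreover have "?s ` mirror r i j ` {c, r + c} = {r + d, r + c}"
      using cd fx by (auto simp: Transposition.transpose_def)
    ultimately show ?thesis by simp
  qed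
  have y: "c \<in> {1..2 * r}" "c \<noteq> r + d" "c \<noteq> r + c" using cd by auto
  have comm: "e_diagram r c d = e_diagram r d c" by (auto simp: e_diagram_def insert_commute)
  have IH: "(e_prod n r i j :: diagram \<Rightarrow> 'a) = basis_diagram (dact (mirror r i j) ?I)"
    by (rule Suc.IH) (use Suc.prems in auto)
  note prod = e_diagram_comp_right[OF DB cd edge y, unfolded D0s]
  have "(e_prod n r i (Suc j) :: diagram \<Rightarrow> 'a) = basis_diagram (dact (mirror r i j) ?I) \<otimes>\<^bsub>brauer_algebra r (of_nat n)\<^esub> basis_diagram (e_diagram r d c)"
    unfolding e_prod.simps IH c_def[symmetric] d_def[symmetric] comm ..
  also have "\<dots> = basis_diagram D"
    unfolding basis_mult_basis[OF D0 e_diagram_closed[OF cd]] prod by simp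
  finally show ?case unfolding D_def .
qed

text \<open>The double coset of \<open>\<pi>\<close> under the Young subgroup is determined by the
  number \<open>j0\<close> of points of the second block that \<open>\<pi>\<close> sends into the
  first, and \<open>mirror r i j\<close> represents the one with \<open>j0 = j\<close>. In a
  factorisation \<open>g \<circ> mirror r i j \<circ> h = \<pi>\<close> the factor \<open>h\<close>
  determines \<open>g\<close>, and it is admissible iff it maps \<open>X\<close> onto
  \<open>Z\<close>. For \<open>j = j0\<close> this leaves \<open>j! (m - i - j)!\<close> choices on
  the second block and \<open>(i - j)! j!\<close> on the first; for \<open>m = n + 1\<close> their
  product is the reciprocal of \<open>c_coeff n i j\<close>.\<close>

lemma block_factorisations:
  assumes ij: "2 * i \<le> m" "i \<le> r" and \<pi>: "\<pi> permutes {1..i} \<union> {r + i + 1..r + m}"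
  defines "Y \<equiv> block_perms {1..i} {r + i + 1..r + m}"
  shows "(\<Sum>j = 0..i. inverse (fact (i - j) * fact (m - i - j) * (fact j)\<^sup>2) *
    of_nat (card {p \<in> Y \<times> Y. fst p \<circ> mirror r i j \<circ> snd p = \<pi>})) = (1 :: rat)"
proof -
  let ?A = "{1..i}" and ?B = "{r + i + 1..r + m}"
  have disj: "?A \<inter> ?B = {}" using ij by auto
  define X where "X = inv \<pi> ` ?A"
  define j0 where "j0 = card (X \<inter> ?B)"
  have \<pi>': "inv \<pi> permutes ?A \<union> ?B" by (rule permutes_inv[OF \<pi>])
  have XJ: "X \<subseteq> ?A \<union> ?B" unfolding X_def using permutes_image[OF \<pi>'] by blast
  have cX: "card X = i" unfolding X_def card_permutation_image[OF \<pi>'] by simp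
  have "X = (X \<inter> ?A) \<union> (X \<inter> ?B)" using XJ by blast
  then have "card X = card ((X \<inter> ?A) \<union> (X \<inter> ?B))" by (rule arg_cong)
  also have "\<dots> = card (X \<inter> ?A) + card (X \<inter> ?B)" by (rule card_Un_disjoint) (use disj in auto)
  finally have cXA: "card (X \<inter> ?A) + j0 = i" using cX by (simp add: j0_def)
  have count: "card {p \<in> Y \<times> Y. fst p \<circ> mirror r i j \<circ> snd p = \<pi>} =
     (if j = j0 then fact (i - j) * fact (m - i - j) * (fact j)\<^sup>2 else 0)" if j: "j \<le> i" for j
  proof -
    let ?t = "mirror r i j"
    define Z where "Z = ?t ` ?A"
    have t: "?t permutes ?A \<union> ?B" by (rule mirror_permutes[OF j ij(2)]) (use ij j in simp)
    have tt: "?t (?t v) = v" for v by (rule mirror_mirror[OF j ij(2)])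
    have Z: "Z \<inter> ?A = {1..i - j}" "Z \<inter> ?B = {r + i + 1..r + i + j}"
    proof -
      have mem: "v \<in> Z \<longleftrightarrow> ?t v \<in> ?A" for v unfolding Z_def using tt by (metis image_iff)
      have "v \<in> Z \<longleftrightarrow> v \<in> {1..i - j} \<or> v \<in> {r + i + 1..r + i + j}" for v
      proof -
        consider "i - j < v \<and> v \<le> i \<or> r + i < v \<and> v \<le> r + i + j" "?t v = r + 2 * i + 1 - v"
          | "\<not> (i - j < v \<and> v \<le> i \<or> r + i < v \<and> v \<le> r + i + j)" "?t v = v"
          by (metis mirror_def)
        then show ?thesis unfolding mem atLeastAtMost_iff by cases (use ij j in linarith)+
      qed
      then have "Z = {1..i - j} \<union> {r + i + 1..r + i + j}" by blast
      moreover have "{1..i - j} \<subseteq> ?A" "{r + i + 1..r + i + j} \<subseteq> ?B" using ij j by auto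
      ultimately show "Z \<inter> ?A = {1..i - j}" "Z \<inter> ?B = {r + i + 1..r + i + j}"
        using disj by blast+
    qed
    have ZJ: "Z \<subseteq> ?A \<union> ?B" unfolding Z_def using permutes_image[OF t] by blast
    have "bij_betw snd {p \<in> Y \<times> Y. fst p \<circ> ?t \<circ> snd p = \<pi>} {h \<in> Y. h ` X = Z}"
    proof (rule bij_betw_byWitness[where f' = "\<lambda>h. (\<pi> \<circ> inv h \<circ> ?t, h)"])
      have det: "g = \<pi> \<circ> inv h \<circ> ?t" if "h \<in> Y" "g \<circ> ?t \<circ> h = \<pi>" for g h
      proof -
        have "h permutes ?A \<union> ?B" using that(1) by (simp add: Y_def block_perms_def)
        then have "h (inv h v) = v" for v by (rule permutes_inverses(1))
        then show ?thesis unfolding that(2)[symmetric] by (auto simp: fun_eq_iff tt)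
      qed
      show "\<forall>p\<in>{p \<in> Y \<times> Y. fst p \<circ> ?t \<circ> snd p = \<pi>}. (\<pi> \<circ> inv (snd p) \<circ> ?t, snd p) = p"
        using det by (auto simp: prod_eq_iff)
      show "\<forall>h\<in>{h \<in> Y. h ` X = Z}. snd (\<pi> \<circ> inv h \<circ> ?t, h) = h" by simp
      show "snd ` {p \<in> Y \<times> Y. fst p \<circ> ?t \<circ> snd p = \<pi>} \<subseteq> {h \<in> Y. h ` X = Z}"
      proof
        fix h assume "h \<in> snd ` {p \<in> Y \<times> Y. fst p \<circ> ?t \<circ> snd p = \<pi>}"
        then obtain g where gh: "g \<in> Y" "h \<in> Y" "g \<circ> ?t \<circ> h = \<pi>" by auto
        have g: "g permutes ?A \<union> ?B" "g ` ?A = ?A" using gh(1) by (auto simp: Y_def block_perms_def)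
        have "\<pi> ` X = ?A" unfolding X_def using permutes_surj[OF \<pi>] by (simp add: image_f_inv_f)
        then have "g ` ?t ` h ` X = g ` ?A" unfolding g(2) gh(3)[symmetric] image_comp[symmetric] .
        then have "?t ` h ` X = ?A" using permutes_inj[OF g(1)] by (simp only: inj_image_eq_iff)
        then have "Z = ?t ` ?t ` h ` X" unfolding Z_def by (simp only:)
        also have "\<dots> = h ` X" by (simp add: image_image tt)
        finally show "h \<in> {h \<in> Y. h ` X = Z}" using gh(2) by simp
      qed
      show "(\<lambda>h. (\<pi> \<circ> inv h \<circ> ?t, h)) ` {h \<in> Y. h ` X = Z} \<subseteq> {p \<in> Y \<times> Y. fst p \<circ> ?t \<circ> snd p = \<pi>}"
      proof
        fix p assume "p \<in> (\<lambda>h. (\<pi> \<circ> inv h \<circ> ?t, h)) ` {h \<in> Y. h ` X = Z}"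
        then obtain h where h: "h \<in> Y" "h ` X = Z" "p = (\<pi> \<circ> inv h \<circ> ?t, h)" by blast
        have hp: "h permutes ?A \<union> ?B" using h(1) by (simp add: Y_def block_perms_def)
        have "\<pi> \<circ> inv h \<circ> ?t permutes ?A \<union> ?B"
          by (intro permutes_compose t permutes_inv hp \<pi>)
        moreover have "(\<pi> \<circ> inv h \<circ> ?t) ` ?A = ?A"
        proof -
          have "inv h ` Z = X" unfolding h(2)[symmetric] by (rule image_inv_f_f[OF permutes_inj[OF hp]])
          then have "(\<pi> \<circ> inv h \<circ> ?t) ` ?A = \<pi> ` X" unfolding image_comp[symmetric] Z_def[symmetric] by simp
          also have "\<dots> = ?A" unfolding X_def using permutes_surj[OF \<pi>] by (simp add: image_f_inv_f)
          finally show ?thesis .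
        qed
        ultimately have "\<pi> \<circ> inv h \<circ> ?t \<in> Y" by (simp add: Y_def block_perms_def)
        moreover have "\<pi> \<circ> inv h \<circ> ?t \<circ> ?t \<circ> h = \<pi>"
          using permutes_inverses(2)[OF hp] by (auto simp: fun_eq_iff tt)
        ultimately show "p \<in> {p \<in> Y \<times> Y. fst p \<circ> ?t \<circ> snd p = \<pi>}" using h by simp
      qed
    qed
    then have "card {p \<in> Y \<times> Y. fst p \<circ> ?t \<circ> snd p = \<pi>} = card {h \<in> Y. h ` X = Z}"
      by (rule bij_betw_same_card)
    also have "\<dots> = card {p. p permutes ?B \<and> p ` (X \<inter> ?B) = Z \<inter> ?B} * card {p. p permutes ?A \<and> p ` (X \<inter> ?A) = Z \<inter> ?A}"
      unfolding Y_def by (rule card_block_perms_onto[OF disj _ _ XJ ZJ]) auto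
    also have "\<dots> = (if j0 = j then fact j0 * fact (m - i - j0) else 0) *
      (if card (X \<inter> ?A) = i - j then fact (card (X \<inter> ?A)) * fact (i - card (X \<inter> ?A)) else 0)"
    proof -
      have c: "card (Z \<inter> ?B) = j" "card (Z \<inter> ?A) = i - j" "card ?B = m - i" "card ?A = i"
        unfolding Z by simp_all
      show ?thesis
        unfolding card_permutes_onto[OF finite_atLeastAtMost Int_lower2 Int_lower2] j0_def[symmetric] c ..
    qed
    also have "\<dots> = (if j = j0 then fact (i - j) * fact (m - i - j) * (fact j)\<^sup>2 else 0)"
    proof (cases "j = j0")
      case True
      then have "card (X \<inter> ?A) = i - j" "i - (i - j) = j" using cXA j by auto
      then show ?thesis using True by (simp add: power2_eq_square mult_ac)
    qed simp
    finally show ?thesis .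
  qed
  have "(\<Sum>j = 0..i. inverse (fact (i - j) * fact (m - i - j) * (fact j)\<^sup>2) *
    of_nat (card {p \<in> Y \<times> Y. fst p \<circ> mirror r i j \<circ> snd p = \<pi>})) = (\<Sum>j = 0..i. if j = j0 then 1 else 0 :: rat)"
  proof (intro sum.cong refl)
    fix j assume "j \<in> {0..i}"
    then have "card {p \<in> Y \<times> Y. fst p \<circ> mirror r i j \<circ> snd p = \<pi>} =
     (if j = j0 then fact (i - j) * fact (m - i - j) * (fact j)\<^sup>2 else 0)" using count by simp
    then have c: "of_nat (card {p \<in> Y \<times> Y. fst p \<circ> mirror r i j \<circ> snd p = \<pi>}) =
      (if j = j0 then fact (i - j) * fact (m - i - j) * (fact j)\<^sup>2 else 0 :: rat)"
      by (simp only: if_distrib[of of_nat] of_nat_mult of_nat_fact of_nat_power of_nat_0)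
    have "fact (i - j) * fact (m - i - j) * (fact j)\<^sup>2 \<noteq> (0 :: rat)" by simp
    then show "inverse (fact (i - j) * fact (m - i - j) * (fact j)\<^sup>2) *
      of_nat (card {p \<in> Y \<times> Y. fst p \<circ> mirror r i j \<circ> snd p = \<pi>}) = (if j = j0 then 1 else 0 :: rat)"
      unfolding c by (cases "j = j0") (simp_all only: if_True if_False left_inverse mult_zero_right not_False_eq_True simp_thms)
  qed
  also have "\<dots> = 1" using cXA by simp
  finally show ?thesis .
qed

text \<open>The left factor \<open>F\<close> antisymmetrises over two intervals of the top row, the
  right one over two of the bottom row. \<open>?A'\<close> and \<open>?B'\<close> are disjoint from
  \<open>A \<union> B\<close>, within which \<open>mirror r i j\<close> moves points, so
  antisymmetrising over them can be pushed through to the identity diagram; there it may be replaced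
  by antisymmetrising over the opposite sets \<open>A\<close> and \<open>B\<close>.\<close>

lemma F_e_F:
  assumes ij: "j \<le> i" "2 * i \<le> n + 1" "n + 1 \<le> r"
  defines "A \<equiv> {1..i}" and "B \<equiv> {r + i + 1..r + n + 1}" and "b \<equiv> basis_diagram (perm_diagram r id)"
  shows "F_elem n r i \<otimes>\<^bsub>brauer_algebra r (of_nat n)\<^esub> e_prod n r i j \<otimes>\<^bsub>brauer_algebra r (of_nat n)\<^esub> F_elem n r i =
    asym B (asym A (vact (mirror r i j) (asym B (asym A b))))"
proof -
  let ?R = "brauer_algebra r (of_nat n)" and ?I = "perm_diagram r id"
  let ?A' = "{r + 1..r + i}" and ?B' = "{i + 1..n + 1}" and ?t = "mirror r i j"
  have ir: "i \<le> r" "i + j \<le> r" using ij by auto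
  have t: "?t permutes A \<union> B"
    using mirror_permutes[OF ij(1) ir(1), of "n + 1"] ij by (simp add: A_def B_def)
  have finAB: "finite (A \<union> B)" by (simp add: A_def B_def)
  have fin: "finite A" "finite B" by (simp_all add: A_def B_def)
  have subs: "A \<subseteq> {1..2 * r}" "B \<subseteq> {1..2 * r}" "?A' \<subseteq> {1..2 * r}" "?B' \<subseteq> {1..2 * r}"
    using ij by (auto simp: A_def B_def)
  have bc: "b \<in> carrier ?R" unfolding b_def by (rule basis_closed[OF id_diagram_closed])
  have ec: "e_prod n r i j = vact ?t b"
    unfolding b_def e_prod_mirror[OF ij(1) ir(2)] vact_basis[OF permutes_bij[OF t]] ..
  have tV: "?t permutes {1..2 * r}" by (rule permutes_subset[OF t]) (use subs in blast)
  have xc: "vact ?t b \<in> carrier ?R" by (rule vact_closed[OF tV bc])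
  define x where "x = asym A (asym ?B' (vact ?t b))"
  have bx: "asym ?B' (vact ?t b) \<in> carrier ?R" by (rule asym_closed[OF subs(4) xc])
  have xcl: "x \<in> carrier ?R" unfolding x_def by (rule asym_closed[OF subs(1) bx])
  have left: "F_elem n r i \<otimes>\<^bsub>?R\<^esub> e_prod n r i j = x"
    unfolding F_elem_def brauer_mult_assoc ec x_def A_def
    using ij by (simp only: antisymmetrizer_mult_left[OF _ _ xc] antisymmetrizer_mult_left[OF _ _ bx] le_add2 ir order_refl)
  have ax: "asym ?A' x \<in> carrier ?R" by (rule asym_closed[OF subs(3) xcl])
  have right: "x \<otimes>\<^bsub>?R\<^esub> F_elem n r i = asym B (asym ?A' x)"
    unfolding F_elem_def brauer_mult_assoc[symmetric] B_def
    using ij by (simp only: antisymmetrizer_mult_right[OF _ _ xcl] antisymmetrizer_mult_right[OF _ _ ax] le_add2 ir order_refl add.assoc)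
  have d: "?A' \<inter> A = {}" "?B' \<inter> (A \<union> B) = {}" "?A' \<inter> (A \<union> B) = {}" "A \<inter> B = {}" "?A' \<inter> B = {}"
    using ij by (auto simp: A_def B_def)
  have pA: "partner ?I ` A = ?A'"
  proof -
    have "partner ?I ` A = (\<lambda>v. r + v) ` {1..i}"
      unfolding A_def by (intro image_cong refl) (use ir in \<open>simp add: partner_id_diagram\<close>)
    then show ?thesis by simp
  qed
  have pB: "partner ?I ` B = ?B'"
  proof -
    have e: "B = (+) r ` ?B'" unfolding B_def by (simp add: add.assoc)
    have "partner ?I ` B = (\<lambda>v. partner ?I (r + v)) ` ?B'" unfolding e image_image ..
    also have "\<dots> = (\<lambda>v. v) ` ?B'" by (intro image_cong refl) (use ij in \<open>simp add: partner_id_diagram\<close>)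
    finally show ?thesis by simp
  qed
  have sA: "asym ?A' b = asym A b"
    unfolding b_def pA[symmetric] by (rule asym_partner[OF id_diagram_closed subs(1)]) (use pA d in auto)
  have sB: "asym ?B' b = asym B b"
    unfolding b_def pB[symmetric] by (rule asym_partner[OF id_diagram_closed subs(2)]) (use pB d in auto)
  have "asym ?A' x = asym A (asym ?A' (asym ?B' (vact ?t b)))"
    unfolding x_def by (rule asym_commute) (use fin d in auto)
  also have "asym ?A' (asym ?B' (vact ?t b)) = vact ?t (asym ?A' (asym ?B' b))"
    by (subst asym_vact_disjoint[OF t finAB _ d(2)], simp, subst asym_vact_disjoint[OF t finAB _ d(3)]) simp_all
  also have "asym ?A' (asym ?B' b) = asym B (asym A b)"
    unfolding sB asym_commute[OF finite_atLeastAtMost fin(2) d(5)] sA ..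
  finally show ?thesis unfolding left right by simp
qed

text \<open>When the \<open>j\<close>-th summand is expanded over pairs \<open>(g, h)\<close> from
  the Young subgroup, the sign of \<open>mirror r i j\<close> cancels the factor
  \<open>(- 1) ^ j\<close>. So every permutation of the vertex set occurs with its own sign, as
  often as it factorises, and \<open>block_factorisations\<close> says that the coefficients turn
  these multiplicities into 1.\<close>

theorem E_elem_eq_asym:
  assumes i: "2 * i \<le> n + 1" and r: "n + 1 \<le> r"
  shows "E_elem n r i = (asym ({1..i} \<union> {r + i + 1..r + n + 1}) (basis_diagram (perm_diagram r id)) :: diagram \<Rightarrow> 'a::comm_ring_1)"
proof -
  let ?A = "{1..i}" and ?B = "{r + i + 1..r + n + 1}"
  let ?J = "?A \<union> ?B" and ?I = "perm_diagram r id"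
  let ?b = "basis_diagram ?I :: diagram \<Rightarrow> rat"
  define Y where "Y = block_perms ?A ?B"
  have ir: "i \<le> r" using assms by simp
  have disj: "?A \<inter> ?B = {}" using ir by auto
  have finY: "finite Y"
    unfolding Y_def block_perms_def by (rule finite_subset[OF _ finite_permutations[of ?J]]) auto
  have Yp: "h permutes ?J" if "h \<in> Y" for h using that by (simp add: Y_def block_perms_def)
  have rat: "E_elem_rat n r i D = asym ?J ?b D" for D
  proof -
    define f where "f \<pi> = of_int (sign \<pi>) * vact \<pi> ?b D" for \<pi>
    let ?c = "c_coeff n i" and ?t = "mirror r i"
    have summand: "(- 1) ^ j * ?c j * (F_elem n r i \<otimes>\<^bsub>brauer_algebra r (of_nat n)\<^esub> e_prod n r i j
        \<otimes>\<^bsub>brauer_algebra r (of_nat n)\<^esub> F_elem n r i) D =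
      (\<Sum>\<pi> | \<pi> permutes ?J. ?c j * of_nat (card {p \<in> Y \<times> Y. fst p \<circ> ?t j \<circ> snd p = \<pi>}) * f \<pi>)" if j: "j \<in> {0..i}" for j
    proof -
      have ji: "j \<le> i" using j by simp
      have tp: "?t j permutes ?J"
        using mirror_permutes[OF ji ir, of "n + 1"] i ji by simp
      have per: "permutation h" if "h permutes ?J" for h by (rule permutes_imp_permutation[OF _ that]) simp
      have "(F_elem n r i \<otimes>\<^bsub>brauer_algebra r (of_nat n)\<^esub> e_prod n r i j \<otimes>\<^bsub>brauer_algebra r (of_nat n)\<^esub> F_elem n r i) D =
        (\<Sum>g\<in>Y. of_int (sign g) * vact g (vact (?t j) (\<lambda>D. \<Sum>h\<in>Y. of_int (sign h) * vact h ?b D)) D)"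
        unfolding F_e_F[OF ji i r] asym_asym_disjoint[OF disj finite_atLeastAtMost finite_atLeastAtMost] Y_def ..
      also have "\<dots> = (\<Sum>g\<in>Y. \<Sum>h\<in>Y. (- 1) ^ j * f (g \<circ> ?t j \<circ> h))"
        unfolding vact_sum sum_distrib_left
      proof (intro sum.cong refl)
        fix g h assume gh: "g \<in> Y" "h \<in> Y"
        note p = Yp[OF gh(1)] Yp[OF gh(2)]
        have "sign (g \<circ> ?t j \<circ> h) = sign g * (- 1) ^ j * sign h"
          using per[OF p(1)] per[OF p(2)] per[OF tp] sign_mirror[OF ji ir]
          by (simp add: sign_compose permutation_compose)
        moreover have "vact (g \<circ> ?t j \<circ> h) ?b = vact g (vact (?t j) (vact h ?b))"
          using permutes_bij[OF p(1)] permutes_bij[OF p(2)] permutes_bij[OF tp]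
          by (simp add: vact_comp bij_comp)
        moreover have "(- 1 :: rat) ^ j * (- 1) ^ j = 1" by (simp add: power_mult_distrib[symmetric])
        ultimately show "of_int (sign g) * (of_int (sign h) * vact g (vact (?t j) (vact h ?b)) D) =
          (- 1) ^ j * f (g \<circ> ?t j \<circ> h)" by (simp add: f_def mult_ac)
      qed
      also have "\<dots> = (- 1) ^ j * (\<Sum>p\<in>Y \<times> Y. f (fst p \<circ> ?t j \<circ> snd p))"
        by (simp only: sum.cartesian_product case_prod_unfold sum_distrib_left)
      also have "(\<Sum>p\<in>Y \<times> Y. f (fst p \<circ> ?t j \<circ> snd p)) =
        (\<Sum>\<pi> | \<pi> permutes ?J. \<Sum>p | p \<in> Y \<times> Y \<and> fst p \<circ> ?t j \<circ> snd p = \<pi>. f (fst p \<circ> ?t j \<circ> snd p))"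
      proof (rule sum.group[symmetric])
        show "(\<lambda>p. fst p \<circ> ?t j \<circ> snd p) ` (Y \<times> Y) \<subseteq> {\<pi>. \<pi> permutes ?J}"
          using Yp tp by (auto intro!: permutes_compose)
      qed (use finY in \<open>auto intro: finite_permutations\<close>)
      also have "\<dots> = (\<Sum>\<pi> | \<pi> permutes ?J. of_nat (card {p \<in> Y \<times> Y. fst p \<circ> ?t j \<circ> snd p = \<pi>}) * f \<pi>)"
        by (intro sum.cong refl) simp
      finally have "(F_elem n r i \<otimes>\<^bsub>brauer_algebra r (of_nat n)\<^esub> e_prod n r i j \<otimes>\<^bsub>brauer_algebra r (of_nat n)\<^esub> F_elem n r i) D =
        (- 1) ^ j * (\<Sum>\<pi> | \<pi> permutes ?J. of_nat (card {p \<in> Y \<times> Y. fst p \<circ> ?t j \<circ> snd p = \<pi>}) * f \<pi>)" .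
      moreover have "(- 1 :: rat) ^ j * a * ((- 1) ^ j * s) = a * s" for a s
      proof -
        have "(- 1 :: rat) ^ j * (- 1) ^ j = 1" by (simp add: power_mult_distrib[symmetric])
        then show ?thesis by (simp add: mult_ac)
      qed
      ultimately show ?thesis by (simp only: sum_distrib_left mult.assoc)
    qed
    have "E_elem_rat n r i D =
      (\<Sum>j = 0..i. \<Sum>\<pi> | \<pi> permutes ?J. ?c j * of_nat (card {p \<in> Y \<times> Y. fst p \<circ> ?t j \<circ> snd p = \<pi>}) * f \<pi>)"
      unfolding E_elem_rat_def by (intro sum.cong refl summand)
    also have "\<dots> = (\<Sum>\<pi> | \<pi> permutes ?J. (\<Sum>j = 0..i. ?c j * of_nat (card {p \<in> Y \<times> Y. fst p \<circ> ?t j \<circ> snd p = \<pi>})) * f \<pi>)"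
      unfolding sum_distrib_right by (rule sum.swap)
    also have "\<dots> = (\<Sum>\<pi> | \<pi> permutes ?J. f \<pi>)"
    proof (intro sum.cong refl, simp only: mem_Collect_eq)
      fix \<pi> assume p: "\<pi> permutes ?J"
      have "(\<Sum>j = 0..i. ?c j * of_nat (card {p \<in> Y \<times> Y. fst p \<circ> ?t j \<circ> snd p = \<pi>})) = 1"
        using block_factorisations[of i "n + 1" r \<pi>] i ir p by (simp add: c_coeff_def Y_def)
      then show "(\<Sum>j = 0..i. ?c j * of_nat (card {p \<in> Y \<times> Y. fst p \<circ> ?t j \<circ> snd p = \<pi>})) * f \<pi> = f \<pi>" by simp
    qed
    finally show ?thesis by (simp add: f_def asym_def)
  qed
  show ?thesis
  proof
    fix D
    \<comment> \<open>The coefficients of the antisymmetrisation are integers, so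
      \<open>floor\<close> loses nothing and the identity carries over from the rationals to every
      coefficient ring.\<close>
    define z where "z = (\<Sum>\<pi> | \<pi> permutes ?J. sign \<pi> * (if D = dact \<pi> ?I then 1 else 0))"
    have "asym ?J ?b D = of_int z"
      unfolding asym_basis z_def of_int_sum by (intro sum.cong refl) (simp add: basis_diagram_def)
    moreover have "asym ?J (basis_diagram ?I) D = (of_int z :: 'a)"
      unfolding asym_basis z_def of_int_sum by (intro sum.cong refl) (simp add: basis_diagram_def)
    ultimately show "E_elem n r i D = (asym ?J (basis_diagram ?I) D :: 'a)"
      by (simp add: E_elem_def rat)
  qed
qed

section \<open>The Brauer homomorphism on diagrams\<close>

text \<open>This reduces the action of all contractions to that of \<open>e_diagram r 1 2\<close>.
  Conjugation renames both rows by \<open>\<sigma>\<close>, which fixes the identity diagram and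
  turns the transposition of \<open>2\<close> and \<open>r + 1\<close> from
  \<open>e_diagram_dact\<close> into that of \<open>\<sigma> 2\<close> and
  \<open>r + \<sigma> 1\<close>.\<close>

lemma e_diagram_conj:
  assumes \<sigma>: "\<sigma> permutes {1..r}" and r: "2 \<le> r"
  shows "e_diagram r (\<sigma> 1) (\<sigma> 2) =
    diagram_comp r (diagram_comp r (perm_diagram r \<sigma>) (e_diagram r 1 2)) (perm_diagram r (inv \<sigma>))"
    and "loop_count r (diagram_comp r (perm_diagram r \<sigma>) (e_diagram r 1 2)) (perm_diagram r (inv \<sigma>)) = 0"
proof -
  let ?I = "perm_diagram r id"
  note \<sigma>' = permutes_inv[OF \<sigma>]
  have e: "e_diagram r 1 2 \<in> brauer_diagrams r" by (rule e_diagram_closed) (use r in auto)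
  have c1: "diagram_comp r (perm_diagram r \<sigma>) (e_diagram r 1 2) = dact \<sigma> (e_diagram r 1 2)"
    by (rule perm_diagram_comp_left(1)[OF \<sigma> e])
  have cl: "dact \<sigma> (e_diagram r 1 2) \<in> brauer_diagrams r" by (rule dact_closed[OF e permutes_le[OF \<sigma>]])
  show "loop_count r (diagram_comp r (perm_diagram r \<sigma>) (e_diagram r 1 2)) (perm_diagram r (inv \<sigma>)) = 0"
    unfolding c1 by (rule perm_diagram_comp_right(2)[OF \<sigma>' cl])
  have c2: "diagram_comp r (dact \<sigma> (e_diagram r 1 2)) (perm_diagram r (inv \<sigma>)) = dact (bottom r \<sigma>) (dact \<sigma> (e_diagram r 1 2))"
    using perm_diagram_comp_right(1)[OF \<sigma>' cl] unfolding permutes_inv_inv[OF \<sigma>] .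
  let ?g = "\<sigma> \<circ> bottom r \<sigma>" and ?g' = "bottom r \<sigma> \<circ> \<sigma>"
  have in_: "\<sigma> v \<in> {1..r}" if "v \<in> {1..r}" for v using that permutes_in_image[OF \<sigma>] by blast
  have out: "\<sigma> v = v" if "v \<notin> {1..r}" for v using that permutes_not_in[OF \<sigma>] by blast
  have pos: "\<sigma> x \<noteq> 0" if "x \<noteq> 0" for x
    using out[of 0] permutes_inj[OF \<sigma>] that by (metis inj_eq atLeastAtMost_iff not_one_le_zero)
  have gg: "?g' v = ?g v" for v
  proof (cases "v \<in> {1..r}")
    case True
    then show ?thesis using in_[OF True] by (simp add: bottom_def)
  next
    case False
    show ?thesis
    proof (cases "r < v")
      case True
      have "\<sigma> (r + \<sigma> (v - r)) = r + \<sigma> (v - r)" by (rule out) (use pos[of "v - r"] True in auto)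
      then show ?thesis using True out[OF False] by (simp add: bottom_def)
    qed (use out[OF False] in \<open>simp add: bottom_def\<close>)
  qed
  have inj: "inj ?g'"
    by (intro inj_compose permutes_inj[OF \<sigma>] permutes_inj[OF bottom_permutes[OF \<sigma>]])
  have g2: "?g' 2 = \<sigma> 2" using in_[of 2] r by (simp add: bottom_def)
  have g1: "?g' (r + 1) = r + \<sigma> 1" using out[of "r + 1"] by (simp add: bottom_def)
  have "?g' \<circ> vswap 2 (r + 1) = vswap (\<sigma> 2) (r + \<sigma> 1) \<circ> ?g'"
  proof
    fix v
    have "?g' v = \<sigma> 2 \<longleftrightarrow> v = 2" "?g' v = r + \<sigma> 1 \<longleftrightarrow> v = r + 1" 
      using inj g1 g2 by (metis inj_eq)+
    then show "(?g' \<circ> vswap 2 (r + 1)) v = (vswap (\<sigma> 2) (r + \<sigma> 1) \<circ> ?g') v"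
      using g1 g2 unfolding comp_apply Transposition.transpose_def by (simp del: One_nat_def)
  qed
  then have sw: "bottom r \<sigma> \<circ> (\<sigma> \<circ> vswap 2 (r + 1)) = vswap (\<sigma> 2) (r + \<sigma> 1) \<circ> ?g'"
    by (simp only: comp_assoc)
  have "dact (bottom r \<sigma>) (dact \<sigma> (e_diagram r 1 2)) = dact (bottom r \<sigma> \<circ> (\<sigma> \<circ> vswap 2 (r + 1))) ?I"
    by (subst e_diagram_dact) (use r in \<open>simp_all add: dact_comp\<close>)
  also have "\<dots> = dact (vswap (\<sigma> 2) (r + \<sigma> 1)) (dact ?g' ?I)" unfolding sw dact_comp ..
  also have "dact ?g' ?I = dact ?g ?I" using gg by (metis ext)
  also have "\<dots> = dact \<sigma> (dact (inv \<sigma>) ?I)" unfolding dact_comp dact_bottom_id_diagram[OF \<sigma>] ..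
  also have "\<dots> = ?I" by (rule dact_inverse(2)[OF permutes_bij[OF \<sigma>]])
  also have "dact (vswap (\<sigma> 2) (r + \<sigma> 1)) ?I = e_diagram r (\<sigma> 1) (\<sigma> 2)"
  proof (rule e_diagram_dact[symmetric])
    show "\<sigma> 1 \<in> {1..r}" "\<sigma> 2 \<in> {1..r}" by (rule in_, use r in simp)+
    show "\<sigma> 1 \<noteq> \<sigma> 2" using permutes_inj[OF \<sigma>] by (simp add: inj_eq)
  qed
  finally show "e_diagram r (\<sigma> 1) (\<sigma> 2) =
    diagram_comp r (diagram_comp r (perm_diagram r \<sigma>) (e_diagram r 1 2)) (perm_diagram r (inv \<sigma>))"
    unfolding c1 c2 by simp
qed

lemma horizontal_free_perm:
  assumes D: "D \<in> brauer_diagrams r" and "\<And>v. v \<in> {r + 1..2 * r} \<Longrightarrow> partner D v \<le> r"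
  obtains \<sigma> where "\<sigma> permutes {1..r}" "D = perm_diagram r \<sigma>"
proof -
  let ?q = "partner D" and ?T = "{1..r}" and ?B = "{r + 1..2 * r}"
  have inj: "inj_on ?q ?B" by (rule inj_on_subset[OF permutes_inj[OF partner_permutes[OF D]]]) simp
  have sub: "?q ` ?B \<subseteq> ?T"
  proof
    fix w assume "w \<in> ?q ` ?B"
    then obtain v where v: "v \<in> ?B" "w = ?q v" by blast
    then have "w \<in> {1..2 * r}" using partner_props(3)[OF D, of v] by simp
    then show "w \<in> ?T" using assms(2)[OF v(1)] v(2) by simp
  qed
  have "card (?q ` ?B) = card ?T" unfolding card_image[OF inj] by simp
  then have eq: "?q ` ?B = ?T" by (rule card_subset_eq[OF finite_atLeastAtMost sub])
  have vert: "v \<le> r \<longleftrightarrow> r < ?q v" if v: "v \<in> {1..2 * r}" for v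
  proof (cases "v \<le> r")
    case True
    then have "v \<in> ?q ` ?B" using v eq by simp
    then obtain w where w: "w \<in> ?B" "v = ?q w" by blast
    then have "?q v = w" using partner_partner[OF D] by simp
    then show ?thesis using w True by simp
  next
    case False
    then have "?q v \<le> r" using assms(2)[of v] v by simp
    then show ?thesis using False by simp
  qed
  show ?thesis using all_vertical_diagram[OF D vert] that by blast
qed

text \<open>Permutations and loop-free products with contractions generate all diagrams: an edge
  \<open>{u, w}\<close> within the bottom row is broken by exchanging \<open>u\<close> with an end
  point \<open>y\<close> of an edge within the top row, which exists because both rows have
  \<open>r\<close> vertices.\<close>

lemma brauer_diagram_induct [consumes 1, case_names perm contract]:
  assumes D: "D \<in> brauer_diagrams r"
    and perm: "\<And>\<sigma>. \<sigma> permutes {1..r} \<Longrightarrow> Q (perm_diagram r \<sigma>)"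
    and contract: "\<And>D c d. D \<in> brauer_diagrams r \<Longrightarrow> Q D \<Longrightarrow> c \<in> {1..r} \<Longrightarrow> d \<in> {1..r} \<Longrightarrow> c \<noteq> d \<Longrightarrow>
      loop_count r D (e_diagram r c d) = 0 \<Longrightarrow> Q (diagram_comp r D (e_diagram r c d))"
  shows "Q D"
  using D
proof (induction "card {v \<in> {r + 1..2 * r}. r < partner D v}" arbitrary: D rule: less_induct)
  case less
  let ?q = "partner D" and ?T = "{1..r}" and ?B = "{r + 1..2 * r}" and ?V = "{1..2 * r}"
  let ?H = "\<lambda>D. {v \<in> ?B. r < partner D v}"
  note D = less.prems
  have qq: "?q (?q v) = v" for v by (rule partner_partner[OF D])
  show ?case
  proof (cases "?H D = {}")
    case True
    have le: "?q v \<le> r" if "v \<in> ?B" for v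
    proof (rule ccontr)
      assume "\<not> ?q v \<le> r"
      then have "v \<in> ?H D" using that by simp
      then show False unfolding True by blast
    qed
    obtain \<sigma> where "\<sigma> permutes {1..r}" "D = perm_diagram r \<sigma>" by (rule horizontal_free_perm[OF D le])
    then show ?thesis using perm by simp
  next
    case False
    then obtain u where u: "u \<in> ?B" "r < ?q u" by blast
    define w where "w = ?q u"
    have uV: "u \<in> ?V" using u by simp
    have w: "w \<in> ?B" "w \<noteq> u" "?q w = u"
      using u partner_props(2,3)[OF D uV] by (auto simp: w_def qq)
    have wV: "w \<in> ?V" using w by simp
    have "\<exists>y\<in>?T. ?q y \<le> r"
    proof (rule ccontr)
      assume no: "\<not> (\<exists>y\<in>?T. ?q y \<le> r)"
      have "?q ` ?T \<subseteq> ?B - {u}"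
      proof
        fix z assume "z \<in> ?q ` ?T"
        then obtain v where v: "v \<in> ?T" "z = ?q v" by blast
        have "z \<in> ?V" unfolding v(2) by (rule partner_props(3)[OF D]) (use v in simp)
        moreover have "r < z" using no v by force
        moreover have "z \<noteq> u"
        proof
          assume "z = u"
          then have "v = w" using v(2) qq w_def by metis
          then show False using v(1) w(1) by simp
        qed
        ultimately show "z \<in> ?B - {u}" by simp
      qed
      then have "card (?q ` ?T) \<le> card (?B - {u})" by (intro card_mono) auto
      moreover have "card (?q ` ?T) = r" using card_permutation_image[OF partner_permutes[OF D], of ?T] by simp
      moreover have "card (?B - {u}) < card ?B" using u(1) by (intro card_Diff1_less) auto
      ultimately show False by simp
    qed
    then obtain y where y: "y \<in> ?T" "?q y \<le> r" by blast
    have yV: "y \<in> ?V" and yu: "y \<noteq> u" "y \<noteq> w" using y(1) u(1) w(1) by auto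
    let ?t = "vswap y u"
    let ?D = "dact ?t D"
    have t: "?t permutes ?V" by (intro permutes_swap_id yV uV)
    have D': "?D \<in> brauer_diagrams r" by (rule dact_closed[OF D t])
    have q': "partner ?D (?t v) = ?t (?q v)" if "v \<in> ?V" for v by (rule partner_dact[OF D t that])
    have qy: "?q y \<noteq> u" "?q y \<noteq> y" using qq w yu partner_props(2)[OF D yV] by metis+
    have qu: "partner ?D u = ?q y" using q'[OF yV] qy by simp
    have "?H ?D \<subset> ?H D"
    proof
      show "?H ?D \<subseteq> ?H D"
      proof
        fix v assume v: "v \<in> ?H ?D"
        then have vV: "v \<in> ?V" "v \<noteq> y" using y(1) by auto
        have vu: "v \<noteq> u" using v qu y(2) by auto
        have "?t (?q v) = partner ?D v" using q'[OF vV(1)] vV(2) vu by simp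
        then have "r < ?t (?q v)" using v by simp
        moreover have "?q v \<noteq> y"
        proof
          assume "?q v = y"
          then have "v = ?q y" using qq by metis
          then show False using y(2) v by simp
        qed
        ultimately have "r < ?q v" using u y(1) by (auto simp: Transposition.transpose_def split: if_splits)
        then show "v \<in> ?H D" using v by simp
      qed
      have "u \<in> ?H D" using u by simp
      moreover have "u \<notin> ?H ?D" using qu y(2) by simp
      ultimately show "?H ?D \<noteq> ?H D" by blast
    qed
    then have "card (?H ?D) < card (?H D)" by (intro psubset_card_mono) auto
    then have "Q ?D" by (rule less.hyps[OF _ D'])
    define c d where "c = u - r" and "d = w - r"
    have cd: "c \<in> ?T" "d \<in> ?T" "c \<noteq> d" and uw: "u = r + c" "w = r + d"
      using u(1) w(1,2) by (auto simp: c_def d_def)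
    have "{r + c, r + d} \<in> D" unfolding uw[symmetric] w_def by (rule partner_props(1)[OF D uV])
    from e_diagram_comp_right[OF D cd this yV yu[unfolded uw]]
    have "diagram_comp r ?D (e_diagram r c d) = D" "loop_count r ?D (e_diagram r c d) = 0" unfolding uw .
    then show ?thesis using contract[OF D' \<open>Q ?D\<close> cd] by simp
  qed
qed

section \<open>Tensor space and the matrices of diagrams\<close>

lemma pure_tensor_cong:
  assumes "\<And>i. i \<in> {1..r} \<Longrightarrow> v i = v' i"
  shows "pure_tensor r v = pure_tensor r v'"
  unfolding pure_tensor_def using assms by (auto intro!: prod.cong)

lemma pure_tensor_closed: "pure_tensor r v \<in> tensor_space r"
  by (simp add: tensor_space_def pure_tensor_def)

lemma tensor_space_sum:
  assumes "\<And>a. a \<in> A \<Longrightarrow> X a \<in> tensor_space r"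
  shows "(\<lambda>t. \<Sum>a\<in>A. c a * X a t) \<in> tensor_space r"
  using assms by (auto simp: tensor_space_def intro!: sum.neutral)

lemma tensor_linear_sum:
  fixes T :: "('k::field, 'n) tensor \<Rightarrow> ('k, 'n) tensor"
  assumes T: "tensor_linear r T" and X: "\<And>a. a \<in> A \<Longrightarrow> X a \<in> tensor_space r"
    and fin: "finite A"
  shows "T (\<lambda>t. \<Sum>a\<in>A. c a * X a t) = (\<lambda>t. \<Sum>a\<in>A. c a * T (X a) t)"
  using fin X
proof (induction A)
  case empty
  have "(\<lambda>t. 0) \<in> tensor_space r" by (simp add: tensor_space_def)
  from T[unfolded tensor_linear_def, THEN conjunct2, rule_format, OF this, of 0] show ?case by simp
next
  case (insert a A)
  have "(\<lambda>t. c a * X a t) \<in> tensor_space r" using insert.prems[of a] by (simp add: tensor_space_def)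
  moreover have "(\<lambda>t. \<Sum>a\<in>A. c a * X a t) \<in> tensor_space r" by (rule tensor_space_sum) (use insert.prems in auto)
  ultimately have "T (\<lambda>t. c a * X a t + (\<Sum>a\<in>A. c a * X a t)) =
     (\<lambda>t. T (\<lambda>t. c a * X a t) t + T (\<lambda>t. \<Sum>a\<in>A. c a * X a t) t)"
    using T unfolding tensor_linear_def by (elim conjE) (drule bspec, assumption, drule bspec, assumption, simp)
  moreover have "T (\<lambda>t. c a * X a t) = (\<lambda>t. c a * T (X a) t)"
    using T insert.prems[of a] unfolding tensor_linear_def by blast
  ultimately show ?case using insert by simp
qed

locale brauer_hom_setup =
  fixes r :: nat and B :: "'k::field ^ 'n::finite \<Rightarrow> 'k ^ 'n \<Rightarrow> 'k" and b :: "'n \<Rightarrow> 'k ^ 'n"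
    and \<nu> :: "(diagram \<Rightarrow> 'k) \<Rightarrow> ('k, 'n) tensor \<Rightarrow> ('k, 'n) tensor"
  assumes form: "symmetric_bilinear_form B" and onb: "orthonormal_basis B b"
    and hom: "brauer_homomorphism r B b \<nu>"
begin

abbreviation btensor :: "(nat \<Rightarrow> 'n) \<Rightarrow> ('k, 'n) tensor" where
  "btensor g \<equiv> pure_tensor r (\<lambda>i. b (g i))"

abbreviation indices :: "(nat \<Rightarrow> 'n) set" where
  "indices \<equiv> multi_indices r"

lemma ring_hom: "\<nu> \<in> ring_hom (brauer_algebra r (of_nat CARD('n) :: 'k)) (equivariant_End r B)"
  using hom by (simp add: brauer_homomorphism_def)

lemma equivariant_End_simps:
  "x \<otimes>\<^bsub>equivariant_End r B\<^esub> y = compose (tensor_space r) x y"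
  "x \<oplus>\<^bsub>equivariant_End r B\<^esub> y = (\<lambda>t\<in>tensor_space r. \<lambda>f. x t f + y t f)"
  "c \<odot>\<^bsub>equivariant_End r B\<^esub> x = (\<lambda>t\<in>tensor_space r. \<lambda>f. c * x t f)"
  "\<zero>\<^bsub>equivariant_End r B\<^esub> = (\<lambda>t\<in>tensor_space r. \<lambda>f. 0)"
  by (simp_all add: equivariant_End_def tensor_End_def)

lemma nu_closed:
  assumes "x \<in> carrier (brauer_algebra r (of_nat CARD('n) :: 'k))"
  shows "tensor_linear r (\<nu> x)" "\<nu> x \<in> tensor_space r \<rightarrow>\<^sub>E tensor_space r"
  using ring_hom_closed[OF ring_hom assms] by (auto simp: equivariant_End_def tensor_End_def)

lemma nu_mult:
  assumes "x \<in> carrier (brauer_algebra r (of_nat CARD('n) :: 'k))" "y \<in> carrier (brauer_algebra r (of_nat CARD('n) :: 'k))" "t \<in> tensor_space r"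
  shows "\<nu> (x \<otimes>\<^bsub>brauer_algebra r (of_nat CARD('n) :: 'k)\<^esub> y) t = \<nu> x (\<nu> y t)"
  using ring_hom_mult[OF ring_hom assms(1,2)] assms(3) by (simp add: equivariant_End_simps compose_def)

lemma nu_add:
  assumes "x \<in> carrier (brauer_algebra r (of_nat CARD('n) :: 'k))" "y \<in> carrier (brauer_algebra r (of_nat CARD('n) :: 'k))" "t \<in> tensor_space r"
  shows "\<nu> (\<lambda>D. x D + y D) t = (\<lambda>f. \<nu> x t f + \<nu> y t f)"
  using ring_hom_add[OF ring_hom assms(1,2)] assms(3) by (simp add: equivariant_End_simps)

lemma nu_scale:
  assumes "x \<in> carrier (brauer_algebra r (of_nat CARD('n) :: 'k))" "t \<in> tensor_space r"
  shows "\<nu> (\<lambda>D. c * x D) t = (\<lambda>f. c * \<nu> x t f)"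
proof -
  have "\<nu> (c \<odot>\<^bsub>brauer_algebra r (of_nat CARD('n) :: 'k)\<^esub> x) = c \<odot>\<^bsub>equivariant_End r B\<^esub> \<nu> x"
    using hom assms(1) unfolding brauer_homomorphism_def by blast
  then show ?thesis using assms(2) by (simp add: equivariant_End_simps)
qed

text \<open>In an orthonormal basis the matrix entries of a diagram are 0 and 1; the colours of the
  top row index the image, those of the bottom row the argument.\<close>

definition acts :: "diagram \<Rightarrow> bool" where
  "acts D \<longleftrightarrow> (\<forall>g. \<nu> (basis_diagram D) (btensor g) =
     (\<lambda>t. \<Sum>f\<in>indices. of_bool (compat (join r f g) D) * btensor f t))"

text \<open>Composing operators multiplies their matrices, and \<open>sum_middle_colourings\<close>
  evaluates the product. Without loops the product of the two basis elements is again a basis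
  element.\<close>

lemma acts_comp:
  assumes D: "D\<^sub>1 \<in> brauer_diagrams r" "D\<^sub>2 \<in> brauer_diagrams r"
    and acts: "acts D\<^sub>1" "acts D\<^sub>2" and loops: "loop_count r D\<^sub>1 D\<^sub>2 = 0"
  shows "acts (diagram_comp r D\<^sub>1 D\<^sub>2)"
  unfolding acts_def
proof
  fix g
  let ?m = "\<lambda>D f g. of_bool (compat (join r f g) D) :: 'k"
  have c: "basis_diagram D\<^sub>1 \<in> carrier (brauer_algebra r (of_nat CARD('n) :: 'k))" "basis_diagram D\<^sub>2 \<in> carrier (brauer_algebra r (of_nat CARD('n) :: 'k))" using basis_closed D by blast+
  have "basis_diagram (diagram_comp r D\<^sub>1 D\<^sub>2) = basis_diagram D\<^sub>1 \<otimes>\<^bsub>brauer_algebra r (of_nat CARD('n) :: 'k)\<^esub> basis_diagram D\<^sub>2"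
    unfolding basis_mult_basis[OF D] by (simp add: loops)
  then have "\<nu> (basis_diagram (diagram_comp r D\<^sub>1 D\<^sub>2)) (btensor g) = \<nu> (basis_diagram D\<^sub>1) (\<nu> (basis_diagram D\<^sub>2) (btensor g))"
    using nu_mult[OF c pure_tensor_closed] by simp
  also have "\<dots> = \<nu> (basis_diagram D\<^sub>1) (\<lambda>t. \<Sum>k\<in>indices. ?m D\<^sub>2 k g * btensor k t)"
    using acts(2) unfolding acts_def by simp
  also have "\<dots> = (\<lambda>t. \<Sum>k\<in>indices. ?m D\<^sub>2 k g * \<nu> (basis_diagram D\<^sub>1) (btensor k) t)"
    by (rule tensor_linear_sum[OF nu_closed(1)[OF c(1)] pure_tensor_closed]) simp
  also have "\<dots> = (\<lambda>t. \<Sum>k\<in>indices. \<Sum>f\<in>indices. (?m D\<^sub>1 f k * ?m D\<^sub>2 k g) * btensor f t)"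
    using acts(1) unfolding acts_def by (simp only: sum_distrib_left mult_ac)
  also have "\<dots> = (\<lambda>t. \<Sum>f\<in>indices. (\<Sum>k\<in>indices. ?m D\<^sub>1 f k * ?m D\<^sub>2 k g) * btensor f t)"
    unfolding sum_distrib_right by (intro ext) (rule sum.swap)
  also have "\<dots> = (\<lambda>t. \<Sum>f\<in>indices. ?m (diagram_comp r D\<^sub>1 D\<^sub>2) f g * btensor f t)"
    unfolding sum_middle_colourings[OF D] loops by simp
  finally show "\<nu> (basis_diagram (diagram_comp r D\<^sub>1 D\<^sub>2)) (btensor g) =
     (\<lambda>t. \<Sum>f\<in>indices. ?m (diagram_comp r D\<^sub>1 D\<^sub>2) f g * btensor f t)" .
qed

lemma acts_perm:
  assumes \<sigma>: "\<sigma> permutes {1..r}"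
  shows "acts (perm_diagram r \<sigma>)"
  unfolding acts_def
proof
  fix g :: "nat \<Rightarrow> 'n"
  let ?f = "restrict (g \<circ> inv \<sigma>) {1..r}"
  have in_: "\<sigma> i \<in> {1..r} \<longleftrightarrow> i \<in> {1..r}" for i by (rule permutes_in_image[OF \<sigma>])
  have in': "inv \<sigma> i \<in> {1..r} \<longleftrightarrow> i \<in> {1..r}" for i by (rule permutes_in_image[OF permutes_inv[OF \<sigma>]])
  have iff: "compat (join r f g) (perm_diagram r \<sigma>) \<longleftrightarrow> f = ?f" if f: "f \<in> indices" for f
  proof -
    have "compat (join r f g) (perm_diagram r \<sigma>) \<longleftrightarrow> (\<forall>i\<in>{1..r}. f (\<sigma> i) = g i)"
      unfolding compat_perm_diagram using in_ by (intro ball_cong refl) (auto simp: join_def)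
    also have "\<dots> \<longleftrightarrow> (\<forall>i\<in>{1..r}. f i = g (inv \<sigma> i))"
      using in_ in' permutes_inverses[OF \<sigma>] by metis
    also have "\<dots> \<longleftrightarrow> f = ?f" using f
      by (auto simp: fun_eq_iff multi_indices_def PiE_def extensional_def)
    finally show ?thesis .
  qed
  have "\<nu> (basis_diagram (perm_diagram r \<sigma>)) (btensor g) = btensor (\<lambda>i. g (inv \<sigma> i))"
    using hom \<sigma> unfolding brauer_homomorphism_def by blast
  also have "\<dots> = btensor ?f" by (rule pure_tensor_cong) simp
  also have "\<dots> = (\<lambda>t. \<Sum>f\<in>indices. of_bool (compat (join r f g) (perm_diagram r \<sigma>)) * btensor f t)"
  proof
    fix t
    have mem: "?f \<in> indices" by (auto simp: multi_indices_def)
    have "(\<Sum>f\<in>indices. of_bool (compat (join r f g) (perm_diagram r \<sigma>)) * btensor f t) =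
      (\<Sum>f\<in>indices. if f = ?f then btensor f t else 0)"
      by (intro sum.cong refl) (simp add: iff)
    also have "\<dots> = btensor ?f t" using mem by (subst sum.delta) simp_all
    finally show "btensor ?f t = (\<Sum>f\<in>indices. of_bool (compat (join r f g) (perm_diagram r \<sigma>)) * btensor f t)" ..
  qed
  finally show "\<nu> (basis_diagram (perm_diagram r \<sigma>)) (btensor g) =
    (\<lambda>t. \<Sum>f\<in>indices. of_bool (compat (join r f g) (perm_diagram r \<sigma>)) * btensor f t)" .
qed

text \<open>Compatible \<open>f\<close> exist only if \<open>g 1 = g 2\<close>, the condition for
  the form to be 1 rather than 0 on the two basis vectors. They then form the family
  \<open>?F k\<close>, one for each summand in the prescribed action.\<close>

lemma acts_e12:
  assumes r: "2 \<le> r"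
  shows "acts (e_diagram r 1 2)"
  unfolding acts_def
proof
  fix g :: "nat \<Rightarrow> 'n"
  let ?F = "\<lambda>k. restrict (g(1 := k, 2 := k)) {1..r}"
  have orth: "B (b i) (b j) = (if i = j then 1 else 0)" for i j
    using onb unfolding orthonormal_basis_def by blast
  have "\<forall>i v. 1 \<le> i \<and> i < r \<longrightarrow> \<nu> (basis_diagram (e_diagram r i (i + 1))) (pure_tensor r v) =
     (\<lambda>f. B (v i) (v (i + 1)) * (\<Sum>k\<in>UNIV. pure_tensor r (v(i := b k, i + 1 := b k)) f))"
    using hom unfolding brauer_homomorphism_def by blast
  then have "\<nu> (basis_diagram (e_diagram r 1 (1 + 1))) (btensor g) =
     (\<lambda>t. B (b (g 1)) (b (g (1 + 1))) * (\<Sum>k\<in>UNIV. pure_tensor r ((\<lambda>i. b (g i))(1 := b k, 1 + 1 := b k)) t))"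
    using r by (elim allE[of _ 1] allE) simp
  then have "\<nu> (basis_diagram (e_diagram r 1 2)) (btensor g) =
     (\<lambda>t. B (b (g 1)) (b (g 2)) * (\<Sum>k\<in>UNIV. pure_tensor r ((\<lambda>i. b (g i))(1 := b k, 2 := b k)) t))"
    unfolding one_add_one .
  also have "\<dots> = (\<lambda>t. of_bool (g 1 = g 2) * (\<Sum>k\<in>UNIV. btensor (?F k) t))"
  proof
    fix t
    have "pure_tensor r ((\<lambda>i. b (g i))(1 := b k, 2 := b k)) = btensor (?F k)" for k
      by (rule pure_tensor_cong) auto
    then show "B (b (g 1)) (b (g 2)) * (\<Sum>k\<in>UNIV. pure_tensor r ((\<lambda>i. b (g i))(1 := b k, 2 := b k)) t) =
      of_bool (g 1 = g 2) * (\<Sum>k\<in>UNIV. btensor (?F k) t)" by (simp add: orth)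
  qed
  also have "\<dots> = (\<lambda>t. \<Sum>f\<in>indices. of_bool (compat (join r f g) (e_diagram r 1 2)) * btensor f t)"
  proof
    fix t
    have iff: "compat (join r f g) (e_diagram r 1 2) \<longleftrightarrow> g 1 = g 2 \<and> f \<in> range ?F" if f: "f \<in> indices" for f
    proof -
      have "compat (join r f g) (e_diagram r 1 2) \<longleftrightarrow>
        f 1 = f 2 \<and> g 1 = g 2 \<and> (\<forall>k\<in>{1..r} - {1, 2}. f k = g k)"
        unfolding compat_e_diagram using r by (auto simp: join_def)
      also have "\<dots> \<longleftrightarrow> g 1 = g 2 \<and> f \<in> range ?F"
      proof
        assume h: "f 1 = f 2 \<and> g 1 = g 2 \<and> (\<forall>k\<in>{1..r} - {1, 2}. f k = g k)"
        have "f v = ?F (f 1) v" for v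
        proof (cases "v \<in> {1..r}")
          case True
          then show ?thesis using h by (cases "v = 1 \<or> v = 2") auto
        next
          case False
          then show ?thesis using f by (auto simp: multi_indices_def PiE_def extensional_def)
        qed
        then have "f = ?F (f 1)" by blast
        then show "g 1 = g 2 \<and> f \<in> range ?F" using h by blast
      next
        assume "g 1 = g 2 \<and> f \<in> range ?F"
        then show "f 1 = f 2 \<and> g 1 = g 2 \<and> (\<forall>k\<in>{1..r} - {1, 2}. f k = g k)"
          using r by (auto split: if_splits)
      qed
      finally show ?thesis .
    qed
    have sub: "range ?F \<subseteq> indices" by (auto simp: multi_indices_def)
    have inj: "inj ?F"
    proof (rule injI)
      fix a c assume "?F a = ?F c"
      then have "?F a 1 = ?F c 1" by metis
      then show "a = c" using r by (simp split: if_splits)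
    qed
    have "(\<Sum>f\<in>indices. of_bool (compat (join r f g) (e_diagram r 1 2)) * btensor f t) =
      (\<Sum>f\<in>indices. of_bool (g 1 = g 2) * (if f \<in> range ?F then btensor f t else 0))"
    proof (intro sum.cong refl)
      fix f assume f: "f \<in> indices"
      show "of_bool (compat (join r f g) (e_diagram r 1 2)) * btensor f t =
        of_bool (g 1 = g 2) * (if f \<in> range ?F then btensor f t else 0)"
        unfolding iff[OF f] by simp
    qed
    also have "\<dots> = of_bool (g 1 = g 2) * (\<Sum>f\<in>range ?F. btensor f t)"
      unfolding sum_distrib_left[symmetric]
      by (subst sum.inter_restrict[symmetric]) (use sub in \<open>simp_all add: Int_absorb1\<close>)
    also have "(\<Sum>f\<in>range ?F. btensor f t) = (\<Sum>k\<in>UNIV. btensor (?F k) t)"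
      by (rule sum.reindex[OF inj, unfolded comp_def])
    finally show "of_bool (g 1 = g 2) * (\<Sum>k\<in>UNIV. btensor (?F k) t) =
      (\<Sum>f\<in>indices. of_bool (compat (join r f g) (e_diagram r 1 2)) * btensor f t)" ..
  qed
  finally show "\<nu> (basis_diagram (e_diagram r 1 2)) (btensor g) =
    (\<lambda>t. \<Sum>f\<in>indices. of_bool (compat (join r f g) (e_diagram r 1 2)) * btensor f t)" .
qed

lemma acts_e:
  assumes cd: "c \<in> {1..r}" "d \<in> {1..r}" "c \<noteq> d"
  shows "acts (e_diagram r c d)"
proof -
  have r: "2 \<le> r" using cd by auto
  obtain \<sigma> where \<sigma>: "\<sigma> permutes {1..r}" "\<And>a. a \<in> {1, 2} \<Longrightarrow> \<sigma> a = (if a = 1 then c else d)"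
    by (rule permutes_extend[of "{1..r}" "\<lambda>a. if a = 1 then c else d" "{1, 2}"]) (use cd r in auto)
  then have s: "\<sigma> 1 = c" "\<sigma> 2 = d" by auto
  have e: "e_diagram r 1 2 \<in> brauer_diagrams r" by (rule e_diagram_closed) (use r in auto)
  have "acts (diagram_comp r (perm_diagram r \<sigma>) (e_diagram r 1 2))"
    by (rule acts_comp[OF perm_diagram_closed[OF \<sigma>(1)] e acts_perm[OF \<sigma>(1)] acts_e12[OF r]
        perm_diagram_comp_left(2)[OF \<sigma>(1) e]])
  then have "acts (diagram_comp r (diagram_comp r (perm_diagram r \<sigma>) (e_diagram r 1 2)) (perm_diagram r (inv \<sigma>)))"
    by (rule acts_comp[OF diagram_comp_closed[OF perm_diagram_closed[OF \<sigma>(1)] e]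
        perm_diagram_closed[OF permutes_inv[OF \<sigma>(1)]] _ acts_perm[OF permutes_inv[OF \<sigma>(1)]]
        e_diagram_conj(2)[OF \<sigma>(1) r]])
  then show ?thesis using e_diagram_conj(1)[OF \<sigma>(1) r] s by simp
qed

lemma acts_all: "D \<in> brauer_diagrams r \<Longrightarrow> acts D"
proof (induction rule: brauer_diagram_induct)
  case (perm \<sigma>)
  then show ?case by (rule acts_perm)
next
  case (contract D c d)
  then show ?case by (intro acts_comp acts_e e_diagram_closed)
qed

text \<open>Additivity and homogeneity of \<open>\<nu>\<close> are used to build up \<open>x\<close>
  from its coefficients, one diagram at a time.\<close>

lemma nu_btensor:
  assumes x: "x \<in> carrier (brauer_algebra r (of_nat CARD('n) :: 'k))"
  shows "\<nu> x (btensor g) = (\<lambda>t. \<Sum>f\<in>indices. ev r x (join r f g) * btensor f t)"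
proof -
  let ?x = "\<lambda>S D. if D \<in> S then x D else 0"
  let ?m = "\<lambda>D f. of_bool (compat (join r f g) D) :: 'k"
  have sub: "\<nu> (?x S) (btensor g) = (\<lambda>t. \<Sum>f\<in>indices. (\<Sum>D\<in>S. x D * ?m D f) * btensor f t)"
    if "finite S" "S \<subseteq> brauer_diagrams r" for S
    using that
  proof (induction S)
    case empty
    have "?x {} = (\<lambda>D. 0 * basis_diagram (perm_diagram r id) D)" by simp
    then show ?case
      using nu_scale[OF basis_closed[OF id_diagram_closed] pure_tensor_closed, of 0 "\<lambda>i. b (g i)"] by simp
  next
    case (insert E S)
    have E: "E \<in> brauer_diagrams r" using insert.prems by simp
    have c: "(\<lambda>D. x E * basis_diagram E D) \<in> carrier (brauer_algebra r (of_nat CARD('n) :: 'k))" "?x S \<in> carrier (brauer_algebra r (of_nat CARD('n) :: 'k))"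
      using basis_closed[OF E, of "of_nat CARD('n) :: 'k"] x by auto
    have "?x (insert E S) = (\<lambda>D. x E * basis_diagram E D + ?x S D)"
      using insert.hyps(2) by (auto simp: basis_diagram_def fun_eq_iff)
    then have "\<nu> (?x (insert E S)) (btensor g) =
      (\<lambda>t. \<nu> (\<lambda>D. x E * basis_diagram E D) (btensor g) t + \<nu> (?x S) (btensor g) t)"
      using nu_add[OF c pure_tensor_closed] by simp
    also have "\<nu> (\<lambda>D. x E * basis_diagram E D) (btensor g) = (\<lambda>t. x E * \<nu> (basis_diagram E) (btensor g) t)"
      by (rule nu_scale[OF basis_closed[OF E] pure_tensor_closed])
    also have "\<nu> (basis_diagram E) (btensor g) = (\<lambda>t. \<Sum>f\<in>indices. ?m E f * btensor f t)"
      using acts_all[OF E] unfolding acts_def by blast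
    also have "\<nu> (?x S) (btensor g) = (\<lambda>t. \<Sum>f\<in>indices. (\<Sum>D\<in>S. x D * ?m D f) * btensor f t)"
      using insert by simp
    finally show ?case
      by (simp only: sum.insert[OF insert.hyps(1,2)] distrib_right sum.distrib sum_distrib_left mult.assoc)
  qed
  have "x = ?x (brauer_diagrams r)" using x by (auto simp: fun_eq_iff)
  then show ?thesis using sub[OF finite_brauer_diagrams subset_refl] unfolding ev_def by metis
qed

lemma B_expand_left: "B v w = (\<Sum>k\<in>UNIV. v $ k * B (axis k 1) w)"
proof -
  have "Vector_Spaces.linear (*s) (*) (B w)" and sym: "B v w = B w v" "\<And>k. B (axis k 1) w = B w (axis k 1)"
    using form by (auto simp: symmetric_bilinear_form_def)
  then interpret Vector_Spaces.linear "(*s)" "(*)" "B w" by blast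
  have "B w v = B w (\<Sum>k\<in>UNIV. v $ k *s axis k 1)" by (simp only: basis_expansion)
  also have "\<dots> = (\<Sum>k\<in>UNIV. v $ k * B w (axis k 1))" by (simp only: sum scale)
  finally show ?thesis by (simp only: sym)
qed

text \<open>The coordinate functional dual to \<open>btensor f\<close>: by orthonormality, pairing
  each factor with \<open>b (f i)\<close> extracts coordinates. It supplies the linear independence
  of the basis tensors.\<close>

definition coeff_at :: "(nat \<Rightarrow> 'n) \<Rightarrow> ('k, 'n) tensor \<Rightarrow> 'k" where
  "coeff_at f t = (\<Sum>h\<in>indices. t h * (\<Prod>i = 1..r. B (axis (h i) 1) (b (f i))))"

lemma coeff_at_btensor:
  assumes "f \<in> indices" "g \<in> indices"
  shows "coeff_at f (btensor g) = of_bool (g = f)"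
proof -
  have orth: "B (b i) (b j) = (if i = j then 1 else 0)" for i j
    using onb unfolding orthonormal_basis_def by blast
  have "coeff_at f (btensor g) = (\<Sum>h\<in>indices. \<Prod>i = 1..r. b (g i) $ h i * B (axis (h i) 1) (b (f i)))"
    unfolding coeff_at_def by (intro sum.cong refl) (simp add: pure_tensor_def prod.distrib)
  also have "\<dots> = (\<Prod>i = 1..r. \<Sum>k\<in>UNIV. b (g i) $ k * B (axis k 1) (b (f i)))"
    unfolding multi_indices_def by (rule prod_sum_PiE[symmetric]) auto
  also have "\<dots> = (\<Prod>i = 1..r. of_bool (g i = f i))"
    by (intro prod.cong refl) (simp add: B_expand_left[symmetric] orth)
  also have "\<dots> = of_bool (g = f)"
  proof (cases "g = f")
    case False
    then obtain i where i: "g i \<noteq> f i" by blast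
    then have "i \<in> {1..r}" using assms by (metis multi_indices_def PiE_arb)
    then have "(\<Prod>i = 1..r. of_bool (g i = f i)) = (0 :: 'k)" using i by (intro prod_zero) auto
    then show ?thesis using False by simp
  qed simp
  finally show ?thesis .
qed

text \<open>Expanding each standard basis vector in the basis \<open>b\<close>, factor by factor,
  shows that the basis tensors span.\<close>

lemma tensor_expand:
  assumes t: "t \<in> tensor_space r"
  obtains a where "t = (\<lambda>s. \<Sum>f\<in>indices. a f * btensor f s)"
proof -
  have inj: "inj b" and span: "vec.span (range b) = UNIV" using onb by (auto simp: orthonormal_basis_def)
  have "\<exists>c. axis k 1 = (\<Sum>j\<in>UNIV. c j *s b j)" for k
  proof -
    have "axis k 1 \<in> vec.span (range b)" unfolding span by simp
    then obtain u where "axis k 1 = (\<Sum>v\<in>range b. u v *s v)" using vec.span_finite[of "range b"] by auto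
    also have "\<dots> = (\<Sum>j\<in>UNIV. u (b j) *s b j)" by (rule sum.reindex[OF inj, unfolded comp_def])
    finally show ?thesis by (rule exI[of _ "\<lambda>j. u (b j)"])
  qed
  then obtain C where C: "axis k 1 = (\<Sum>j\<in>UNIV. C k j *s b j)" for k by metis
  have ax: "(if s = k then 1 else 0) = (\<Sum>j\<in>UNIV. C k j * b j $ s)" for k s
  proof -
    have "axis k (1 :: 'k) $ s = (\<Sum>j\<in>UNIV. C k j *s b j) $ s" unfolding C[of k] ..
    then show ?thesis by (simp add: axis_def)
  qed
  define a where "a f = (\<Sum>h\<in>indices. t h * (\<Prod>i = 1..r. C (h i) (f i)))" for f
  have "t s = (\<Sum>f\<in>indices. a f * btensor f s)" for s
  proof (cases "s \<in> indices")
    case False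
    then show ?thesis using t by (simp add: tensor_space_def pure_tensor_def)
  next
    case True
    have delta: "(\<Prod>i = 1..r. if s i = h i then 1 else 0 :: 'k) = (if h = s then 1 else 0)" if h: "h \<in> indices" for h
    proof (cases "h = s")
      case False
      then obtain i where i: "s i \<noteq> h i" by (metis ext)
      then have "i \<in> {1..r}" using True h by (metis multi_indices_def PiE_arb)
      then have "(\<Prod>i = 1..r. if s i = h i then 1 else 0 :: 'k) = 0" using i by (intro prod_zero) auto
      then show ?thesis using False by simp
    qed simp
    have "(\<Sum>f\<in>indices. a f * btensor f s) =
      (\<Sum>f\<in>indices. \<Sum>h\<in>indices. t h * (\<Prod>i = 1..r. C (h i) (f i) * b (f i) $ s i))"
      unfolding a_def sum_distrib_right using True
      by (intro sum.cong refl) (simp add: pure_tensor_def prod.distrib mult.assoc)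
    also have "\<dots> = (\<Sum>h\<in>indices. t h * (\<Sum>f\<in>indices. \<Prod>i = 1..r. C (h i) (f i) * b (f i) $ s i))"
      unfolding sum_distrib_left by (rule sum.swap)
    also have "\<dots> = (\<Sum>h\<in>indices. t h * (\<Prod>i = 1..r. \<Sum>j\<in>UNIV. C (h i) j * b j $ s i))"
      unfolding multi_indices_def by (subst prod_sum_PiE) auto
    also have "\<dots> = (\<Sum>h\<in>indices. if h = s then t h else 0)"
      unfolding ax[symmetric]
    proof (intro sum.cong refl)
      fix h assume h: "h \<in> indices"
      show "t h * (\<Prod>i = 1..r. if s i = h i then 1 else 0) = (if h = s then t h else 0)"
        unfolding delta[OF h] by simp
    qed
    also have "\<dots> = t s" using True by simp
    finally show ?thesis ..
  qed
  then show ?thesis using that by blast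
qed

text \<open>An operator vanishes iff its matrix does: \<open>coeff_at\<close> recovers the entries,
  and the basis tensors span. On \<open>{1..2 * r}\<close> every colouring \<open>h\<close> has the
  form \<open>join r f g\<close> with \<open>f\<close> and \<open>g\<close> multi-indices.\<close>

theorem kernel_eq:
  "a_kernel (brauer_algebra r (of_nat CARD('n) :: 'k)) (equivariant_End r B) \<nu> = {x \<in> carrier (brauer_algebra r (of_nat CARD('n) :: 'k)). \<forall>h :: nat \<Rightarrow> 'n. ev r x h = 0}"
proof -
  have "\<nu> x = \<zero>\<^bsub>equivariant_End r B\<^esub> \<longleftrightarrow> (\<forall>h :: nat \<Rightarrow> 'n. ev r x h = 0)" if x: "x \<in> carrier (brauer_algebra r (of_nat CARD('n) :: 'k))" for x
  proof
    assume zero: "\<nu> x = \<zero>\<^bsub>equivariant_End r B\<^esub>"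
    show "\<forall>h :: nat \<Rightarrow> 'n. ev r x h = 0"
    proof
      fix h :: "nat \<Rightarrow> 'n"
      define f g where "f = restrict h {1..r}" and "g = restrict (\<lambda>i. h (i + r)) {1..r}"
      have fI: "f \<in> indices" "g \<in> indices" by (auto simp: f_def g_def multi_indices_def)
      have "(\<lambda>t. \<Sum>f'\<in>indices. ev r x (join r f' g) * btensor f' t) = (\<lambda>t. 0)"
        unfolding nu_btensor[OF x, symmetric] zero by (simp add: equivariant_End_simps pure_tensor_closed)
      then have "coeff_at f (\<lambda>t. \<Sum>f'\<in>indices. ev r x (join r f' g) * btensor f' t) = 0"
        by (simp add: coeff_at_def)
      moreover have "coeff_at f (\<lambda>t. \<Sum>f'\<in>indices. ev r x (join r f' g) * btensor f' t) =
        (\<Sum>f'\<in>indices. ev r x (join r f' g) * coeff_at f (btensor f'))"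
        unfolding coeff_at_def sum_distrib_right sum_distrib_left
        by (subst sum.swap) (simp only: mult.assoc)
      moreover have "\<dots> = (\<Sum>f'\<in>indices. if f' = f then ev r x (join r f' g) else 0)"
        by (intro sum.cong refl) (simp add: coeff_at_btensor[OF fI(1)])
      ultimately have "ev r x (join r f g) = 0" using fI(1) by simp
      moreover have "ev r x (join r f g) = ev r x h"
      proof -
        have "compat (join r f g) D \<longleftrightarrow> compat h D" if "D \<in> brauer_diagrams r" for D
          by (rule compat_cong[OF that]) (auto simp: join_def f_def g_def)
        then show ?thesis unfolding ev_def by (intro sum.cong refl) simp
      qed
      ultimately show "ev r x h = 0" by simp
    qed
  next
    assume ev: "\<forall>h :: nat \<Rightarrow> 'n. ev r x h = 0"
    have z: "\<nu> x t = (\<lambda>f. 0)" if tS: "t \<in> tensor_space r" for t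
    proof -
      obtain a where a: "t = (\<lambda>s. \<Sum>f\<in>indices. a f * btensor f s)" by (rule tensor_expand[OF tS])
      have "\<nu> x t = (\<lambda>s. \<Sum>f\<in>indices. a f * \<nu> x (btensor f) s)"
        unfolding a by (rule tensor_linear_sum[OF nu_closed(1)[OF x] pure_tensor_closed]) simp
      then show ?thesis using ev by (simp add: nu_btensor[OF x])
    qed
    have "\<nu> x t = (\<lambda>t\<in>tensor_space r. \<lambda>f. 0) t" for t
      using z[of t] PiE_arb[OF nu_closed(2)[OF x], of t] by (cases "t \<in> tensor_space r") auto
    then show "\<nu> x = \<zero>\<^bsub>equivariant_End r B\<^esub>" unfolding equivariant_End_simps by blast
  qed
  then show ?thesis unfolding a_kernel_def' by blast
qed

end

section \<open>The common zeros of the colouring functionals form an ideal\<close>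

lemma ev_mult:
  fixes x y :: "diagram \<Rightarrow> 'a::comm_ring_1" and f g :: "nat \<Rightarrow> 'c::finite"
  shows "ev r (x \<otimes>\<^bsub>brauer_algebra r (of_nat CARD('c))\<^esub> y) (join r f g) =
    (\<Sum>k\<in>multi_indices r. ev r x (join r f k) * ev r y (join r k g))"
proof -
  let ?B = "brauer_diagrams r" and ?m = "\<lambda>D f g. of_bool (compat (join r f g) D) :: 'a"
  let ?M = "multi_indices r :: (nat \<Rightarrow> 'c) set"
  have "ev r (x \<otimes>\<^bsub>brauer_algebra r (of_nat CARD('c))\<^esub> y) (join r f g) =
    (\<Sum>D\<^sub>1\<in>?B. \<Sum>D\<^sub>2\<in>?B. x D\<^sub>1 * y D\<^sub>2 * (of_nat CARD('c) ^ loop_count r D\<^sub>1 D\<^sub>2 * ?m (diagram_comp r D\<^sub>1 D\<^sub>2) f g))"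
    unfolding ev_def by (rule brauer_mult_pairing)
  also have "\<dots> = (\<Sum>D\<^sub>1\<in>?B. \<Sum>D\<^sub>2\<in>?B. \<Sum>k\<in>?M. (x D\<^sub>1 * ?m D\<^sub>1 f k) * (y D\<^sub>2 * ?m D\<^sub>2 k g))"
    by (intro sum.cong refl) (simp only: sum_middle_colourings[symmetric] sum_distrib_left mult_ac)
  also have "\<dots> = (\<Sum>D\<^sub>1\<in>?B. \<Sum>k\<in>?M. \<Sum>D\<^sub>2\<in>?B. (x D\<^sub>1 * ?m D\<^sub>1 f k) * (y D\<^sub>2 * ?m D\<^sub>2 k g))"
    by (intro sum.cong refl) (rule sum.swap)
  also have "\<dots> = (\<Sum>k\<in>?M. \<Sum>D\<^sub>1\<in>?B. \<Sum>D\<^sub>2\<in>?B. (x D\<^sub>1 * ?m D\<^sub>1 f k) * (y D\<^sub>2 * ?m D\<^sub>2 k g))"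
    by (rule sum.swap)
  also have "\<dots> = (\<Sum>k\<in>?M. ev r x (join r f k) * ev r y (join r k g))"
    unfolding ev_def sum_product ..
  finally show ?thesis .
qed

text \<open>By \<open>ev_mult\<close> the values of \<open>ev\<close> multiply like matrices, and a
  matrix product with a zero factor vanishes.\<close>

lemma ev_kernel_ideal:
  "ideal {x \<in> carrier (brauer_algebra r (of_nat CARD('c::finite) :: 'a::comm_ring_1)). \<forall>h :: nat \<Rightarrow> 'c. ev r x h = 0}
    (brauer_algebra r (of_nat CARD('c)))" (is "ideal ?K ?R")
proof (rule idealI[OF brauer_ring])
  interpret ring ?R by (rule brauer_ring)
  have split: "h = join r h (\<lambda>v. h (v + r))" for h :: "nat \<Rightarrow> 'c" by (simp add: join_split)
  show "subgroup ?K (add_monoid ?R)"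
  proof (rule subgroup.intro)
    show "?K \<subseteq> carrier (add_monoid ?R)" by auto
    show "x \<otimes>\<^bsub>add_monoid ?R\<^esub> y \<in> ?K" if "x \<in> ?K" "y \<in> ?K" for x y
      using that by (auto simp: ev_add)
    show "\<one>\<^bsub>add_monoid ?R\<^esub> \<in> ?K" by (auto simp: ev_def)
    show "m_inv (add_monoid ?R) x \<in> ?K" if x: "x \<in> ?K" for x
    proof -
      have "\<ominus>\<^bsub>?R\<^esub> x = (\<lambda>D. - x D)"
        by (rule minus_equality) (use x in auto)
      moreover have "ev r (\<lambda>D. - x D) h = - ev r x h" for h :: "nat \<Rightarrow> 'c"
        by (simp add: ev_def sum_negf)
      ultimately show ?thesis using x unfolding a_inv_def by auto
    qed
  qed
  fix a x assume a: "a \<in> ?K" and x: "x \<in> carrier ?R"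
  have "ev r (x \<otimes>\<^bsub>?R\<^esub> a) h = 0" "ev r (a \<otimes>\<^bsub>?R\<^esub> x) h = 0" for h :: "nat \<Rightarrow> 'c"
    by (subst split, subst ev_mult, use a in simp)+
  then show "x \<otimes>\<^bsub>?R\<^esub> a \<in> ?K" "a \<otimes>\<^bsub>?R\<^esub> x \<in> ?K" using brauer_mult_closed by blast+
qed

theorem theorem9p4:
  fixes n r :: nat
    and B :: "'k::field ^ 'n::finite \<Rightarrow> 'k ^ 'n \<Rightarrow> 'k"
    and b :: "'n \<Rightarrow> 'k ^ 'n"
    and \<nu> :: "(diagram \<Rightarrow> 'k) \<Rightarrow> ('k, 'n) tensor \<Rightarrow> ('k, 'n) tensor"
  assumes "n = CARD('n)"
    and "n \<ge> 1"
    and "r \<ge> n + 1"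
    and "CHAR('k) > 2 * (n + 1)"
    and "symmetric_bilinear_form B"
    and "orthonormal_basis B b"
    and "brauer_homomorphism r B b \<nu>"
  shows "a_kernel (brauer_algebra r (of_nat n)) (equivariant_End r B) \<nu> =
           Idl\<^bsub>brauer_algebra r (of_nat n)\<^esub> {E_elem n r ((n + 1) div 2)}"
proof -
  interpret brauer_hom_setup r B b \<nu> by unfold_locales (rule assms)+
  let ?R = "brauer_algebra r (of_nat n :: 'k)" and ?i = "(n + 1) div 2"
  let ?E = "E_elem n r ?i :: diagram \<Rightarrow> 'k" and ?I = "perm_diagram r id"
  let ?J = "{1..?i} \<union> {r + ?i + 1..r + n + 1}"
  let ?K = "{x \<in> carrier ?R. \<forall>h :: nat \<Rightarrow> 'n. ev r x h = 0}"
  \<comment> \<open>The bound on the characteristic makes \<open>1, ..., 2 * (n + 1)\<close> nonzero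
    in the field, in particular 2 and the integers up to \<open>n + 1\<close> among which the Garnir
    step finds its divisors.\<close>
  have nz: "of_nat k \<noteq> (0 :: 'k)" if "1 \<le> k" "k \<le> 2 * (n + 1)" for k
  proof
    assume "of_nat k = (0 :: 'k)"
    then have "CHAR('k) dvd k" by (simp add: of_nat_eq_0_iff_char_dvd)
    then have "CHAR('k) \<le> k" using that(1) by (intro dvd_imp_le) auto
    then show False using that assms(4) by simp
  qed
  have two: "(2 :: 'k) \<noteq> 0" using nz[of 2] by simp
  have E: "?E = asym ?J (basis_diagram ?I)" by (rule E_elem_eq_asym) (use assms(3) in auto)
  have JV: "?J \<subseteq> {1..2 * r}" using assms(3) by auto
  have cJ: "card ?J = n + 1" 
  proof -
    have "card ?J = card {1..?i} + card {r + ?i + 1..r + n + 1}"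
      by (rule card_Un_disjoint) (use assms(3) in auto)
    then show ?thesis by simp
  qed
  have Ec: "?E \<in> carrier ?R" unfolding E by (intro asym_closed JV basis_closed id_diagram_closed)
  have ker: "a_kernel ?R (equivariant_End r B) \<nu> = ?K" using kernel_eq unfolding assms(1)[symmetric] .
  interpret R: ring ?R by (rule brauer_ring)
  have idl: "ideal (Idl\<^bsub>?R\<^esub> {?E}) ?R" by (rule R.genideal_ideal) (use Ec in blast)
  \<comment> \<open>The ideal generated by \<open>E\<close> takes the role of \<open>P\<close>;
    since \<open>E\<close> is the standard antisymmetrisation with \<open>k = (n + 1) div 2\<close>,
    it provides the starting point of \<open>all_good\<close>.\<close>
  interpret gadget_ideal r "n + 1" "of_nat n :: 'k" "Idl\<^bsub>?R\<^esub> {?E}"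
  proof (rule gadget_ideal.intro[OF idl two])
    show "of_nat k \<noteq> (0 :: 'k)" if "1 \<le> k" "k \<le> n + 1" for k by (rule nz) (use that in auto)
  qed (rule assms(3))
  have std: "asym (std_set ((n + 1) div 2)) (basis_diagram ?I) \<in> Idl\<^bsub>?R\<^esub> {?E}"
  proof -
    have "?E \<in> Idl\<^bsub>?R\<^esub> {?E}" by (rule R.genideal_self'[OF Ec])
    moreover have "std_set ((n + 1) div 2) = ?J" by (simp only: std_set_def add.assoc)
    ultimately show ?thesis unfolding E by simp
  qed
  have "?K \<subseteq> Idl\<^bsub>?R\<^esub> {?E}"
  proof
    fix x assume x: "x \<in> ?K"
    show "x \<in> Idl\<^bsub>?R\<^esub> {?E}"
    proof (rule colouring_relations[OF two lin])
      fix D J assume "D \<in> brauer_diagrams r" "J \<subseteq> {1..2 * r}" "card J = CARD('n) + 1"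
      then show "asym J (basis_diagram D) \<in> Idl\<^bsub>?R\<^esub> {?E}"
        unfolding assms(1)[symmetric] by (rule all_good[OF std])
    qed (use x in auto)
  qed
  moreover have "Idl\<^bsub>?R\<^esub> {?E} \<subseteq> ?K"
  proof (rule R.genideal_minimal)
    show "ideal ?K ?R" using ev_kernel_ideal[where 'c = 'n and 'a = 'k, of r] unfolding assms(1)[symmetric] .
    have "ev r ?E h = 0" for h :: "nat \<Rightarrow> 'n"
      unfolding E by (rule ev_asym_eq_0[OF id_diagram_closed JV _ two]) (use cJ assms(1) in simp)
    then show "{?E} \<subseteq> ?K" using Ec by blast
  qed
  ultimately show ?thesis unfolding ker by blast
qed

end
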